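(* Let $p\in[0,1]$ and let $m$ be any probability measure on $(0,\infty)$. Consider ballistic annihilation with random lengths on $\mathbb R_+$ with parameters $p$ and $m$, and let $$A=\min\{n\ge1 : \bullet_n \text{ crosses } 0 \text{ from the right}\}\in\{1,2,\dots\}\cup\{\infty\}.$$ a) The random variables $(A,x_A)$ and $(A,\widetilde x_A)$ have the same distribution given $\{A<\infty\}$ (when this event has positive probability), where $\widetilde x=(\widetilde x_n)_{n\ge1}$ is a copy of $x=(x_n)_{n\ge1}$ that is independent of $A$. b) Let $\mathcal L_\ell(\lambda)=\mathbb E[e^{-\lambda x_1}]$ be the Laplace transform of $x_1=\ell_1$, let $D=x_A$ (with $D=\infty$ if $A=\infty$), and let $\mathcal L_D(\lambda)=\mathbb E[e^{-\lambda D}\mathbf 1_{\{D<\infty\}}]$ be the Laplace transform of $D$. Then for all $\lambda\in\mathbb R_+$, $$p\,\mathcal L_\ell(\lambda)\,\mathcal L_D(\lambda)^4-(1+2p)\,\mathcal L_\ell(\lambda)\,\mathcal L_D(\lambda)^2+2\,\mathcal L_D(\lambda)-(1-p)\,\mathcal L_\ell(\lambda)=0.$$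
   Context: **Model (random lengths).** Let $(\ell_k)_{k\ge1}$ be i.i.d. with law $m$, $(v_k)_{k\ge1}$ i.i.d. with law $\frac{1-p}2\delta_{-1}+p\,\delta_0+\frac{1-p}2\delta_{+1}$, and $(s_k)_{k\ge1}$ i.i.d. uniform on $\{-1,+1\}$ ("spins"), the three sequences being independent. Put $x_n=\ell_1+\cdots+\ell_n$ for $n\ge1$. **Dynamics.** At time $0$, particles $\bullet_1,\bullet_2,\dots$ start at $x_1<x_2<\cdots$ on the real line and move at constant velocities $v_1,v_2,\dots$ until they are annihilated. When exactly two (not yet annihilated) particles meet, both are annihilated. When three particles meet (necessarily one right-moving, one static $\bullet_i$, one left-moving), the static particle and one of the two moving particles annihilate each other, and the other moving particle continues unperturbed: the left-moving one survives if $s_i=-1$, the right-moving one if $s_i=+1$. Annihilated particles are removed from the system. "$\bullet_n$ crosses $0$ from the right" means $v_n=-1$ and $\bullet_n$ is not annihilated when or before it reaches location $0$; whether this occurs depends only on $\bullet_1,\dots,\bullet_n$. By convention $\min\emptyset=\infty$. *)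

theory Defs
  imports "HOL-Probability.Probability"
begin

section \<open>Deterministic dynamics\<close>

text \<open>
  A configuration consists of initial positions \<open>x\<close>, velocities \<open>v\<close> and spins \<open>s\<close> of particles
  indexed by a set \<open>I\<close> of natural numbers. The evolution of the system is described by the
  annihilation times \<open>T\<close> of the particles, where \<open>T i = \<infinity>\<close> means that particle \<open>i\<close> is never
  annihilated.
\<close>

text \<open>The particles that reach location \<open>y\<close> at time \<open>t\<close> without having been annihilated
  strictly before time \<open>t\<close>:\<close>

definition present ::
  "nat set \<Rightarrow> (nat \<Rightarrow> real) \<Rightarrow> (nat \<Rightarrow> real) \<Rightarrow> (nat \<Rightarrow> ereal) \<Rightarrow> real \<Rightarrow> real \<Rightarrow> nat set" where
  "present I x v T t y = {i \<in> I. ereal t \<le> T i \<and> x i + v i * t = y}"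

text \<open>The members of a group \<open>C\<close> of particles meeting at one point that are annihilated there.
  In a triple collision, the survivor is the particle whose velocity is the spin of the
  static particle.\<close>

definition annihilated :: "(nat \<Rightarrow> real) \<Rightarrow> (nat \<Rightarrow> real) \<Rightarrow> nat set \<Rightarrow> nat set" where
  "annihilated v s C =
     (if card C = 2 then C
      else if card C = 3 then {i \<in> C. \<not> (\<exists>j\<in>C. v j = 0 \<and> v i = s j)}
      else {})"

definition evolution ::
  "nat set \<Rightarrow> (nat \<Rightarrow> real) \<Rightarrow> (nat \<Rightarrow> real) \<Rightarrow> (nat \<Rightarrow> real) \<Rightarrow> (nat \<Rightarrow> ereal) \<Rightarrow> bool" where
  "evolution I x v s T \<longleftrightarrow>
     (\<forall>i\<in>I. 0 \<le> T i) \<and>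
     (\<forall>t\<ge>0. \<forall>y. {i \<in> present I x v T t y. T i = ereal t} = annihilated v s (present I x v T t y))"

text \<open>
  Particle \<open>n\<close>, if left-moving, reaches \<open>0\<close> at time \<open>x n\<close>. Whether it gets there only depends on
  the particles \<open>1, \<dots>, n\<close>, so the dynamics is run with these only; finite systems have exactly
  one evolution (lemmas \<open>evolution_exists\<close> and \<open>evolution_unique\<close>), and any evolution of a larger,
  possibly infinite, system gives the same answer (lemma \<open>crosses_zero_iff\<close>).
\<close>

definition crosses_zero :: "(nat \<Rightarrow> real) \<Rightarrow> (nat \<Rightarrow> real) \<Rightarrow> (nat \<Rightarrow> real) \<Rightarrow> nat \<Rightarrow> bool" where
  "crosses_zero x v s n \<longleftrightarrow> v n = -1 \<and> (\<exists>T. evolution {1..n} x v s T \<and> ereal (x n) < T n)"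

text \<open>The infimum of the empty set is \<open>\<infinity>\<close> in type \<open>enat\<close>.\<close>

definition first_crossing :: "(nat \<Rightarrow> real) \<Rightarrow> (nat \<Rightarrow> real) \<Rightarrow> (nat \<Rightarrow> real) \<Rightarrow> enat" where
  "first_crossing x v s = (INF n \<in> {n. 1 \<le> n \<and> crosses_zero x v s n}. enat n)"

definition value_at :: "(nat \<Rightarrow> real) \<Rightarrow> enat \<Rightarrow> ereal" where
  "value_at x a = (case a of enat n \<Rightarrow> ereal (x n) | \<infinity> \<Rightarrow> \<infinity>)"


section \<open>Well-definedness of the dynamics\<close>

lemma annihilated_subset: "annihilated v s C \<subseteq> C"
  by (auto simp: annihilated_def)

lemma annihilated_nonempty:
  assumes "card C \<ge> 2" "finite C" "inj_on v C" "\<And>i. i \<in> C \<Longrightarrow> v i \<in> {-1, 0, 1}"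
    "\<And>i. i \<in> C \<Longrightarrow> s i \<noteq> 0"
  shows "annihilated v s C \<noteq> {}"
proof -
  have im: "v ` C \<subseteq> {-1, 0, 1}" using assms(4) by auto
  have cv: "card (v ` C) = card C" using assms(3) by (rule card_image)
  have "card (v ` C) \<le> card {-1, 0, 1 :: real}" by (rule card_mono) (use im in auto)
  then consider "card C = 2" | "card C = 3" using assms(1) cv by fastforce
  then show ?thesis
  proof cases
    case 1
    then show ?thesis by (auto simp: annihilated_def)
  next
    case 2
    have "v ` C = {-1, 0, 1}"
      by (rule card_subset_eq) (use im cv 2 in auto)
    then obtain j where j: "j \<in> C" "v j = 0" by (metis imageE insertCI)
    have "v j \<noteq> s k" if "k \<in> C" for k using j assms(5)[OF that] by simp
    then have "j \<in> annihilated v s C" using 2 j by (auto simp: annihilated_def)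
    then show ?thesis by blast
  qed
qed

lemma evolution_from:
  assumes "finite I" "inj_on x I" "\<And>i. i \<in> I \<Longrightarrow> v i \<in> {-1, 0, 1}" "\<And>i. i \<in> I \<Longrightarrow> s i \<noteq> 0"
  shows "\<exists>T. (\<forall>i\<in>I. ereal t0 < T i) \<and> (\<forall>t>t0. \<forall>y.
    {i \<in> present I x v T t y. T i = ereal t} = annihilated v s (present I x v T t y))"
  using assms
proof (induction "card I" arbitrary: I t0 rule: less_induct)
  case less
  define S where "S = {t. t0 < t \<and> (\<exists>i\<in>I. \<exists>j\<in>I. i \<noteq> j \<and> x i + v i * t = x j + v j * t)}"
  have meet: "t = (x j - x i) / (v i - v j) \<and> v i \<noteq> v j"
    if "i \<in> I" "j \<in> I" "i \<noteq> j" "x i + v i * t = x j + v j * t" for i j t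
  proof -
    have "x i \<noteq> x j" using that less.prems(2) by (auto simp: inj_on_def)
    then have "v i \<noteq> v j" using that by auto
    then show ?thesis using that by (auto simp: field_simps)
  qed
  have "S \<subseteq> (\<lambda>(i, j). (x j - x i) / (v i - v j)) ` (I \<times> I)"
    unfolding S_def using meet by fastforce
  then have finS: "finite S" by (rule finite_subset) (use less.prems in auto)
  have small: "card {i \<in> I. x i + v i * t = y} \<le> 1" if "t0 < t" "t \<notin> S" for t y
  proof -
    have "i = j" if "i \<in> {i \<in> I. x i + v i * t = y}" "j \<in> {i \<in> I. x i + v i * t = y}" for i j
      using that \<open>t0 < t\<close> \<open>t \<notin> S\<close> unfolding S_def by auto
    then show ?thesis using less.prems(1) by (auto simp: card_le_Suc0_iff_eq)
  qed
  show ?case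
  proof (cases "S = {}")
    case True
    have "annihilated v s (present I x v (\<lambda>_. \<infinity>) t y) = {}" if "t0 < t" for t y
    proof -
      have "card (present I x v (\<lambda>_. \<infinity>) t y) \<le> 1"
        using small[of t y] that True by (simp add: present_def)
      then show ?thesis by (auto simp: annihilated_def)
    qed
    then show ?thesis by (intro exI[of _ "\<lambda>_. \<infinity>"]) auto
  next
    case False
    define t1 where "t1 = Min S"
    have t1: "t1 \<in> S" unfolding t1_def using finS False by (rule Min_in)
    have t1_le: "t1 \<le> t" if "t \<in> S" for t unfolding t1_def using finS that by (rule Min_le)
    have t01: "t0 < t1" using t1 by (simp add: S_def)
    define C where "C y = {i \<in> I. x i + v i * t1 = y}" for y
    define K where "K = (\<Union>y. annihilated v s (C y))"
    have KI: "K \<subseteq> I" unfolding K_def C_def using annihilated_subset by fastforce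
    have KC: "K \<inter> C y = annihilated v s (C y)" for y
      unfolding K_def using annihilated_subset[of v s "C _"] by (auto simp: C_def)
    obtain i j where ij: "i \<in> I" "j \<in> I" "i \<noteq> j" "x i + v i * t1 = x j + v j * t1"
      using t1 unfolding S_def by auto
    define y where "y = x i + v i * t1"
    have "annihilated v s (C y) \<noteq> {}"
    proof (rule annihilated_nonempty)
      have "card {i, j} \<le> card (C y)"
        by (rule card_mono) (use ij less.prems in \<open>auto simp: C_def y_def\<close>)
      then show "2 \<le> card (C y)" using ij by simp
      show "finite (C y)" using less.prems by (simp add: C_def)
      show "inj_on v (C y)" by (rule inj_onI) (use meet in \<open>fastforce simp: C_def\<close>)
    qed (use less.prems in \<open>auto simp: C_def\<close>)
    then have "K \<noteq> {}" unfolding K_def by auto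
    then have "card (I - K) < card I" using KI less.prems(1) by (intro psubset_card_mono) auto
    then have "\<exists>T. (\<forall>i\<in>I - K. ereal t1 < T i) \<and> (\<forall>t>t1. \<forall>y.
      {i \<in> present (I - K) x v T t y. T i = ereal t} = annihilated v s (present (I - K) x v T t y))"
      by (rule less.hyps) (use less.prems in \<open>auto intro: inj_on_diff\<close>)
    then obtain T' where T':
      "\<forall>i\<in>I - K. ereal t1 < T' i"
      "\<And>t y. t > t1 \<Longrightarrow> {i \<in> present (I - K) x v T' t y. T' i = ereal t}
        = annihilated v s (present (I - K) x v T' t y)"
      by blast
    define T where "T i = (if i \<in> K then ereal t1 else T' i)" for i
    have T_ge: "ereal t1 \<le> T i" if "i \<in> I" for i
      using that T'(1) by (auto simp: T_def less_imp_le)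
    have "{i \<in> present I x v T t y. T i = ereal t} = annihilated v s (present I x v T t y)"
      if "t0 < t" for t y
    proof -
      consider "t < t1" | "t = t1" | "t > t1" by linarith
      then show ?thesis
      proof cases
        case 1
        have "ereal t < T i" if "i \<in> I" for i using T_ge[OF that] 1
          by (meson ereal_less_eq(3) less_ereal.simps(1) order_less_le_trans)
        then have P: "present I x v T t y = {i \<in> I. x i + v i * t = y}"
          and E: "{i \<in> present I x v T t y. T i = ereal t} = {}"
          by (fastforce simp: present_def)+
        have "card (present I x v T t y) \<le> 1"
          unfolding P by (rule small) (use 1 t1_le \<open>t0 < t\<close> in force)+
        then show ?thesis unfolding E by (auto simp: annihilated_def)
      next
        case 2
        have P: "present I x v T t y = C y" using T_ge 2 by (auto simp: present_def C_def)
        have "T' i \<noteq> ereal t1" if "i \<in> I - K" for i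
          using T'(1) that by (metis less_irrefl)
        then have "{i \<in> C y. T i = ereal t} = K \<inter> C y"
          using 2 by (auto simp: T_def C_def)
        then show ?thesis unfolding P KC .
      next
        case 3
        have P: "present I x v T t y = present (I - K) x v T' t y"
          using 3 by (auto simp: present_def T_def split: if_splits)
        have "{i \<in> present I x v T t y. T i = ereal t}
          = {i \<in> present (I - K) x v T' t y. T' i = ereal t}"
          unfolding P by (auto simp: present_def T_def)
        then show ?thesis unfolding P using T'(2)[OF 3] by simp
      qed
    qed
    moreover have "ereal t0 < T i" if "i \<in> I" for i
      using T_ge[OF that] t01 by (meson less_ereal.simps(1) order_less_le_trans)
    ultimately show ?thesis by (intro exI[of _ T]) auto
  qed
qed

lemma evolution_exists:
  assumes "finite I" "inj_on x I" "\<And>i. i \<in> I \<Longrightarrow> v i \<in> {-1, 0, 1}" "\<And>i. i \<in> I \<Longrightarrow> s i \<noteq> 0"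
  shows "\<exists>T. evolution I x v s T"
proof -
  obtain T where T: "\<forall>i\<in>I. ereal 0 < T i"
    "\<And>t y. t > 0 \<Longrightarrow>
      {i \<in> present I x v T t y. T i = ereal t} = annihilated v s (present I x v T t y)"
    using evolution_from[of I x v s 0] assms by blast
  have "{i \<in> present I x v T 0 y. T i = ereal 0} = annihilated v s (present I x v T 0 y)" for y
  proof -
    have "card (present I x v T 0 y) \<le> Suc 0"
      using assms(1,2) by (subst card_le_Suc0_iff_eq) (auto simp: present_def inj_on_def)
    moreover have "{i \<in> present I x v T 0 y. T i = ereal 0} = {}"
      using T(1) by (fastforce simp: present_def)
    ultimately show ?thesis by (auto simp: annihilated_def)
  qed
  then have "evolution I x v s T"
    unfolding evolution_def using T by (metis less_imp_le order_le_less zero_ereal_def)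
  then show ?thesis by blast
qed

text \<open>Two evolutions agree inside a space-time region \<open>E\<close> that is entered by no other particles
  and left by no particle backwards in time.\<close>

lemma evolution_agree:
  assumes T: "evolution I x v s T" and T': "evolution J x v s T'" and J: "J \<subseteq> I" "finite J"
    and down: "\<And>i t t'. i \<in> J \<Longrightarrow> E i t \<Longrightarrow> t' \<le> t \<Longrightarrow> E i t'"
    and meet: "\<And>i j t. i \<in> J \<Longrightarrow> j \<in> I \<Longrightarrow> 0 \<le> t \<Longrightarrow> E i t \<Longrightarrow> x j + v j * t = x i + v i * t
      \<Longrightarrow> j \<in> J \<and> E j t"
    and all: "\<And>t. E n t" and n: "n \<in> J"
  shows "T n = T' n"
proof (rule ccontr)
  assume neq: "T n \<noteq> T' n"
  have nonneg: "0 \<le> T i" "0 \<le> T' i" if "i \<in> J" for i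
    using T T' J that by (auto simp: evolution_def)
  define d where "d i = real_of_ereal (min (T i) (T' i))" for i
  have d: "ereal (d i) = min (T i) (T' i)" "0 \<le> d i" if "i \<in> J" "T i \<noteq> T' i" for i
    using nonneg[OF that(1)] that(2)
    by (cases "T i"; cases "T' i"; auto simp: d_def min_def)+
  define B where "B = {i \<in> J. T i \<noteq> T' i \<and> E i (d i)}"
  have "n \<in> B" using neq all n by (simp add: B_def)
  moreover have "finite B" using J by (simp add: B_def)
  ultimately obtain i where i: "i \<in> B" and least: "\<And>j. j \<in> B \<Longrightarrow> d i \<le> d j"
    using arg_min_if_finite(1)[of B d] arg_min_least[of B _ d] by blast
  define t where "t = d i"
  define y where "y = x i + v i * t"
  have iJ: "i \<in> J" and ineq: "T i \<noteq> T' i" and Ei: "E i t"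
    using i by (auto simp: B_def t_def)
  have t0: "0 \<le> t" and tmin: "ereal t = min (T i) (T' i)"
    using d[OF iJ ineq] by (auto simp: t_def)
  have same: "ereal t \<le> T j \<longleftrightarrow> ereal t \<le> T' j" if "j \<in> J" "E j t" for j
  proof (rule ccontr)
    assume "\<not> ?thesis"
    then have ne: "T j \<noteq> T' j" and "min (T j) (T' j) < ereal t" by auto
    then have "d j < t" using d(1)[OF that(1) ne] by (metis less_ereal.simps(1))
    moreover from this have "j \<in> B"
      using that ne down[of j t "d j"] by (simp add: B_def)
    ultimately show False using least[of j] by (simp add: t_def)
  qed
  have P: "present I x v T t y = present J x v T' t y"
    using meet[OF iJ _ t0 Ei] same J(1) by (auto simp: present_def y_def)
  then have "{j \<in> present I x v T t y. T j = ereal t} = {j \<in> present I x v T t y. T' j = ereal t}"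
    using T T' t0 unfolding evolution_def by metis
  moreover have "i \<in> present I x v T t y"
    using iJ J(1) tmin by (auto simp: present_def y_def min_def split: if_splits)
  ultimately have "T i = ereal t \<longleftrightarrow> T' i = ereal t" by blast
  then show False using ineq tmin by (auto simp: min_def split: if_splits)
qed

lemma evolution_unique:
  assumes "evolution I x v s T" "evolution I x v s T'" "finite I" "i \<in> I"
  shows "T i = T' i"
  by (rule evolution_agree[where E = "\<lambda>_ _. True", OF assms(1,2)]) (use assms in auto)

lemma crosses_zero_iff:
  assumes T: "evolution I x v s T" and I: "{1..n} \<subseteq> I" "I \<subseteq> {1..}" and "1 \<le> n"
    and x: "strict_mono_on I x"
    and v: "\<And>i. i \<in> I \<Longrightarrow> v i \<in> {-1, 0, 1}" and s: "\<And>i. i \<in> I \<Longrightarrow> s i \<in> {-1, 1}"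
  shows "crosses_zero x v s n \<longleftrightarrow> v n = -1 \<and> ereal (x n) < T n"
proof -
  have "T n = T' n" if T': "evolution {1..n} x v s T'" and vn: "v n = -1" for T'
  proof (rule evolution_agree[where E = "\<lambda>i t. x i + v i * t \<le> x n - t", OF T T' I(1)])
    fix i t t' assume "i \<in> {1..n}" and le: "x i + v i * t \<le> x n - t" and "t' \<le> (t :: real)"
    then have "i \<in> I" using I by auto
    then have "0 \<le> v i + 1" using v by fastforce
    then have "(v i + 1) * t' \<le> (v i + 1) * t" using \<open>t' \<le> t\<close> by (rule mult_left_mono[rotated])
    then show "x i + v i * t' \<le> x n - t'" using le by (simp add: algebra_simps)
  next
    fix i j and t :: real
    assume "i \<in> {1..n}" "j \<in> I" "0 \<le> t" and le: "x i + v i * t \<le> x n - t"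
      and eq: "x j + v j * t = x i + v i * t"
    have "-1 \<le> v j" using v[OF \<open>j \<in> I\<close>] by auto
    then have "- t \<le> v j * t" using mult_right_mono[OF _ \<open>0 \<le> t\<close>, of "-1" "v j"] by simp
    then have "x j \<le> x n" using le eq by linarith
    then have "\<not> n < j" using strict_mono_onD[OF x, of n j] \<open>j \<in> I\<close> I \<open>1 \<le> n\<close> by fastforce
    then show "j \<in> {1..n} \<and> x j + v j * t \<le> x n - t" using \<open>j \<in> I\<close> I le eq by auto
  qed (use vn \<open>1 \<le> n\<close> in auto)
  moreover have "\<exists>T'. evolution {1..n} x v s T'"
  proof (rule evolution_exists)
    show "inj_on x {1..n}"
      using strict_mono_on_imp_inj_on[OF x] I(1) by (rule inj_on_subset)
    show "v i \<in> {-1, 0, 1}" if "i \<in> {1..n}" for i using that I v by blast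
    show "s i \<noteq> 0" if "i \<in> {1..n}" for i using that I s[of i] by auto
  qed simp
  ultimately show ?thesis unfolding crosses_zero_def by metis
qed


section \<open>The random model\<close>

definition velocity_law :: "real \<Rightarrow> real measure" where
  "velocity_law p = point_measure {-1, 0, 1} (\<lambda>u. ennreal (if u = 0 then p else (1 - p) / 2))"

definition spin_law :: "real measure" where
  "spin_law = uniform_count_measure {-1, 1}"

text \<open>The assumption \<open>indep\<close> states the joint independence of all lengths, velocities and spins.\<close>

locale ballistic_annihilation = prob_space M for M :: "'a measure" +
  fixes p :: real and m :: "real measure"
    and l v s :: "nat \<Rightarrow> 'a \<Rightarrow> real"
  assumes p: "0 \<le> p" "p \<le> 1"
    and m: "prob_space m" "sets m = sets (restrict_space borel {0<..})"
    and law_l: "\<And>k. 1 \<le> k \<Longrightarrow> l k \<in> measurable M m" "\<And>k. 1 \<le> k \<Longrightarrow> distr M m (l k) = m"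
    and law_v: "\<And>k. 1 \<le> k \<Longrightarrow> v k \<in> measurable M (velocity_law p)"
      "\<And>k. 1 \<le> k \<Longrightarrow> distr M (velocity_law p) (v k) = velocity_law p"
    and law_s: "\<And>k. 1 \<le> k \<Longrightarrow> s k \<in> measurable M spin_law"
      "\<And>k. 1 \<le> k \<Longrightarrow> distr M spin_law (s k) = spin_law"
    and indep: "indep_vars
      (case_sum (\<lambda>_. m) (case_sum (\<lambda>_. velocity_law p) (\<lambda>_. spin_law)))
      (case_sum l (case_sum v s)) ({1..} <+> ({1..} <+> {1..}))"

definition position :: "(nat \<Rightarrow> 'a \<Rightarrow> real) \<Rightarrow> nat \<Rightarrow> 'a \<Rightarrow> real" where
  "position l n \<omega> = (\<Sum>k=1..n. l k \<omega>)"

text \<open>A sequence \<open>(x' n)\<close>, \<open>n \<ge> 1\<close>, with the same law as \<open>(x n)\<close>, \<open>n \<ge> 1\<close>, and independent of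
  \<open>A\<close>.\<close>

definition independent_copy ::
  "'a measure \<Rightarrow> (nat \<Rightarrow> 'a \<Rightarrow> real) \<Rightarrow> ('a \<Rightarrow> enat) \<Rightarrow> (nat \<Rightarrow> 'a \<Rightarrow> real) \<Rightarrow> bool" where
  "independent_copy M x A x' \<longleftrightarrow>
     (let S = Pi\<^sub>M {1..} (\<lambda>_. borel);
          X = (\<lambda>\<omega>. \<lambda>n\<in>{1..}. x n \<omega>);
          X' = (\<lambda>\<omega>. \<lambda>n\<in>{1..}. x' n \<omega>)
      in X' \<in> measurable M S \<and> distr M S X' = distr M S X \<and>
         prob_space.indep_set M
           (sets (vimage_algebra (space M) A (count_space UNIV)))
           (sets (vimage_algebra (space M) X' S)))"

text \<open>Every model can be enlarged, without changing its law, to one on which an independent copy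
  of the positions exists.\<close>

lemma distr_pair_fst_snd:
  assumes "prob_space M"
  shows "distr (M \<Otimes>\<^sub>M M) M fst = M" "distr (M \<Otimes>\<^sub>M M) M snd = M"
proof -
  interpret prob_space M by fact
  interpret P: pair_prob_space M M ..
  have 1: "fst -` B \<inter> space (M \<Otimes>\<^sub>M M) = B \<times> space M"
    and 2: "snd -` B \<inter> space (M \<Otimes>\<^sub>M M) = space M \<times> B" if "B \<in> sets M" for B
    using sets.sets_into_space[OF that] by (auto simp: space_pair_measure)
  show "distr (M \<Otimes>\<^sub>M M) M fst = M" "distr (M \<Otimes>\<^sub>M M) M snd = M"
    by (auto intro!: measure_eqI simp: emeasure_distr 1 2 emeasure_pair_measure_Times emeasure_space_1)
qed

lemma indep_vars_comp_preserving:
  assumes "prob_space M" "prob_space N" and f: "f \<in> measurable N M" "distr N M f = M"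
    and X: "prob_space.indep_vars M M' X I" and "I \<noteq> {}"
  shows "prob_space.indep_vars N M' (\<lambda>i. X i \<circ> f) I"
proof -
  interpret M: prob_space M by fact
  interpret N: prob_space N by fact
  have meas: "X i \<in> measurable M (M' i)" if "i \<in> I" for i
    using X that unfolding M.indep_vars_def by blast
  have law: "distr N (M' i) (X i \<circ> f) = distr M (M' i) (X i)" if "i \<in> I" for i
    using distr_distr[OF meas[OF that] f(1)] by (simp add: f)
  have "(\<lambda>\<omega>. \<lambda>i\<in>I. X i \<omega>) \<in> measurable M (Pi\<^sub>M I M')"
    by (rule measurable_restrict) (rule meas)
  from distr_distr[OF this f(1)]
  have "distr N (Pi\<^sub>M I M') (\<lambda>\<omega>. \<lambda>i\<in>I. (X i \<circ> f) \<omega>)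
      = distr M (Pi\<^sub>M I M') (\<lambda>\<omega>. \<lambda>i\<in>I. X i \<omega>)"
    by (simp add: f comp_def)
  also have "\<dots> = Pi\<^sub>M I (\<lambda>i. distr M (M' i) (X i))"
    by (rule M.indep_vars_iff_distr_eq_PiM'[THEN iffD1, OF \<open>I \<noteq> {}\<close> _ X]) (rule meas)
  also have "\<dots> = Pi\<^sub>M I (\<lambda>i. distr N (M' i) (X i \<circ> f))"
    by (rule PiM_cong) (simp_all only: law)
  finally have eq: "distr N (Pi\<^sub>M I M') (\<lambda>\<omega>. \<lambda>i\<in>I. (X i \<circ> f) \<omega>)
      = Pi\<^sub>M I (\<lambda>i. distr N (M' i) (X i \<circ> f))" .
  show ?thesis
    by (rule N.indep_vars_iff_distr_eq_PiM'[THEN iffD2, OF \<open>I \<noteq> {}\<close> _ eq])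
      (rule measurable_comp[OF f(1) meas])
qed

lemma ballistic_annihilation_enlarge:
  assumes "ballistic_annihilation M p m l v s"
  shows "ballistic_annihilation (M \<Otimes>\<^sub>M M) p m
    (\<lambda>k. l k \<circ> fst) (\<lambda>k. v k \<circ> fst) (\<lambda>k. s k \<circ> fst)"
proof -
  interpret ballistic_annihilation M p m l v s by fact
  interpret P: pair_prob_space M M ..
  have fst: "distr (M \<Otimes>\<^sub>M M) M fst = M" by (rule distr_pair_fst_snd) (rule prob_space_axioms)
  have law: "distr (M \<Otimes>\<^sub>M M) N (f \<circ> fst) = distr M N f" if "f \<in> measurable M N" for f :: "'a \<Rightarrow> real" and N
    using distr_distr[OF that measurable_fst, of M] by (simp add: fst)
  have "P.indep_vars (case_sum (\<lambda>_. m) (case_sum (\<lambda>_. velocity_law p) (\<lambda>_. spin_law)))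
      (\<lambda>i. case_sum l (case_sum v s) i \<circ> fst) ({1..} <+> ({1..} <+> {1..}))"
    by (rule indep_vars_comp_preserving[OF prob_space_axioms P.prob_space_axioms measurable_fst fst indep])
      auto
  also have "(\<lambda>i. case_sum l (case_sum v s) i \<circ> fst)
      = case_sum (\<lambda>k. l k \<circ> fst) (case_sum (\<lambda>k. v k \<circ> fst) (\<lambda>k. s k \<circ> fst))"
    by (auto simp: fun_eq_iff split: sum.split)
  finally have indep': "P.indep_vars (case_sum (\<lambda>_. m) (case_sum (\<lambda>_. velocity_law p) (\<lambda>_. spin_law)))
      (case_sum (\<lambda>k. l k \<circ> fst) (case_sum (\<lambda>k. v k \<circ> fst) (\<lambda>k. s k \<circ> fst)))
      ({1..} <+> ({1..} <+> {1..}))" .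
  show ?thesis
    by (intro ballistic_annihilation.intro ballistic_annihilation_axioms.intro P.prob_space_axioms
        p m indep') (simp_all add: law law_l law_v law_s measurable_comp[OF measurable_fst])
qed

lemma independent_copy_enlarge:
  assumes "prob_space M" "A \<in> measurable M (count_space UNIV)"
    and x: "\<And>n. 1 \<le> n \<Longrightarrow> x n \<in> borel_measurable M"
  shows "independent_copy (M \<Otimes>\<^sub>M M) (\<lambda>n. x n \<circ> fst) (A \<circ> fst) (\<lambda>n. x n \<circ> snd)"
proof -
  interpret prob_space M by fact
  interpret P: pair_prob_space M M ..
  define S where "S = Pi\<^sub>M {1::nat..} (\<lambda>_. borel :: real measure)"
  define X where "X = (\<lambda>\<omega>. \<lambda>n\<in>{1..}. x n \<omega>)"
  have X: "X \<in> measurable M S" unfolding X_def S_def by (intro measurable_restrict) (simp add: x)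
  have fst: "distr (M \<Otimes>\<^sub>M M) M fst = M" by (rule distr_pair_fst_snd) (rule prob_space_axioms)
  have snd: "distr (M \<Otimes>\<^sub>M M) M snd = M" by (rule distr_pair_fst_snd) (rule prob_space_axioms)
  have "distr (M \<Otimes>\<^sub>M M) S (X \<circ> snd) = distr (M \<Otimes>\<^sub>M M) S (X \<circ> fst)"
    using distr_distr[OF X measurable_fst, of M] distr_distr[OF X measurable_snd, of M]
    by (simp add: fst snd)
  moreover have "P.indep_set (sets (vimage_algebra (space (M \<Otimes>\<^sub>M M)) (A \<circ> fst) (count_space UNIV)))
      (sets (vimage_algebra (space (M \<Otimes>\<^sub>M M)) (X \<circ> snd) S))"
  proof (rule P.indep_setI)
    show "sets (vimage_algebra (space (M \<Otimes>\<^sub>M M)) (A \<circ> fst) (count_space UNIV)) \<subseteq> sets (M \<Otimes>\<^sub>M M)"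
      by (subst sets_vimage_algebra2)
        (use measurable_sets[OF measurable_comp[OF measurable_fst assms(2)]] in auto)
    show "sets (vimage_algebra (space (M \<Otimes>\<^sub>M M)) (X \<circ> snd) S) \<subseteq> sets (M \<Otimes>\<^sub>M M)"
      by (subst sets_vimage_algebra2)
        (use measurable_sets[OF measurable_comp[OF measurable_snd X]]
          measurable_space[OF measurable_comp[OF measurable_snd X]] in auto)
    fix a b
    assume "a \<in> sets (vimage_algebra (space (M \<Otimes>\<^sub>M M)) (A \<circ> fst) (count_space UNIV))"
    then obtain U where a: "a = (A \<circ> fst) -` U \<inter> space (M \<Otimes>\<^sub>M M)"
      by (subst (asm) sets_vimage_algebra2) auto
    assume "b \<in> sets (vimage_algebra (space (M \<Otimes>\<^sub>M M)) (X \<circ> snd) S)"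
    then obtain V where b: "b = (X \<circ> snd) -` V \<inter> space (M \<Otimes>\<^sub>M M)" and V: "V \<in> sets S"
      using measurable_space[OF measurable_comp[OF measurable_snd X]]
      by (subst (asm) sets_vimage_algebra2) auto
    have m: "A -` U \<inter> space M \<in> sets M" "X -` V \<inter> space M \<in> sets M"
      using measurable_sets[OF assms(2)] measurable_sets[OF X V] by auto
    have "a = (A -` U \<inter> space M) \<times> space M" "b = space M \<times> (X -` V \<inter> space M)"
      "a \<inter> b = (A -` U \<inter> space M) \<times> (X -` V \<inter> space M)"
      by (auto simp: a b space_pair_measure)
    then show "measure (M \<Otimes>\<^sub>M M) (a \<inter> b) = measure (M \<Otimes>\<^sub>M M) a * measure (M \<Otimes>\<^sub>M M) b"
      using m by (simp add: measure_def emeasure_pair_measure_Times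
        enn2real_mult emeasure_space_1)
  qed
  ultimately show ?thesis
    using X measurable_comp[OF measurable_snd X]
    by (simp add: independent_copy_def Let_def X_def S_def comp_def)
qed

end

theory Submission
  imports Defs "HOL-Computational_Algebra.Formal_Power_Series"
begin

text \<open>
  The event \<open>A = n\<close> says that, among the particles \<open>1, \<dots>, n\<close>, the last one moves left and survives
  while all others die. Write \<open>L(a,b)\<close> for this event in the block \<open>a, \<dots>, b\<close> (\<open>clears_left\<close>) and
  \<open>R(a,b)\<close> for its mirror image (\<open>clears_right\<close>). Fix a weight \<open>\<phi>\<close> with \<open>\<bar>\<phi>\<bar> \<le> 1\<close> and
  \<open>\<phi>(y + z) = \<phi>(y) \<phi>(z)\<close>, let \<open>c\<close> be the expectation of \<open>\<phi>(x\<^sub>1)\<close> and \<open>\<alpha> n\<close> that of \<open>\<phi>(x\<^sub>n)\<close> on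
  \<open>A = n\<close>. The proof finds a recursion for \<open>\<alpha>\<close> into which \<open>\<phi>\<close> and the law of the lengths enter
  through \<open>c\<close> only.

  If particle 1 moves left, then \<open>A = 1\<close>. If it is static, it is removed by the \<open>k\<close> with \<open>L(2,k)\<close>,
  and then \<open>L(k+1,n)\<close> is needed, a block that starts afresh (\<open>clears_left_static\<close>). If it moves
  right, there are two ways to \<open>L(1,n)\<close> (\<open>clears_left_right\<close>). Either particle 1 is annihilated by a
  static \<open>j\<close>, which happens if \<open>R(1,j-1)\<close> and particle 1 wins the race to \<open>j\<close> against the
  particle \<open>n\<close> with \<open>L(j+1,n)\<close>, which then passes (\<open>opens_way\<close>); or it is annihilated by a left-moving
  \<open>k\<close> (\<open>collide\<close>) and \<open>L(k+1,n)\<close> follows.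

  Let \<open>\<eta>\<close> and \<open>\<beta>\<close> be the weights of \<open>opens_way\<close> and \<open>collide\<close>. Reversing the block
  \<open>1, \<dots>, j\<close> turns \<open>R(1,j-1)\<close> into \<open>L(2,j)\<close>, so the race is between independent copies of the same
  variable; as a tie is broken by a fair spin, exchanging them shows that each side wins half of the time, whence
  \<open>2 \<eta> = p c X \<alpha>\<^sup>2\<close> for the generating series (\<open>\<eta>_recursion\<close>). The weight \<open>\<beta>\<close> is found
  by deleting the right-moving particle 1: if then \<open>k\<close> is the first to cross, either
  1 and \<open>k\<close> annihilate each other, or 1 opens the way for some \<open>m\<close> and \<open>L(m+1,k)\<close>
  (\<open>clears_left_beyond_right\<close>), so \<open>(1-p)/2 c X \<alpha> = \<beta> + \<eta> \<alpha>\<close>. Eliminating \<open>\<beta>\<close> and \<open>\<eta>\<close> gives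
  \<open>2 \<alpha> = c X ((1-p) + (1+2p) \<alpha>\<^sup>2 - p \<alpha>\<^sup>4)\<close> (\<open>\<alpha>_series_quartic\<close>).

  This equation has one power series solution, and it depends on \<open>c\<close> through the substitution
  \<open>X \<mapsto> c X\<close> only. Comparison with \<open>\<phi> = 1\<close> yields \<open>\<alpha> n = c\<^sup>n P(A = n)\<close> (\<open>\<alpha>_scaling\<close>), and \<open>c\<^sup>n\<close>
  is the expectation of \<open>\<phi>(x\<^sub>n)\<close>. With the characters \<open>\<phi>(y) = exp(i t y)\<close> this is the independence of
  \<open>A = n\<close> and \<open>x\<^sub>n\<close>, which is part a; with \<open>\<phi>(y) = exp(-u y)\<close>, summing the series at
  \<open>X = 1\<close> gives part b.
\<close>

section \<open>The dynamics, particle by particle\<close>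

definition location :: "(nat \<Rightarrow> real) \<Rightarrow> (nat \<Rightarrow> real) \<Rightarrow> nat \<Rightarrow> real \<Rightarrow> real" where
  "location x v i t = x i + v i * t"

text \<open>The local form of the law of collisions: \<open>meets\<close> lists the particles that share the place of \<open>i\<close>
  at time \<open>t\<close>, and \<open>hit\<close> says that \<open>i\<close> dies there. The exception in \<open>hit\<close> is the moving particle
  whose direction is the spin of the static one, when a third, opposite particle is there to die in its place.\<close>

definition meets where
  "meets J x v T i t j \<longleftrightarrow> j \<in> J \<and> j \<noteq> i \<and> ereal t \<le> T j \<and> location x v j t = location x v i t"

definition hit where
  "hit J x v s T i t \<longleftrightarrow> (\<exists>j. meets J x v T i t j) \<and>
     \<not> (\<exists>j k. meets J x v T i t j \<and> meets J x v T i t k \<and> v j = 0 \<and> v k = - v i \<and> s j = v i)"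

locale configuration =
  fixes I :: "nat set" and x v s :: "nat \<Rightarrow> real"
  assumes x: "\<And>i j. i \<in> I \<Longrightarrow> j \<in> I \<Longrightarrow> i < j \<Longrightarrow> x i < x j"
    and v: "\<And>i. i \<in> I \<Longrightarrow> v i = -1 \<or> v i = 0 \<or> v i = 1"
    and s: "\<And>i. i \<in> I \<Longrightarrow> s i = -1 \<or> s i = 1"
begin

abbreviation "loc \<equiv> location x v"
abbreviation "evo J T \<equiv> evolution J x v s T"
abbreviation "meet J T \<equiv> meets J x v T"
abbreviation "struck J T \<equiv> hit J x v s T"

lemma velocity_decreasing:
  assumes "i \<in> I" "j \<in> I" "i < j" "0 \<le> t" "loc i t = loc j t"
  shows "v j < v i"
proof (rule ccontr)
  assume "\<not> v j < v i"
  then have "v i * t \<le> v j * t" using \<open>0 \<le> t\<close> by (simp add: mult_right_mono)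
  then show False using x[OF assms(1-3)] assms(5) by (simp add: location_def)
qed

lemma velocity_distinct:
  assumes "i \<in> I" "j \<in> I" "i \<noteq> j" "0 \<le> t" "loc i t = loc j t"
  shows "v i \<noteq> v j"
  using velocity_decreasing[of i j t] velocity_decreasing[of j i t] assms
  by (metis less_irrefl linorder_neqE_nat)

text \<open>Particles at one place have distinct velocities, so at most three of them meet.\<close>

lemma annihilated_iff_hit:
  assumes "J \<subseteq> I" "0 \<le> t" "i \<in> J" "ereal t \<le> T i"
  shows "i \<in> annihilated v s (present J x v T t (loc i t)) \<longleftrightarrow> struck J T i t"
proof -
  define C where "C = present J x v T t (loc i t)"
  have C: "j \<in> C \<longleftrightarrow> j \<in> J \<and> ereal t \<le> T j \<and> loc j t = loc i t" for j
    by (auto simp: C_def present_def location_def)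
  have iC: "i \<in> C" using assms C by auto
  have CI: "C \<subseteq> I" using C assms by auto
  have inj: "inj_on v C"
    by (rule inj_onI) (use velocity_distinct[of _ _ t] CI C \<open>0 \<le> t\<close> in \<open>metis subsetD\<close>)
  have fin: "finite C"
    by (rule inj_on_finite[OF inj, of "{-1,0,1}"]) (use v CI in blast, simp)
  have "card C \<le> card {-1,0,1::real}"
    by (rule card_inj_on_le[OF inj]) (use v CI in blast, simp)
  then have card: "card C \<le> 3" by simp
  have m: "meet J T i t j \<longleftrightarrow> j \<in> C \<and> j \<noteq> i" for j by (auto simp: meets_def C)
  have nz: "s j \<noteq> 0" if "j \<in> C" for j using s[of j] that CI by auto
  have pos: "card C \<noteq> 0" using iC fin by auto
  consider "card C = 1" | "card C = 2" | "card C = 3" using card pos by linarith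
  then show ?thesis unfolding C_def[symmetric]
  proof cases
    case 1
    then have "C = {i}" using iC by (metis card_1_singletonE singletonD)
    then show "i \<in> annihilated v s C \<longleftrightarrow> struck J T i t" by (auto simp: annihilated_def hit_def m)
  next
    case 2
    then obtain a where a: "C = {i, a}" "a \<noteq> i" using iC
      by (metis card_2_iff insertE insert_commute singletonD)
    have "s a \<noteq> 0" using nz a by auto
    moreover have "v a \<noteq> v i" using inj a by (auto simp: inj_on_def)
    ultimately show "i \<in> annihilated v s C \<longleftrightarrow> struck J T i t"
      using 2 a by (auto simp: annihilated_def hit_def m)
  next
    case 3
    have im: "v ` C = {-1,0,1}"
      by (rule card_subset_eq) (use v CI 3 card_image[OF inj] in auto)
    have neg: "\<exists>k\<in>C. v k = - v i"
      using v[of i] CI iC im by (metis (no_types, opaque_lifting) imageE insertCI minus_minus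
          minus_zero subsetD)
    have "\<exists>j. j \<in> C \<and> j \<noteq> i"
    proof (rule ccontr)
      assume "\<not> ?thesis"
      then have "C \<subseteq> {i}" by auto
      then show False using 3 card_mono[of "{i}" C] by simp
    qed
    moreover have "v k \<noteq> 0 \<or> s j \<noteq> v k" if "j \<in> C" for j k using nz[OF that] by auto
    ultimately show "i \<in> annihilated v s C \<longleftrightarrow> struck J T i t"
      using 3 iC neg nz by (auto simp: annihilated_def hit_def m; fastforce)
  qed
qed

text \<open>An evolution is characterised one particle at a time: this is the form in which new evolutions
  are checked and given ones are used.\<close>

lemma evolution_iff:
  assumes "J \<subseteq> I"
  shows "evo J T \<longleftrightarrow> (\<forall>i\<in>J. 0 \<le> T i \<and> (\<forall>t\<ge>0. ereal t \<le> T i \<longrightarrow> (T i = ereal t \<longleftrightarrow> struck J T i t)))"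
    (is "_ \<longleftrightarrow> ?R")
proof
  assume E: "evo J T"
  show ?R
  proof (intro ballI conjI allI impI)
    fix i t assume i: "i \<in> J" and t: "(0::real) \<le> t" "ereal t \<le> T i"
    have "{j \<in> present J x v T t (loc i t). T j = ereal t}
        = annihilated v s (present J x v T t (loc i t))"
      using E t(1) by (simp add: evolution_def)
    then have "T i = ereal t \<longleftrightarrow> i \<in> annihilated v s (present J x v T t (loc i t))"
      using i t by (auto simp: present_def location_def set_eq_iff)
    then show "T i = ereal t \<longleftrightarrow> struck J T i t"
      using annihilated_iff_hit[of J t i T, OF assms t(1) i t(2)] by simp
  qed (use E in \<open>auto simp: evolution_def\<close>)
next
  assume R: ?R
  have "{i \<in> present J x v T t y. T i = ereal t} = annihilated v s (present J x v T t y)"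
    if t: "0 \<le> t" for t y
  proof -
    have "T i = ereal t \<longleftrightarrow> i \<in> annihilated v s (present J x v T t y)"
      if i: "i \<in> present J x v T t y" for i
    proof -
      have "i \<in> J" "ereal t \<le> T i" "y = loc i t"
        using i by (auto simp: present_def location_def)
      then show ?thesis using annihilated_iff_hit[of J t i T, OF assms t] R t by auto
    qed
    then show ?thesis using annihilated_subset by blast
  qed
  then show "evo J T" using R by (simp add: evolution_def)
qed

lemma evolution_cong:
  assumes "\<And>i. i \<in> J \<Longrightarrow> T i = T' i"
  shows "evo J T \<longleftrightarrow> evo J T'"
proof -
  have P: "present J x v T t y = present J x v T' t y" for t y
    using assms by (auto simp: present_def)
  have "{i \<in> present J x v T t y. T i = ereal t} = {i \<in> present J x v T' t y. T' i = ereal t}" for t y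
    using assms by (auto simp: present_def)
  then show ?thesis using assms by (auto simp: evolution_def P)
qed

lemma nonneg: "evo J T \<Longrightarrow> i \<in> J \<Longrightarrow> 0 \<le> T i"
  by (simp add: evolution_def)

lemma dies_iff:
  assumes "J \<subseteq> I" "evo J T" "i \<in> J" "0 \<le> t" "ereal t \<le> T i"
  shows "T i = ereal t \<longleftrightarrow> struck J T i t"
  using assms evolution_iff by blast

lemma hit_static:
  assumes "J \<subseteq> I" "i \<in> J" "v i = 0" "meet J T i t j"
  shows "struck J T i t"
proof -
  have "s k \<noteq> v i" if "meet J T i t k" for k
    using that s[of k] assms by (auto simp: meets_def)
  then show ?thesis using assms(4) by (auto simp: hit_def)
qed

text \<open>Of two particles at the same place, at most one gets away, since both survivors would have
  to carry the spin of the same static particle.\<close>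

lemma pair_dies:
  assumes J: "J \<subseteq> I" and E: "evo J T" and ij: "i \<in> J" "j \<in> J" "i \<noteq> j"
    and t: "0 \<le> t" "ereal t \<le> T i" "ereal t \<le> T j" and eq: "loc i t = loc j t"
  shows "T i = ereal t \<or> T j = ereal t"
proof (rule ccontr)
  assume "\<not> ?thesis"
  then have "\<not> struck J T i t" "\<not> struck J T j t" using dies_iff[OF J E] ij t by auto
  moreover have "meet J T i t j" "meet J T j t i" using ij t eq by (auto simp: meets_def)
  ultimately obtain k k' where k: "meet J T i t k" "v k = 0" "s k = v i"
    and k': "meet J T j t k'" "v k' = 0" "s k' = v j"
    unfolding hit_def by blast
  have "k = k'"
    using velocity_distinct[of k k' t] k k' J t eq by (auto simp: meets_def)
  then have "v i = v j" using k k' by simp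
  then show False using velocity_distinct[of i j t] ij J t eq by auto
qed

text \<open>Particles could only change their order at a meeting, which one of the two does not survive.\<close>

lemma order_preserved:
  assumes J: "J \<subseteq> I" and E: "evo J T" and ij: "i \<in> J" "j \<in> J" "i < j"
    and t: "0 \<le> t" "ereal t \<le> T i" "ereal t \<le> T j"
  shows "loc i t \<le> loc j t"
proof (rule ccontr)
  assume c: "\<not> ?thesis"
  have xij: "x i < x j" using x ij J by blast
  have "v j * t < v i * t" using c xij by (simp add: location_def)
  then have vv: "v j < v i" using t(1) by (metis mult_right_mono not_le)
  \<comment> \<open>the time at which the trajectories cross\<close>
  define t' where "t' = (x j - x i) / (v i - v j)"
  have t': "0 \<le> t'" "t' < t" "loc i t' = loc j t'"
    using vv xij c by (auto simp: t'_def location_def field_simps)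
  then have "ereal t' < T i" "ereal t' < T j" using t
    by (meson ereal_less_eq(3) less_ereal.simps(1) order_less_le_trans)+
  moreover from this have "T i = ereal t' \<or> T j = ereal t'"
    using pair_dies[OF J E ij(1,2), of t'] ij(3) t' by simp
  ultimately show False by auto
qed

lemma mortal_meets:
  assumes "J \<subseteq> I" "evo J T" "i \<in> J" "T i = ereal t"
  obtains j where "meet J T i t j"
proof -
  have "0 \<le> t" using nonneg[OF assms(2,3)] assms(4) by simp
  then show ?thesis using dies_iff[OF assms(1-3), of t] assms(4) that by (auto simp: hit_def)
qed

text \<open>A mortal particle never leaves the convex hull of the initial positions: it dies at a place
  where particles with different velocities meet.\<close>

lemma mortal_right_of:
  assumes J: "J \<subseteq> I" and E: "evo J T" and i: "i \<in> J" "T i < \<infinity>"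
    and t: "0 \<le> t" "ereal t \<le> T i" and y: "\<And>j. j \<in> J \<Longrightarrow> y < x j"
  shows "y < loc i t"
proof -
  obtain r where r: "T i = ereal r" using i nonneg[OF E i(1)] by (cases "T i") auto
  then have r0: "0 \<le> r" and tr: "t \<le> r" using nonneg[OF E i(1)] t by auto
  obtain j where j: "meet J T i r j" using mortal_meets[OF J E i(1) r] .
  have "y < loc i r"
  proof (cases "v i = -1")
    case True
    have "j \<in> J" "loc j r = loc i r" using j by (auto simp: meets_def)
    moreover have "v j \<noteq> -1"
      using velocity_distinct[of i j r] subsetD[OF J, of i] subsetD[OF J, of j] j i r0 True
      by (auto simp: meets_def)
    ultimately show ?thesis using y[of j] v[of j] subsetD[OF J, of j] r0 True
      by (auto simp: location_def)
  next
    case False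
    then show ?thesis using y[of i] v[of i] subsetD[OF J, of i] r0 i by (auto simp: location_def)
  qed
  then show ?thesis using y[of i] v[of i] subsetD[OF J, of i] t tr i by (auto simp: location_def)
qed

lemma mortal_left_of:
  assumes J: "J \<subseteq> I" and E: "evo J T" and i: "i \<in> J" "T i < \<infinity>"
    and t: "0 \<le> t" "ereal t \<le> T i" and y: "\<And>j. j \<in> J \<Longrightarrow> x j < y"
  shows "loc i t < y"
proof -
  obtain r where r: "T i = ereal r" using i nonneg[OF E i(1)] by (cases "T i") auto
  then have r0: "0 \<le> r" and tr: "t \<le> r" using nonneg[OF E i(1)] t by auto
  obtain j where j: "meet J T i r j" using mortal_meets[OF J E i(1) r] .
  have "loc i r < y"
  proof (cases "v i = 1")
    case True
    have "j \<in> J" "loc j r = loc i r" using j by (auto simp: meets_def)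
    moreover have "v j \<noteq> 1"
      using velocity_distinct[of i j r] subsetD[OF J, of i] subsetD[OF J, of j] j i r0 True
      by (auto simp: meets_def)
    ultimately show ?thesis using y[of j] v[of j] subsetD[OF J, of j] r0 True
      by (auto simp: location_def)
  next
    case False
    then show ?thesis using y[of i] v[of i] subsetD[OF J, of i] r0 i by (auto simp: location_def)
  qed
  then show ?thesis using y[of i] v[of i] subsetD[OF J, of i] t tr i by (auto simp: location_def)
qed

lemma hit_union:
  assumes "\<And>k. k \<in> K \<Longrightarrow> ereal t \<le> T k \<Longrightarrow> loc k t \<noteq> loc i t"
  shows "struck (J \<union> K) T i t \<longleftrightarrow> struck J T i t"
proof -
  have "meet (J \<union> K) T i t = meet J T i t" using assms by (auto simp: meets_def fun_eq_iff)
  then show ?thesis by (simp add: hit_def)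
qed

text \<open>Two systems that never meet evolve independently. A meeting is also harmless if it
  consists of a right-moving and a static particle of \<open>J\<close> and a left-moving particle of \<open>K\<close> that
  the spin saves: it passes as if the other two were not there, and these die as they would without it.\<close>

lemma evolution_union:
  assumes J: "J \<subseteq> I" and K: "K \<subseteq> I" and disj: "J \<inter> K = {}"
    and harmless: "\<And>i k t. i \<in> J \<Longrightarrow> k \<in> K \<Longrightarrow> 0 \<le> t \<Longrightarrow> ereal t \<le> T i \<Longrightarrow> ereal t \<le> T k \<Longrightarrow>
      loc i t = loc k t \<Longrightarrow> v k = -1 \<and>
        (\<exists>j\<in>J. \<exists>a\<in>J. ereal t \<le> T j \<and> ereal t \<le> T a \<and> loc j t = loc k t \<and> loc a t = loc k t \<and>
          v a = 1 \<and> v j = 0 \<and> s j = -1)"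
  shows "evo (J \<union> K) T \<longleftrightarrow> evo J T \<and> evo K T"
proof -
  have JK: "J \<union> K \<subseteq> I" using J K by auto
  have hJ: "struck (J \<union> K) T i t \<longleftrightarrow> struck J T i t"
    if i: "i \<in> J" and t: "0 \<le> t" "ereal t \<le> T i" for i t
  proof (cases "\<exists>k\<in>K. ereal t \<le> T k \<and> loc i t = loc k t")
    case True
    then obtain k where k: "k \<in> K" "ereal t \<le> T k" "loc i t = loc k t" by blast
    then obtain j a where ja: "v k = -1" "j \<in> J" "a \<in> J" "ereal t \<le> T j" "ereal t \<le> T a"
      "loc j t = loc k t" "loc a t = loc k t" "v a = 1" "v j = 0" "s j = -1"
      using harmless[OF i k(1) t k(2,3)] by blast
    have u: "c = j" if "c \<in> J \<union> K" "loc c t = loc i t" "v c = 0" for c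
      using velocity_distinct[of c j t] that ja k J K t by auto
    have "v i \<noteq> -1" using velocity_distinct[of i k t] i k J K t disj ja(1) by auto
    have nsave: "\<not> (\<exists>c. (c \<in> J \<or> c \<in> K) \<and> loc c t = loc i t \<and> v c = 0 \<and> s c = v i)"
    proof (rule notI, elim exE conjE)
      fix c assume c: "c \<in> J \<or> c \<in> K" "loc c t = loc i t" "v c = 0" "s c = v i"
      then have "c = j" using u by blast
      then show False using c ja \<open>v i \<noteq> -1\<close> by simp
    qed
    have "i \<noteq> j \<or> i \<noteq> a" using ja by auto
    then have "(\<exists>c. meet J T i t c)" using ja k by (auto simp: meets_def)
    moreover from this have "(\<exists>c. meet (J \<union> K) T i t c)" by (auto simp: meets_def)
    ultimately show ?thesis using nsave by (auto simp: hit_def meets_def)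
  next
    case False
    then show ?thesis by (intro hit_union) auto
  qed
  have hK: "struck (J \<union> K) T k t \<longleftrightarrow> struck K T k t"
    if k: "k \<in> K" and t: "0 \<le> t" "ereal t \<le> T k" for k t
  proof (cases "\<exists>i\<in>J. ereal t \<le> T i \<and> loc i t = loc k t")
    case True
    then obtain i where i: "i \<in> J" "ereal t \<le> T i" "loc i t = loc k t" by blast
    then obtain j a where ja: "v k = -1" "j \<in> J" "a \<in> J" "ereal t \<le> T j" "ereal t \<le> T a"
      "loc j t = loc k t" "loc a t = loc k t" "v a = 1" "v j = 0" "s j = -1"
      using harmless[OF i(1) k t(1) i(2) t(2) i(3)] by blast
    have "\<not> meet K T k t c" for c
    proof
      assume c: "meet K T k t c"
      then have c': "c \<in> K" "c \<noteq> k" "loc c t = loc k t" by (auto simp: meets_def)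
      then have "v c \<noteq> v k" "v c \<noteq> v j" "v c \<noteq> v a"
        using velocity_distinct[of c _ t] ja k J K t disj by (metis disjoint_iff subsetD)+
      then show False using v[of c] ja c' K by auto
    qed
    moreover have "meet (J \<union> K) T k t j" "meet (J \<union> K) T k t a"
      using ja disj k by (auto simp: meets_def)
    ultimately show ?thesis using ja unfolding hit_def
      by (metis minus_minus)
  next
    case False
    then show ?thesis using hit_union[of J t T k K] by (auto simp: Un_commute)
  qed
  show ?thesis unfolding evolution_iff[OF J] evolution_iff[OF K] evolution_iff[OF JK]
    using hJ hK by (simp add: ball_Un cong: ball_cong conj_cong imp_cong)
qed

text \<open>A particle survives a meeting only in a triple collision, and the other two then annihilate each
  other with or without it.\<close>

lemma hit_remove_survivor:
  assumes J: "J \<subseteq> I" and a: "a \<in> J" "ereal t \<le> T a" "\<not> struck J T a t" and t: "0 \<le> t"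
    and i: "i \<in> J" "i \<noteq> a" "ereal t \<le> T i"
  shows "struck (J - {a}) T i t \<longleftrightarrow> struck J T i t"
proof (cases "loc i t = loc a t")
  case False
  then have "meet (J - {a}) T i t = meet J T i t" by (auto simp: meets_def fun_eq_iff)
  then show ?thesis by (simp add: hit_def)
next
  case True
  then have "meet J T a t i" using i by (auto simp: meets_def)
  then obtain j k where jk: "meet J T a t j" "meet J T a t k" "v j = 0" "v k = - v a" "s j = v a"
    using a unfolding hit_def by blast
  have dist: "c = d" if "c \<in> J" "d \<in> J" "loc c t = loc d t" "v c = v d" for c d
    using velocity_distinct[of c d t] that J t by auto
  have va: "v a \<noteq> 0" using jk s[of j] J by (auto simp: meets_def)
  have jkJ: "j \<in> J" "k \<in> J" "loc j t = loc a t" "loc k t = loc a t" "j \<noteq> a" "k \<noteq> a"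
    "ereal t \<le> T j" "ereal t \<le> T k"
    using jk by (auto simp: meets_def)
  have "v i \<noteq> v a" using dist[of i a] True i a by auto
  then have "v i = v j \<or> v i = v k" using v[of i] v[of a] va jk subsetD[OF J i(1)] subsetD[OF J a(1)] by auto
  then have ijk: "i = j \<or> i = k" using dist[of i j] dist[of i k] jkJ True i by auto
  have jnk: "j \<noteq> k" using jk va by auto
  have nsave: "\<not> (\<exists>c d. meet J T i t c \<and> v c = 0 \<and> s c = v i)"
  proof safe
    fix c assume c: "meet J T i t c" "v c = 0" "s c = v i"
    then have "c = j" using dist[of c j] jkJ True jk by (auto simp: meets_def)
    then show False using c ijk jk va by (auto simp: meets_def)
  qed
  have "\<exists>c. meet (J - {a}) T i t c" using ijk jkJ jnk True by (auto simp: meets_def)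
  then show ?thesis using nsave by (auto simp: hit_def meets_def)
qed


section \<open>Crossings\<close>

lemma evolution_ex:
  assumes "{a..b} \<subseteq> I"
  shows "\<exists>T. evo {a..b} T"
proof -
  have "inj_on x {a..b}"
    by (rule inj_onI) (use x assms in \<open>metis less_irrefl linorder_neqE_nat subsetD\<close>)
  moreover have "v i \<in> {-1, 0, 1}" "s i \<noteq> 0" if "i \<in> {a..b}" for i
    using v[of i] s[of i] subsetD[OF assms that] by auto
  ultimately show ?thesis using evolution_exists[of "{a..b}" x v s] by blast
qed

text \<open>If \<open>a\<close> and \<open>c\<close> die at the same time and after all others, then \<open>c\<close> survives in
  the system without \<open>a\<close>. This covers a static \<open>a\<close>, a moving \<open>a\<close>
  and the mirror images of both.\<close>

lemma remove_pair:
  assumes J: "J \<subseteq> I" and E: "evo J T" and a: "a \<in> J" "c \<in> J" "a \<noteq> c"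
    and T: "T a = ereal \<tau>" "T c = ereal \<tau>" and others: "\<And>i. i \<in> J - {a, c} \<Longrightarrow> T i < ereal \<tau>"
  shows "evo (J - {a}) (T(c := \<infinity>))"
proof -
  let ?T = "T(c := \<infinity>)"
  have J': "J - {a} \<subseteq> I" using J by auto
  have early: "struck (J - {a}) ?T i t \<longleftrightarrow> struck J T i t"
    if i: "i \<in> J" "i \<noteq> a" and t: "0 \<le> t" "t < \<tau>" "ereal t \<le> T i" for i t
  proof -
    have "meet (J - {a}) ?T i t = meet (J - {a}) T i t"
      using t(2) T by (auto simp: meets_def fun_eq_iff)
    then have "struck (J - {a}) ?T i t \<longleftrightarrow> struck (J - {a}) T i t" by (simp add: hit_def)
    also have "\<dots> \<longleftrightarrow> struck J T i t"
    proof (rule hit_remove_survivor[of J a t T i, OF J a(1) _ _ t(1) i t(3)])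
      show "ereal t \<le> T a" using t T by simp
      then show "\<not> struck J T a t" using dies_iff[OF J E a(1) t(1)] t T by simp
    qed
    finally show ?thesis .
  qed
  show ?thesis unfolding evolution_iff[OF J']
  proof (intro ballI conjI allI impI)
    fix i assume i: "i \<in> J - {a}"
    show "0 \<le> ?T i" using nonneg[OF E] i by auto
    fix t assume t: "(0::real) \<le> t" "ereal t \<le> ?T i"
    show "?T i = ereal t \<longleftrightarrow> struck (J - {a}) ?T i t"
    proof (cases "i = c")
      case False
      then have ti: "ereal t \<le> T i" "T i < ereal \<tau>" using t others[of i] i by auto
      then have "t < \<tau>" by (metis less_ereal.simps(1) order_le_less_trans)
      then show ?thesis using early[of i t] dies_iff[OF J E, of i t] i ti t False by auto
    next
      case c: True
      show ?thesis
      proof (cases "t < \<tau>")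
        case True
        then have "struck (J - {a}) ?T i t \<longleftrightarrow> T i = ereal t"
          using early[of i t] dies_iff[OF J E, of i t] i t c T by auto
        then show ?thesis using c T True by simp
      next
        case False
        have "\<not> meet (J - {a}) ?T i t j" for j
        proof
          assume "meet (J - {a}) ?T i t j"
          then have "j \<in> J - {a, c}" "ereal t \<le> T j" using c by (auto simp: meets_def)
          then show False using others[of j] False
            by (metis ereal_less_eq(3) leD not_le order_trans)
        qed
        then show ?thesis using c by (auto simp: hit_def)
      qed
    qed
  qed
qed

text \<open>Conversely, a static particle placed on the way of the survivor \<open>c\<close> is removed by it, if all
  others are dead by then and never come to that place.\<close>

lemma add_static:
  assumes K: "K \<subseteq> I" and E: "evo K T" and a: "a \<in> I" "a \<notin> K" "v a = 0"
    and c: "c \<in> K" "T c = \<infinity>" "v c \<noteq> 0" "0 \<le> \<tau>" "loc c \<tau> = x a"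
    and others: "\<And>i. i \<in> K - {c} \<Longrightarrow> T i < ereal \<tau>"
      "\<And>i t. i \<in> K - {c} \<Longrightarrow> 0 \<le> t \<Longrightarrow> ereal t \<le> T i \<Longrightarrow> loc i t \<noteq> x a"
  shows "evo (insert a K) (T(a := ereal \<tau>, c := ereal \<tau>))"
proof -
  let ?T = "T(a := ereal \<tau>, c := ereal \<tau>)"
  have I: "insert a K \<subseteq> I" using K a by auto
  have ac: "a \<noteq> c" using a c by auto
  have la: "loc a t = x a" for t using a by (simp add: location_def)
  have lc: "loc c t = x a \<longleftrightarrow> t = \<tau>" for t
  proof
    assume "loc c t = x a"
    then have "x c + v c * t = x c + v c * \<tau>" using c(5) by (simp only: location_def)
    then show "t = \<tau>" using c(3) by simp
  qed (use c in simp)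
  have early: "struck (insert a K) ?T i t \<longleftrightarrow> struck K T i t"
    if i: "i \<in> K" and t: "0 \<le> t" "t < \<tau>" "ereal t \<le> T i" for i t
  proof -
    have "loc i t \<noteq> x a"
      using others(2)[of i t] lc[of t] i t by (cases "i = c") auto
    then have "meet (insert a K) ?T i t = meet K T i t"
      using t c la by (auto simp: meets_def fun_eq_iff)
    then show ?thesis by (simp add: hit_def)
  qed
  have at_a: "j = c \<and> t = \<tau>" if "j \<in> K" "loc j t = x a" "ereal t \<le> ?T j" "0 \<le> t" for j t
    using others(2)[of j t] that lc a by (cases "j = c") (auto split: if_splits)
  show ?thesis unfolding evolution_iff[OF I]
  proof (intro ballI conjI allI impI)
    fix i assume i: "i \<in> insert a K"
    show "0 \<le> ?T i" using nonneg[OF E] i c by auto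
    fix t assume t: "(0::real) \<le> t" "ereal t \<le> ?T i"
    consider "i = a" | "i \<noteq> a" "t < \<tau>" | "i \<noteq> a" "\<tau> \<le> t" by linarith
    then show "?T i = ereal t \<longleftrightarrow> struck (insert a K) ?T i t"
    proof cases
      case 1
      have m: "meet (insert a K) ?T a t j \<longleftrightarrow> j = c \<and> t = \<tau>" for j
        using at_a[of j t] t la lc c ac by (auto simp: meets_def)
      then have "struck (insert a K) ?T a t \<longleftrightarrow> t = \<tau>" using c a by (auto simp: hit_def)
      then show ?thesis using 1 ac by auto
    next
      case 2
      then have iK: "i \<in> K" using i by simp
      have ti: "ereal t \<le> T i" using t 2 c by (cases "i = c") auto
      have "struck (insert a K) ?T i t \<longleftrightarrow> T i = ereal t"
        using early[OF iK t(1) 2(2) ti] dies_iff[OF K E iK t(1) ti] by simp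
      then show ?thesis using 2 c by (cases "i = c") auto
    next
      case 3
      then have ic: "i = c"
        using others(1)[of i] t(2) i by (cases "i = c") (auto dest: order_le_less_trans)
      then have t\<tau>: "t = \<tau>" using t 3 by simp
      have "meet (insert a K) ?T c \<tau> j \<longleftrightarrow> j = a" for j
        using at_a[of j \<tau>] c ac la[of \<tau>] by (auto simp: meets_def)
      moreover have "v a \<noteq> - v c" using a c by simp
      ultimately have "struck (insert a K) ?T c \<tau>" by (auto simp: hit_def)
      then show ?thesis using ic t\<tau> by simp
    qed
  qed
qed

end

definition clears_left where
  "clears_left x v s a b \<longleftrightarrow> a \<le> b \<and> v b = -1 \<and>
     (\<exists>T. evolution {a..b} x v s T \<and> T b = \<infinity> \<and> (\<forall>i\<in>{a..<b}. T i < \<infinity>))"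

definition clears_right where
  "clears_right x v s a b \<longleftrightarrow> a \<le> b \<and> v a = 1 \<and>
     (\<exists>T. evolution {a..b} x v s T \<and> T a = \<infinity> \<and> (\<forall>i\<in>{a<..b}. T i < \<infinity>))"

context configuration
begin

abbreviation "clearsL \<equiv> clears_left x v s"
abbreviation "clearsR \<equiv> clears_right x v s"

lemma unique:
  assumes "evo {a..b} T" "evo {a..b} T'" "i \<in> {a..b}"
  shows "T i = T' i"
  using evolution_unique[OF assms(1,2) _ assms(3)] by simp

lemma split_behind_left_mover:
  assumes I: "{a..b} \<subseteq> I" and c: "a \<le> c" "c \<le> b" and vc: "v c = -1"
    and behind: "\<And>i t. i \<in> {a..c} \<Longrightarrow> 0 \<le> t \<Longrightarrow> ereal t \<le> T i \<Longrightarrow> loc i t \<le> loc c t"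
  shows "evo {a..b} T \<longleftrightarrow> evo {a..c} T \<and> evo {Suc c..b} T"
proof -
  have J: "{a..c} \<subseteq> I" and K: "{Suc c..b} \<subseteq> I" using I c by auto
  have "loc i t \<noteq> loc k t"
    if "i \<in> {a..c}" "k \<in> {Suc c..b}" "0 \<le> t" "ereal t \<le> T i" for i k t
  proof -
    have "loc i t \<le> loc c t" using behind that by auto
    also have "\<dots> < loc k t"
    proof -
      have "c \<in> I" "k \<in> I" "c < k" using that I c by auto
      then have "x c < x k" "-1 \<le> v k" using x v[of k] by auto
      then show ?thesis
        using vc mult_right_mono[OF \<open>-1 \<le> v k\<close> that(3)] by (simp add: location_def)
    qed
    finally show ?thesis by simp
  qed
  then have "evo ({a..c} \<union> {Suc c..b}) T \<longleftrightarrow> evo {a..c} T \<and> evo {Suc c..b} T"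
    by (intro evolution_union[OF J K]) (fastforce, blast)
  moreover have "{a..c} \<union> {Suc c..b} = {a..b}" using c by auto
  ultimately show ?thesis by simp
qed

text \<open>A block that ends with a left-moving particle \<open>c\<close> outliving the others stays to the left of all
  particles that follow.\<close>

lemma closed_union:
  assumes I: "{a..b} \<subseteq> I" and c: "a \<le> c" "c \<le> b" and E: "evo {a..c} T"
    and vc: "v c = -1" and T: "\<And>i. i \<in> {a..c} \<Longrightarrow> T i \<le> T c"
  shows "evo {a..b} T \<longleftrightarrow> evo {Suc c..b} T"
proof -
  have J: "{a..c} \<subseteq> I" using I c by auto
  have "loc i t \<le> loc c t" if "i \<in> {a..c}" "0 \<le> t" "ereal t \<le> T i" for i t
    using order_preserved[OF J E, of i c t] that c T[OF that(1)]
    by (cases "i = c") (auto intro: order_trans)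
  then show ?thesis using split_behind_left_mover[OF I c vc] E by blast
qed

lemma closed_extend:
  assumes I: "{a..b} \<subseteq> I" and c: "a \<le> c" "c \<le> b" and E: "evo {a..c} T"
    and vc: "v c = -1" and T: "\<And>i. i \<in> {a..c} \<Longrightarrow> T i \<le> T c" and E': "evo {Suc c..b} T'"
  shows "evo {a..b} (\<lambda>i. if i \<le> c then T i else T' i)"
proof -
  let ?T = "\<lambda>i. if i \<le> c then T i else T' i"
  have "evo {a..c} ?T" using E evolution_cong[of "{a..c}" T ?T] by auto
  moreover have "evo {Suc c..b} ?T" using E' evolution_cong[of "{Suc c..b}" T' ?T] by auto
  ultimately show ?thesis using closed_union[OF I c, of ?T] vc T by auto
qed

lemma clears_left_unique:
  assumes I: "{a..b} \<subseteq> I" and "clearsL a b" "clearsL a c" "c \<le> b"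
  shows "b = c"
proof (rule ccontr)
  assume ne: "b \<noteq> c"
  obtain T where T: "evo {a..b} T" "\<forall>i\<in>{a..<b}. T i < \<infinity>"
    using assms unfolding clears_left_def by auto
  obtain T' where T': "evo {a..c} T'" "T' c = \<infinity>" "v c = -1" "a \<le> c"
    using assms unfolding clears_left_def by auto
  obtain T'' where T'': "evo {Suc c..b} T''" using evolution_ex[of "Suc c" b] I T'(4)
    by (meson atLeastatMost_subset_iff le_Suc_eq order_trans order_refl)
  have "evo {a..b} (\<lambda>i. if i \<le> c then T' i else T'' i)"
    by (rule closed_extend[OF I T'(4) \<open>c \<le> b\<close> T'(1) T'(3) _ T'']) (use T' in auto)
  from unique[OF T(1) this, of c] have "T c = \<infinity>" using T' \<open>c \<le> b\<close> by simp
  then show False using T(2) ne T' \<open>c \<le> b\<close> by auto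
qed

text \<open>Once the block \<open>a, \<dots>, c\<close> has annihilated itself behind \<open>c\<close>, the system starts afresh with \<open>c + 1\<close>.\<close>

lemma clears_left_after:
  assumes I: "{a..b} \<subseteq> I" "{a..c} \<subseteq> I" and c: "a \<le> c" and E: "evo {a..c} T"
    and vc: "v c = -1" and T: "\<And>i. i \<in> {a..c} \<Longrightarrow> T i \<le> T c" "T c < \<infinity>"
  shows "clearsL a b \<longleftrightarrow> c < b \<and> clearsL (Suc c) b"
proof (cases "c < b")
  case False
  have "\<not> clearsL a b"
  proof
    assume L: "clearsL a b"
    then obtain T' where T': "evo {a..b} T'" "T' b = \<infinity>" "v b = -1" "a \<le> b"
      unfolding clears_left_def by auto
    have bc: "b \<le> c" using False by simp
    obtain T'' where T'': "evo {Suc b..c} T''"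
      using evolution_ex[of "Suc b" c] I(2) T'(4)
      by (meson atLeastatMost_subset_iff le_Suc_eq order_trans order_refl)
    have "evo {a..c} (\<lambda>i. if i \<le> b then T' i else T'' i)"
      by (rule closed_extend[OF I(2) T'(4) bc T'(1) T'(3) _ T'']) (use T' in auto)
    from unique[OF E this, of b] have "T b = \<infinity>" using T' bc by simp
    then show False using T(1)[of b] T(2) T' bc by auto
  qed
  then show ?thesis using False by simp
next
  case True
  then have cb: "c \<le> b" by simp
  obtain T' where T': "evo {Suc c..b} T'" using evolution_ex[of "Suc c" b] I(1) c
    by (meson atLeastatMost_subset_iff le_Suc_eq order_trans order_refl)
  define T2 where "T2 = (\<lambda>i. if i \<le> c then T i else T' i)"
  have E2: "evo {a..b} T2"
    unfolding T2_def by (rule closed_extend[OF I(1) c cb E vc T(1) T'])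
  have fin: "T2 i < \<infinity>" if "i \<in> {a..c}" for i
    using T(1)[OF that] T(2) that by (auto simp: T2_def)
  have "clearsL a b \<longleftrightarrow> v b = -1 \<and> T2 b = \<infinity> \<and> (\<forall>i\<in>{a..<b}. T2 i < \<infinity>)"
  proof
    assume "clearsL a b"
    then obtain T3 where T3: "evo {a..b} T3" "T3 b = \<infinity>" "v b = -1" "\<forall>i\<in>{a..<b}. T3 i < \<infinity>"
      unfolding clears_left_def by auto
    then show "v b = -1 \<and> T2 b = \<infinity> \<and> (\<forall>i\<in>{a..<b}. T2 i < \<infinity>)"
      using unique[OF E2 T3(1)] c cb by auto
  qed (use E2 c cb in \<open>auto simp: clears_left_def\<close>)
  also have "\<dots> \<longleftrightarrow> v b = -1 \<and> T' b = \<infinity> \<and> (\<forall>i\<in>{Suc c..<b}. T' i < \<infinity>)"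
    using fin True c by (force simp: T2_def)
  also have "\<dots> \<longleftrightarrow> clearsL (Suc c) b"
  proof
    assume "clearsL (Suc c) b"
    then obtain T3 where T3: "evo {Suc c..b} T3" "T3 b = \<infinity>" "v b = -1"
      "\<forall>i\<in>{Suc c..<b}. T3 i < \<infinity>"
      unfolding clears_left_def by auto
    then show "v b = -1 \<and> T' b = \<infinity> \<and> (\<forall>i\<in>{Suc c..<b}. T' i < \<infinity>)"
      using unique[OF T' T3(1)] True by auto
  qed (use T' True in \<open>auto simp: clears_left_def\<close>)
  finally show ?thesis using True by simp
qed

text \<open>All but the last particle of the block die between the left end of the block and the trajectory of the last one.\<close>

lemma clears_left_bounds:
  assumes I: "{a..b} \<subseteq> I" and E: "evo {a..b} T" and b: "a \<le> b" "v b = -1" "T b = \<infinity>"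
    and T: "\<And>i. i \<in> {a..<b} \<Longrightarrow> T i < \<infinity>" and y: "\<And>i. i \<in> {a..b} \<Longrightarrow> y < x i"
    and i: "i \<in> {a..<b}"
  shows "T i < ereal (x b - y)" "\<And>t. 0 \<le> t \<Longrightarrow> ereal t \<le> T i \<Longrightarrow> y < loc i t"
proof -
  have i': "i \<in> {a..b}" using i by auto
  show *: "y < loc i t" if "0 \<le> t" "ereal t \<le> T i" for t
    by (rule mortal_right_of[OF I E i' T[OF i] that y])
  obtain r where r: "T i = ereal r" "0 \<le> r"
    using T[OF i] nonneg[OF E i'] by (cases "T i") auto
  have "loc i r \<le> loc b r" using order_preserved[OF I E i', of b r] i b r by auto
  then show "T i < ereal (x b - y)" using *[of r] r b by (simp add: location_def)
qed

lemma clears_right_bounds: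
  assumes I: "{a..b} \<subseteq> I" and E: "evo {a..b} T" and a: "a \<le> b" "v a = 1" "T a = \<infinity>"
    and T: "\<And>i. i \<in> {a<..b} \<Longrightarrow> T i < \<infinity>" and y: "\<And>i. i \<in> {a..b} \<Longrightarrow> x i < y"
    and i: "i \<in> {a<..b}"
  shows "T i < ereal (y - x a)" "\<And>t. 0 \<le> t \<Longrightarrow> ereal t \<le> T i \<Longrightarrow> loc i t < y"
proof -
  have i': "i \<in> {a..b}" using i by auto
  show *: "loc i t < y" if "0 \<le> t" "ereal t \<le> T i" for t
    by (rule mortal_left_of[OF I E i' T[OF i] that y])
  obtain r where r: "T i = ereal r" "0 \<le> r"
    using T[OF i] nonneg[OF E i'] by (cases "T i") auto
  have "loc a r \<le> loc i r" using order_preserved[OF I E, of a i r] i a r i' by auto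
  then show "T i < ereal (y - x a)" using *[of r] r a by (simp add: location_def)
qed

lemma static_cleared_from_right:
  assumes I: "{a..c} \<subseteq> I" and a: "v a = 0" and L: "clearsL (Suc a) c"
  obtains T where "evo {a..c} T" "T a = ereal (x c - x a)" "T c = ereal (x c - x a)"
    "\<And>i. i \<in> {a<..<c} \<Longrightarrow> T i < ereal (x c - x a)"
proof -
  obtain T where T: "evo {Suc a..c} T" "T c = \<infinity>" "v c = -1" "Suc a \<le> c"
    "\<And>i. i \<in> {Suc a..<c} \<Longrightarrow> T i < \<infinity>"
    using L unfolding clears_left_def by auto
  have I': "{Suc a..c} \<subseteq> I" using I by auto
  have y: "x a < x i" if "i \<in> {Suc a..c}" for i 
    using x[of a i] subsetD[OF I, of a] subsetD[OF I, of i] that by auto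
  note B = clears_left_bounds[OF I' T(1,4,3,2,5) y]
  have "evo (insert a {Suc a..c}) (T(a := ereal (x c - x a), c := ereal (x c - x a)))"
    by (rule add_static[OF I' T(1)])
      (use a T I y[of c] B in \<open>force simp: location_def\<close>)+
  moreover have "insert a {Suc a..c} = {a..c}" using T(4) by auto
  ultimately show ?thesis using that B(1) T(4) by auto
qed

lemma static_cleared_from_left:
  assumes I: "{a..j} \<subseteq> I" and j: "v j = 0" "a < j" and R: "clearsR a (j - 1)"
  obtains T where "evo {a..j} T" "T a = ereal (x j - x a)" "T j = ereal (x j - x a)"
    "\<And>i. i \<in> {a<..<j} \<Longrightarrow> T i < ereal (x j - x a)"
proof -
  obtain T where T: "evo {a..j - 1} T" "T a = \<infinity>" "v a = 1" "a \<le> j - 1"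
    "\<And>i. i \<in> {a<..j - 1} \<Longrightarrow> T i < \<infinity>"
    using R unfolding clears_right_def by auto
  have I': "{a..j - 1} \<subseteq> I" by (rule order_trans[OF _ I]) auto
  have y: "x i < x j" if "i \<in> {a..j - 1}" for i 
    using x[of i j] subsetD[OF I, of i] subsetD[OF I, of j] that j by auto
  note B = clears_right_bounds[OF I' T(1,4,3,2,5) y]
  have "evo (insert j {a..j - 1}) (T(j := ereal (x j - x a), a := ereal (x j - x a)))"
  proof (rule add_static[OF I' T(1)])
    fix i assume "i \<in> {a..j - 1} - {a}"
    then have i: "i \<in> {a<..j - 1}" by auto
    show "T i < ereal (x j - x a)" using B(1)[of i] i by auto
    fix t :: real assume "0 \<le> t" "ereal t \<le> T i"
    then show "loc i t \<noteq> x j" using B(2)[of i t] i by auto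
  qed (use j T I y[of a] in \<open>auto simp: location_def\<close>)
  moreover have "insert j {a..j - 1} = {a..j}" using T(4) j by auto
  ultimately have "evo {a..j} (T(j := ereal (x j - x a), a := ereal (x j - x a)))" by simp
  then show ?thesis by (rule that) (use B(1) j in auto)
qed

text \<open>The first particle of the system cannot be the static member of a triple collision, so whatever
  annihilates it includes a second victim.\<close>

lemma first_dies_with_partner:
  assumes I: "{a..n} \<subseteq> I" and E: "evo {a..n} T" "a \<le> n" and Ta: "T a = ereal \<tau>"
  obtains j where "a < j" "j \<le> n" "T j = ereal \<tau>" "loc j \<tau> = loc a \<tau>" "0 \<le> \<tau>"
proof -
  have aI: "a \<in> {a..n}" using E by simp
  have \<tau>: "0 \<le> \<tau>" using nonneg[OF E(1) aI] Ta by simp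
  obtain k where k: "meet {a..n} T a \<tau> k" using mortal_meets[OF I E(1) aI Ta] .
  then have k': "k \<in> {a..n}" "a < k" "ereal \<tau> \<le> T k" "loc k \<tau> = loc a \<tau>"
    by (auto simp: meets_def)
  show ?thesis
  proof (cases "T k = ereal \<tau>")
    case True
    then show ?thesis using that[of k] k' \<tau> by auto
  next
    case False
    then have "\<not> struck {a..n} T k \<tau>" using dies_iff[OF I E(1) k'(1) \<tau> k'(3)] by simp
    moreover have "meet {a..n} T k \<tau> a" using k' aI Ta by (auto simp: meets_def)
    ultimately obtain j i where j: "meet {a..n} T k \<tau> j" "meet {a..n} T k \<tau> i" "v j = 0" "v i = - v k"
      "s j = v k"
      unfolding hit_def by blast
    have "j \<noteq> a"
    proof
      assume "j = a"
      then have va: "v a = 0" using j by simp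
      have "v k \<noteq> 0" using j s[of j] I by (auto simp: meets_def)
      moreover have "v k < v a" 
        using velocity_decreasing[of a k \<tau>] k' subsetD[OF I aI] subsetD[OF I k'(1)] \<tau> by auto
      ultimately have "v i > v a" using j va by simp
      moreover have "i \<in> {a..n}" "loc i \<tau> = loc a \<tau>" using j k' by (auto simp: meets_def)
      ultimately show False
        using velocity_decreasing[of a i \<tau>] subsetD[OF I aI] subsetD[OF I, of i] \<tau>
        by (cases "i = a") auto
    qed
    then have jj: "a < j" "j \<le> n" "loc j \<tau> = loc a \<tau>" "ereal \<tau> \<le> T j"
      using j k' by (auto simp: meets_def)
    have "meet {a..n} T j \<tau> a" using jj aI Ta by (auto simp: meets_def)
    then have "struck {a..n} T j \<tau>" by (intro hit_static[OF I]) (use jj j in auto)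
    then have "T j = ereal \<tau>" using dies_iff[OF I E(1), of j \<tau>] jj \<tau> by auto
    then show ?thesis using that[of j] jj \<tau> by auto
  qed
qed

text \<open>When the first particle and \<open>j\<close> annihilate each other, the particles in between are squeezed and
  have died before. The particles after \<open>j\<close> do not notice this, except for a left-moving one that arrives in a
  triple collision, and this one is saved by the spin.\<close>

lemma first_collision_splits:
  assumes I: "{a..n} \<subseteq> I" and E: "evo {a..n} T" and j: "a < j" "j \<le> n" "0 \<le> \<tau>"
    and T: "T a = ereal \<tau>" "T j = ereal \<tau>" and eq: "loc j \<tau> = loc a \<tau>"
  shows "evo {a..j} T" "evo {Suc j..n} T" "\<And>i. i \<in> {a<..<j} \<Longrightarrow> T i < ereal \<tau>"
proof -
  have aI: "a \<in> {a..n}" and jI: "j \<in> {a..n}" using j by auto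
  have vja: "v j < v a" 
    using velocity_decreasing[of a j \<tau>] subsetD[OF I aI] subsetD[OF I jI] j eq by auto
  show inner: "T i < ereal \<tau>" if i: "i \<in> {a<..<j}" for i
  proof (rule ccontr)
    assume "\<not> T i < ereal \<tau>"
    then have Ti: "ereal \<tau> \<le> T i" by simp
    have iI: "i \<in> {a..n}" using i j by auto
    have li: "loc i \<tau> = loc a \<tau>"
      using order_preserved[OF I E aI iI _ j(3)] order_preserved[OF I E iI jI _ j(3)] i Ti T eq
      by force
    have "v i < v a" "v j < v i"
      using velocity_decreasing[of a i \<tau>] velocity_decreasing[of i j \<tau>] i j li eq
        subsetD[OF I iI] subsetD[OF I aI] subsetD[OF I jI] by auto
    then have vs: "v a = 1" "v i = 0" "v j = -1"
      using v[of a] v[of i] v[of j] subsetD[OF I iI] subsetD[OF I aI] subsetD[OF I jI] by auto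
    have "struck {a..n} T a \<tau>" "struck {a..n} T j \<tau>"
      using dies_iff[OF I E aI j(3)] dies_iff[OF I E jI j(3)] T by auto
    moreover have "meet {a..n} T a \<tau> i" "meet {a..n} T a \<tau> j" "meet {a..n} T j \<tau> i" "meet {a..n} T j \<tau> a"
      using i j li eq Ti T by (auto simp: meets_def)
    ultimately have "s i \<noteq> 1" "s i \<noteq> -1" unfolding hit_def using vs by force+
    then show False using s[of i] subsetD[OF I iI] by auto
  qed
  have J: "{a..j} \<subseteq> I" and K: "{Suc j..n} \<subseteq> I" using I j by auto
  have "evo ({a..j} \<union> {Suc j..n}) T \<longleftrightarrow> evo {a..j} T \<and> evo {Suc j..n} T"
  proof (rule evolution_union[OF J K])
    fix i k t
    assume i: "i \<in> {a..j}" and k: "k \<in> {Suc j..n}" and t: "0 \<le> t" "ereal t \<le> T i" "ereal t \<le> T k"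
      and l: "loc i t = loc k t"
    have iI: "i \<in> {a..n}" and kI: "k \<in> {a..n}" using i k j by auto
    have "T i \<le> ereal \<tau>" using inner[of i] T i by (cases "i = a \<or> i = j") auto
    then have t\<tau>: "t \<le> \<tau>" using t(2) by (meson ereal_less_eq(3) order_trans)
    then have tj: "ereal t \<le> T j" using T by simp
    have "loc i t \<le> loc j t"
      using order_preserved[OF I E iI jI _ t(1,2) tj] i by (cases "i = j") auto
    moreover have "loc j t \<le> loc k t"
      using order_preserved[OF I E jI kI _ t(1) tj t(3)] k by auto
    ultimately have lj: "loc j t = loc k t" using l by simp
    have vkj: "v k < v j" 
      using velocity_decreasing[of j k t] subsetD[OF I jI] subsetD[OF I kI] k t lj by auto
    then have vs: "v k = -1" "v j = 0" "v a = 1"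
      
      using vja v[of a] v[of j] v[of k] subsetD[OF I jI] subsetD[OF I kI] subsetD[OF I aI] by auto
    have "struck {a..n} T j t"
      by (rule hit_static[OF I jI, of _ _ k]) (use vs k kI t lj in \<open>auto simp: meets_def\<close>)
    then have "t = \<tau>" using dies_iff[OF I E jI t(1) tj] T by simp
    moreover have "struck {a..n} T a \<tau>" using dies_iff[OF I E aI j(3)] T by auto
    moreover have "meet {a..n} T a \<tau> j" "meet {a..n} T a \<tau> k"
      using j k t lj eq T \<open>t = \<tau>\<close> by (auto simp: meets_def)
    ultimately have "s j \<noteq> 1" unfolding hit_def using vs by force
    then have "s j = -1" using s[of j] subsetD[OF I jI] by auto
    then show "v k = -1 \<and> (\<exists>j'\<in>{a..j}. \<exists>a'\<in>{a..j}. ereal t \<le> T j' \<and> ereal t \<le> T a' \<and>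
        loc j' t = loc k t \<and> loc a' t = loc k t \<and> v a' = 1 \<and> v j' = 0 \<and> s j' = -1)"
      using vs T j lj eq \<open>t = \<tau>\<close> by (intro conjI bexI[of _ j] bexI[of _ a]) auto
  qed auto
  moreover have "{a..j} \<union> {Suc j..n} = {a..n}" using j by auto
  ultimately show "evo {a..j} T" "evo {Suc j..n} T" using E by auto
qed


lemma clears_left_left:
  assumes I: "{a..b} \<subseteq> I" and v: "v a = -1"
  shows "clearsL a b \<longleftrightarrow> b = a"
proof -
  have "evo {a..a} (\<lambda>_. \<infinity>)" if "a \<in> I"
    using that by (subst evolution_iff) (auto simp: hit_def meets_def)
  then have "clearsL a a" if "a \<in> I" using that v by (auto simp: clears_left_def)
  moreover have aI: "a \<in> I" if "a \<le> b" using I that by auto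
  moreover have "b = a" if L: "clearsL a b"
  proof -
    have "a \<le> b" using L by (simp add: clears_left_def)
    then show ?thesis using clears_left_unique[OF I L] calculation by blast
  qed
  ultimately show ?thesis by blast
qed

lemma clears_left_ends: "clearsL a b \<Longrightarrow> a \<le> b \<and> v b = -1"
  by (simp add: clears_left_def)

lemma clears_left_mortal:
  assumes "evo {a..b} T" "clearsL a b"
  shows "T b = \<infinity>" "\<And>i. i \<in> {a..<b} \<Longrightarrow> T i < \<infinity>"
proof -
  obtain T' where T': "evo {a..b} T'" "T' b = \<infinity>" "\<forall>i\<in>{a..<b}. T' i < \<infinity>" "a \<le> b"
    using assms(2) unfolding clears_left_def by auto
  show "T b = \<infinity>" "\<And>i. i \<in> {a..<b} \<Longrightarrow> T i < \<infinity>"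
    using unique[OF assms(1) T'(1)] T' by auto
qed

lemma clears_leftI:
  assumes "evo {a..b} T" "a \<le> b" "v b = -1" "T b = \<infinity>" "\<And>i. i \<in> {a..<b} \<Longrightarrow> T i < \<infinity>"
  shows "clearsL a b"
  using assms unfolding clears_left_def by auto

text \<open>The leftmost immortal left-moving particle is the first to cross: an immortal static or
  right-moving particle on its left would have met it.\<close>

lemma left_survivor:
  assumes I: "{a..n} \<subseteq> I" and E: "evo {a..n} T" and k: "k \<in> {a..n}" "v k = -1" "T k = \<infinity>"
  obtains m where "m \<le> k" "clearsL a m" "T m = \<infinity>"
proof -
  define m where "m = (LEAST m. m \<in> {a..n} \<and> v m = -1 \<and> T m = \<infinity>)"
  have m: "m \<in> {a..n}" "v m = -1" "T m = \<infinity>" and mk: "m \<le> k"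
    unfolding m_def using k by (smt (verit, best) LeastI Least_le)+
  have least: "T i < \<infinity>" if "i \<in> {a..<m}" "v i = -1" for i
  proof (rule ccontr)
    assume "\<not> ?thesis"
    then have "i \<in> {a..n} \<and> v i = -1 \<and> T i = \<infinity>" using that m by auto
    then have "m \<le> i" unfolding m_def by (rule Least_le)
    then show False using that by simp
  qed
  have behind: "loc i t \<le> loc m t" if "i \<in> {a..m}" "0 \<le> t" "ereal t \<le> T i" for i t
    using order_preserved[OF I E, of i m t] that m by (cases "i = m") auto
  have "evo {a..m} T" using split_behind_left_mover[OF I _ _ m(2) behind] m E by auto
  moreover have "T i < \<infinity>" if "i \<in> {a..<m}" for i
  proof (rule ccontr)
    assume inf: "\<not> T i < \<infinity>"
    have iI: "i \<in> I" "m \<in> I" using that m I by auto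
    then have xx: "x i < x m" using x that by auto
    then have "loc i (x m - x i) \<le> loc m (x m - x i)" using behind[of i] that inf by auto
    moreover have "v i = 0 \<or> v i = 1" using least[OF that] inf v[OF iI(1)] by auto
    ultimately have "v i = 0" using xx m by (auto simp: location_def)
    have r: "ereal (x m - x i) \<le> T i" "ereal (x m - x i) \<le> T m" "0 \<le> x m - x i" using inf m xx by auto
    have "T i = ereal (x m - x i) \<or> T m = ereal (x m - x i)"
      by (rule pair_dies[OF I E _ m(1) _ r(3,1,2)])
        (use that m \<open>v i = 0\<close> in \<open>auto simp: location_def\<close>)
    then show False using inf m by auto
  qed
  ultimately have "clearsL a m" using clears_leftI[of a m T] m by auto
  then show ?thesis using that m mk by blast
qed

lemma clears_left_static:
  assumes I: "{a..b} \<subseteq> I" and va: "v a = 0"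
  shows "clearsL a b \<longleftrightarrow> (\<exists>c. a < c \<and> c < b \<and> clearsL (Suc a) c \<and> clearsL (Suc c) b)"
proof
  assume "\<exists>c. a < c \<and> c < b \<and> clearsL (Suc a) c \<and> clearsL (Suc c) b"
  then obtain c where c: "a < c" "c < b" "clearsL (Suc a) c" "clearsL (Suc c) b" by blast
  have I': "{a..c} \<subseteq> I" using I c by auto
  obtain T where T: "evo {a..c} T" "T a = ereal (x c - x a)" "T c = ereal (x c - x a)"
    "\<And>i. i \<in> {a<..<c} \<Longrightarrow> T i < ereal (x c - x a)"
    using static_cleared_from_right[OF I' va c(3)] by blast
  have "T i \<le> T c" if "i \<in> {a..c}" for i
    using T(4)[of i] T(2,3) that by (cases "i = a \<or> i = c") (auto intro: less_imp_le)
  then show "clearsL a b"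
    using clears_left_after[OF I I' _ T(1)] c T(3) clears_left_ends[OF c(3)] by auto
next
  assume L: "clearsL a b"
  then obtain T where T: "evo {a..b} T" "T b = \<infinity>" "v b = -1" "a \<le> b"
    "\<And>i. i \<in> {a..<b} \<Longrightarrow> T i < \<infinity>"
    unfolding clears_left_def by auto
  have "a \<noteq> b" using va T by auto
  then have ab: "a < b" using T by simp
  obtain \<tau> where \<tau>: "T a = ereal \<tau>" using T(5)[of a] ab nonneg[OF T(1), of a] by (cases "T a") auto
  obtain c where c: "a < c" "c \<le> b" "T c = ereal \<tau>" "loc c \<tau> = loc a \<tau>" "0 \<le> \<tau>"
    using first_dies_with_partner[OF I T(1,4) \<tau>] .
  have "a \<in> I" "c \<in> I" using I c ab by auto
  then have "v c < v a" using velocity_decreasing[of a c \<tau>] c by auto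
  then have vc: "v c = -1" using v[OF \<open>c \<in> I\<close>] va by auto
  have cb: "c < b" using c T(2) by (cases "c = b") auto
  note S = first_collision_splits[OF I T(1) c(1,2,5) \<tau> c(3,4)]
  have I': "{a..c} \<subseteq> I" using I c by auto
  have "evo ({a..c} - {a}) (T(c := \<infinity>))"
    by (rule remove_pair[OF I' S(1) _ _ _ \<tau> c(3)]) (use c S(3) in auto)
  moreover have "{a..c} - {a} = {Suc a..c}" by auto
  ultimately have E: "evo {Suc a..c} (T(c := \<infinity>))" by simp
  have "clearsL (Suc a) c" by (rule clears_leftI[OF E]) (use c vc T(5) in auto)
  moreover have "clearsL (Suc c) b" by (rule clears_leftI[OF S(2)]) (use cb c T in auto)
  ultimately show "\<exists>c. a < c \<and> c < b \<and> clearsL (Suc a) c \<and> clearsL (Suc c) b" using c cb by blast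
qed

end

section \<open>The fate of a right-moving first particle\<close>

definition collide where
  "collide x v s a b \<longleftrightarrow> a < b \<and> v a = 1 \<and> v b = -1 \<and>
     (\<exists>T. evolution {a..b} x v s T \<and> T a = ereal ((x b - x a) / 2) \<and> T b = ereal ((x b - x a) / 2))"

text \<open>A static particle \<open>j\<close> would be reached from the left by \<open>a\<close> and from the right by \<open>b\<close>, each as the first
  to come. If \<open>a\<close> is faster, or in case of a tie the spin of \<open>j\<close> is \<open>-1\<close>, then \<open>a\<close> and \<open>j\<close>
  annihilate each other and \<open>b\<close> passes.\<close>

definition opens_way where
  "opens_way x v s a j b \<longleftrightarrow> a < j \<and> j < b \<and> v j = 0 \<and>
     clears_right x v s a (j - 1) \<and> clears_left x v s (Suc j) b \<and>
     (x j - x a < x b - x j \<or> x j - x a = x b - x j \<and> s j = -1)"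

context configuration
begin

abbreviation "collides \<equiv> collide x v s"
abbreviation "opens \<equiv> opens_way x v s"

text \<open>The blocks \<open>a, \<dots>, j\<close> and \<open>j + 1, \<dots>, b\<close> evolve independently. Only \<open>b\<close> gets to
  the place of \<open>j\<close>, and not before \<open>a\<close>; a simultaneous arrival is the harmless triple collision.\<close>

lemma opens_way_evolution:
  assumes I: "{a..b} \<subseteq> I" and O: "opens a j b"
  obtains T where "evo {a..b} T" "T a = ereal (x j - x a)" "T b = \<infinity>"
    "\<And>i. i \<in> {a..<b} \<Longrightarrow> T i < \<infinity>"
proof -
  note O' = O[unfolded opens_way_def]
  have j: "a < j" "j < b" "v j = 0" and R: "clearsR a (j - 1)" and L: "clearsL (Suc j) b"
    and time: "x j - x a < x b - x j \<or> x j - x a = x b - x j \<and> s j = -1"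
    using O' by auto
  define \<tau> where "\<tau> = x j - x a"
  have J: "{a..j} \<subseteq> I" and K: "{Suc j..b} \<subseteq> I" using I j by auto
  obtain T1 where T1: "evo {a..j} T1" "T1 a = ereal \<tau>" "T1 j = ereal \<tau>"
    "\<And>i. i \<in> {a<..<j} \<Longrightarrow> T1 i < ereal \<tau>"
    using static_cleared_from_left[OF J j(3,1) R] unfolding \<tau>_def by blast
  obtain T2 where T2: "evo {Suc j..b} T2" "T2 b = \<infinity>" "v b = -1"
    "\<And>i. i \<in> {Suc j..<b} \<Longrightarrow> T2 i < \<infinity>"
    using L unfolding clears_left_def by auto
  have jI: "j \<in> I" and aI: "a \<in> I" using I j by auto
  have va: "v a = 1" using R by (simp add: clears_right_def)
  have y: "x j < x i" if "i \<in> {Suc j..b}" for i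
    using x[of j i] subsetD[OF K that] jI that by auto
  have B2: "x j < loc k t" if "k \<in> {Suc j..<b}" "0 \<le> t" "ereal t \<le> T2 k" for k t
    by (rule clears_left_bounds(2)[OF K T2(1) _ T2(3,2,4) y that(1) that(2,3)]) (use j in auto)
  define T where "T = (\<lambda>i. if i \<le> j then T1 i else T2 i)"
  have E1: "evo {a..j} T" and E2: "evo {Suc j..b} T"
    using T1(1) T2(1) evolution_cong[of "{a..j}" T1 T] evolution_cong[of "{Suc j..b}" T2 T]
    by (auto simp: T_def)
  have T_le: "T i \<le> ereal \<tau>" if "i \<in> {a..j}" for i
    using T1(2,3) T1(4)[of i] that by (cases "i = a \<or> i = j") (auto simp: T_def intro: less_imp_le)
  have "evo ({a..j} \<union> {Suc j..b}) T"
  proof (subst evolution_union[OF J K])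
    fix i k t
    assume i: "i \<in> {a..j}" and k: "k \<in> {Suc j..b}" and t: "0 \<le> t" "ereal t \<le> T i" "ereal t \<le> T k"
      and eq: "loc i t = loc k t"
    have t\<tau>: "t \<le> \<tau>" using T_le[OF i] t(2) by (meson ereal_less_eq(3) order_trans)
    have Tj: "ereal t \<le> T j" using t\<tau> T1(3) by (simp add: T_def)
    have "loc i t \<le> loc j t"
      using order_preserved[OF J E1, of i j t] i t Tj j by (cases "i = j") auto
    then have le: "loc k t \<le> x j" using eq j(3) by (simp add: location_def)
    have kb: "k = b"
    proof (rule ccontr)
      assume "k \<noteq> b"
      then have "x j < loc k t" using B2[of k t] k t by (auto simp: T_def)
      then show False using le by simp
    qed
    then have ge: "x b - x j \<le> t" using le T2(3) by (simp add: location_def)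
    then have tie: "t = \<tau>" "x j - x a = x b - x j" "s j = -1"
      using time t\<tau> by (auto simp: \<tau>_def)
    then have l: "loc j t = loc k t" "loc a t = loc k t"
      using kb T2(3) j(3) va by (auto simp: location_def \<tau>_def)
    then show "v k = -1 \<and> (\<exists>j'\<in>{a..j}. \<exists>a'\<in>{a..j}. ereal t \<le> T j' \<and> ereal t \<le> T a' \<and>
        loc j' t = loc k t \<and> loc a' t = loc k t \<and> v a' = 1 \<and> v j' = 0 \<and> s j' = -1)"
      using kb T2(3) va j tie Tj T1(2)
      by (intro conjI bexI[of _ j] bexI[of _ a]) (auto simp: T_def)
  qed (use E1 E2 in auto)
  moreover have "{a..j} \<union> {Suc j..b} = {a..b}" using j by auto
  moreover have "T i < \<infinity>" if "i \<in> {a..<b}" for i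
  proof (cases "i \<le> j")
    case True
    then show ?thesis using T_le[of i] that by (auto intro: order_le_less_trans)
  next
    case False
    then show ?thesis using T2(4)[of i] that by (auto simp: T_def)
  qed
  ultimately show ?thesis using that[of T] j T1(2) T2(2) by (auto simp: T_def \<tau>_def)
qed

lemma opens_way_clears:
  assumes "{a..b} \<subseteq> I" "opens a j b"
  shows "clearsL a b"
proof -
  have "a \<le> b" "v b = -1" using assms(2) by (auto simp: opens_way_def clears_left_def)
  then show ?thesis using opens_way_evolution[OF assms] by (metis clears_leftI)
qed

lemma opens_way_unique:
  assumes I: "{a..b} \<subseteq> I" and "opens a j b" "opens a j' b"
  shows "j = j'"
proof -
  obtain T where T: "evo {a..b} T" "T a = ereal (x j - x a)"
    using opens_way_evolution[OF I assms(2)] by blast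
  obtain T' where T': "evo {a..b} T'" "T' a = ereal (x j' - x a)"
    using opens_way_evolution[OF I assms(3)] by blast
  have j: "j \<in> {a..b}" "j' \<in> {a..b}" using assms(2,3) by (auto simp: opens_way_def)
  then have "x j = x j'" using unique[OF T(1) T'(1), of a] T T' by auto
  then show ?thesis using x[of j j'] x[of j' j] j I
    by (metis less_irrefl linorder_neqE_nat subsetD)
qed

lemma drop_first:
  assumes I: "{a..b} \<subseteq> I" and E: "evo {a..b} T" and Ta: "T a = \<infinity>"
  shows "evo {Suc a..b} T"
proof (cases "a \<le> b")
  case True
  have eq: "{Suc a..b} = {a..b} - {a}" using True by auto
  have I': "{a..b} - {a} \<subseteq> I" using I by auto
  show ?thesis unfolding eq evolution_iff[OF I']
  proof (intro ballI conjI allI impI)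
    fix i t assume i: "i \<in> {a..b} - {a}" and t: "(0::real) \<le> t" "ereal t \<le> T i"
    have "\<not> struck {a..b} T a t" using dies_iff[OF I E, of a t] Ta True t by auto
    then have "struck ({a..b} - {a}) T i t \<longleftrightarrow> struck {a..b} T i t"
      using hit_remove_survivor[OF I, of a t T i] i t Ta True by auto
    then show "T i = ereal t \<longleftrightarrow> struck ({a..b} - {a}) T i t" using dies_iff[OF I E, of i t] i t by auto
  qed (use nonneg[OF E] in auto)
qed (simp add: evolution_def present_def annihilated_def)

text \<open>Without the right-moving \<open>a\<close> that would have been the first to reach the static particle \<open>j\<close>, the
  particles between \<open>a\<close> and \<open>j\<close> still annihilate each other, and so do not disturb a system to the right of \<open>j\<close>.\<close>

lemma without_right_clearer:
  assumes I: "{a..b} \<subseteq> I" and j: "a < j" "j \<le> b" "v j = 0" and R: "clearsR a (j - 1)"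
    and E: "evo {j..b} T'" and T': "\<And>k t. k \<in> {j..b} \<Longrightarrow> 0 \<le> t \<Longrightarrow> ereal t \<le> T' k \<Longrightarrow> x j \<le> loc k t"
  obtains T where "evo {Suc a..b} T" "\<And>i. i \<in> {Suc a..<j} \<Longrightarrow> T i < ereal (x j - x a)"
    "\<And>i. i \<in> {j..b} \<Longrightarrow> T i = T' i"
proof -
  obtain T0 where T0: "evo {a..j - 1} T0" "T0 a = \<infinity>" "v a = 1" "a \<le> j - 1"
    "\<And>i. i \<in> {a<..j - 1} \<Longrightarrow> T0 i < \<infinity>"
    using R unfolding clears_right_def by auto
  have I': "{a..j - 1} \<subseteq> I" by (rule order_trans[OF _ I]) (use j in auto)
  have y: "x i < x j" if "i \<in> {a..j - 1}" for i
    using x[of i j] subsetD[OF I, of i] subsetD[OF I, of j] that j by auto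
  note B = clears_right_bounds[OF I' T0(1,4,3,2,5) y]
  define T where "T = (\<lambda>i. if i < j then T0 i else T' i)"
  have "evo {Suc a..j - 1} T0" by (rule drop_first[OF I' T0(1,2)])
  moreover have "T0 i = T i" if "i \<in> {Suc a..j - 1}" for i using that by (auto simp: T_def)
  ultimately have E1: "evo {Suc a..j - 1} T" using evolution_cong by blast
  have E2: "evo {j..b} T" using E evolution_cong[of "{j..b}" T' T] by (auto simp: T_def)
  have J: "{Suc a..j - 1} \<subseteq> I" by (rule order_trans[OF _ I]) (use j in auto)
  have K: "{j..b} \<subseteq> I" by (rule order_trans[OF _ I]) (use j in auto)
  have "evo ({Suc a..j - 1} \<union> {j..b}) T"
  proof (subst evolution_union[OF J K])
    fix i k t
    assume i: "i \<in> {Suc a..j - 1}" and k: "k \<in> {j..b}" and t: "0 \<le> t" "ereal t \<le> T i" "ereal t \<le> T k"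
      and eq: "loc i t = loc k t"
    have "i < j" using i j by auto
    then have "loc i t < x j" using B(2)[of i t] i t by (auto simp: T_def)
    moreover have "x j \<le> loc k t" using T'[of k t] k t by (auto simp: T_def)
    ultimately have False using eq by simp
    then show "v k = -1 \<and> (\<exists>j'\<in>{Suc a..j - 1}. \<exists>a'\<in>{Suc a..j - 1}. ereal t \<le> T j' \<and> ereal t \<le> T a' \<and>
        loc j' t = loc k t \<and> loc a' t = loc k t \<and> v a' = 1 \<and> v j' = 0 \<and> s j' = -1)" ..
  qed (use E1 E2 j in auto)
  moreover have "{Suc a..j - 1} \<union> {j..b} = {Suc a..b}" using j by auto
  moreover have "T i < ereal (x j - x a)" if "i \<in> {Suc a..<j}" for i
    using B(1)[of i] that by (auto simp: T_def)
  ultimately show ?thesis using that[of T] by (auto simp: T_def)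
qed

text \<open>Without \<open>a\<close>, it is \<open>m\<close> that removes the static \<open>j\<close>, so that nothing of the block up to \<open>m\<close> is left.\<close>

lemma opens_way_skip:
  assumes I: "{a..m} \<subseteq> I" "{a..k} \<subseteq> I" and O: "opens a j m"
  shows "clearsL (Suc a) k \<longleftrightarrow> m < k \<and> clearsL (Suc m) k"
proof -
  have j: "a < j" "j < m" "v j = 0" and R: "clearsR a (j - 1)" and L: "clearsL (Suc j) m"
    and time: "x j - x a \<le> x m - x j"
    using O by (auto simp: opens_way_def)
  have I': "{j..m} \<subseteq> I" using I(1) j by auto
  have jI: "j \<in> I" using I' j by auto
  obtain T' where T': "evo {j..m} T'" "T' j = ereal (x m - x j)" "T' m = ereal (x m - x j)"
    "\<And>i. i \<in> {j<..<m} \<Longrightarrow> T' i < ereal (x m - x j)"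
    using static_cleared_from_right[OF I' j(3) L] by blast
  have fin: "T' i \<le> ereal (x m - x j)" if "i \<in> {j..m}" for i
    using T'(2,3) T'(4)[of i] that by (cases "i = j \<or> i = m") (auto intro: less_imp_le)
  have above: "x j \<le> loc i t" if "i \<in> {j..m}" "0 \<le> t" "ereal t \<le> T' i" for i t
  \<comment> \<open>the block contains \<open>j\<close> itself, so only numbers below \<open>x j\<close> are strict lower bounds\<close>
  proof (rule field_le_epsilon)
    fix e :: real assume e: "0 < e"
    have "x j \<le> x l" if "l \<in> {j..m}" for l
      using x[of j l] jI subsetD[OF I' that] that by (cases "l = j") auto
    then have "x j - e < x l" if "l \<in> {j..m}" for l using e that by fastforce
    moreover have "T' i < \<infinity>" using fin[OF that(1)] by (auto intro: order_le_less_trans)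
    ultimately have "x j - e < loc i t"
      by (intro mortal_right_of[OF I' T'(1) that(1) _ that(2,3)]) auto
    then show "x j \<le> loc i t + e" by simp
  qed
  obtain T where T: "evo {Suc a..m} T" "\<And>i. i \<in> {Suc a..<j} \<Longrightarrow> T i < ereal (x j - x a)"
    "\<And>i. i \<in> {j..m} \<Longrightarrow> T i = T' i"
    by (rule without_right_clearer[OF I(1) j(1) _ j(3) R T'(1) above]) (use j in auto)
  have Tm: "T m = ereal (x m - x j)" using T(3)[of m] T'(3) j by simp
  have "T i \<le> T m" if "i \<in> {Suc a..m}" for i
  proof (cases "i < j")
    case True
    then have "T i < ereal (x j - x a)" using T(2)[of i] that by auto
    also have "\<dots> \<le> T m" using Tm time by simp
    finally show ?thesis by simp
  next
    case False
    then show ?thesis using T(3)[of i] fin[of i] Tm that by auto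
  qed
  then show ?thesis
    using clears_left_after[of "Suc a" k m T] I T(1) Tm j clears_left_ends[OF L]
    by (auto simp: atLeastatMost_subset_iff subset_iff)
qed

lemma collide_skip:
  assumes I: "{a..k} \<subseteq> I" "{a..b} \<subseteq> I" and C: "collides a k"
  shows "clearsL a b \<longleftrightarrow> k < b \<and> clearsL (Suc k) b" and "clearsL (Suc a) k"
proof -
  define \<tau> where "\<tau> = (x k - x a) / 2"
  obtain T where T: "evo {a..k} T" "T a = ereal \<tau>" "T k = ereal \<tau>" and k: "a < k" "v a = 1" "v k = -1"
    using C by (auto simp: collide_def \<tau>_def)
  have "x a < x k" using x[of a k] subsetD[OF I(1), of a] subsetD[OF I(1), of k] k by auto
  then have \<tau>: "0 \<le> \<tau>" "loc k \<tau> = loc a \<tau>" using k by (auto simp: \<tau>_def location_def field_simps)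
  have T_less: "T i < ereal \<tau>" if "i \<in> {a<..<k}" for i
    by (rule first_collision_splits(3)[OF I(1) T(1) k(1) _ \<tau>(1) T(2,3) \<tau>(2) that]) simp
  then have "T i \<le> T k" if "i \<in> {a..k}" for i
    using T that by (cases "i = a \<or> i = k") (auto intro: less_imp_le)
  then show "clearsL a b \<longleftrightarrow> k < b \<and> clearsL (Suc k) b"
    using clears_left_after[OF I(2,1) _ T(1)] k T by auto
  have "evo ({a..k} - {a}) (T(k := \<infinity>))"
    by (rule remove_pair[OF I(1) T(1) _ _ _ T(2,3)]) (use k T_less in auto)
  moreover have "{a..k} - {a} = {Suc a..k}" by auto
  ultimately have "evo {Suc a..k} (T(k := \<infinity>))" by simp
  then show "clearsL (Suc a) k"
  proof (rule clears_leftI)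
    fix i assume "i \<in> {Suc a..<k}"
    then have "T i < ereal \<tau>" "i \<noteq> k" using T_less by auto
    then show "(T(k := \<infinity>)) i < \<infinity>" by auto
  qed (use k in auto)
qed

text \<open>A right-moving first particle that dies does so either together with a left-moving particle or together with
  a static \<open>j\<close>. In the second case, no particle that is the first to cross \<open>j\<close> from the right can have been
  faster.\<close>

lemma right_fate:
  assumes I: "{a..n} \<subseteq> I" and E: "evo {a..n} T" and a: "a \<le> n" "v a = 1" "T a < \<infinity>"
  obtains (collision) k where "a < k" "k \<le> n" "collides a k" "T k < \<infinity>"
  | (obstacle) j where "a < j" "j \<le> n" "v j = 0" "T j < \<infinity>" "clearsR a (j - 1)" "evo {Suc j..n} T"
      "\<And>m. j < m \<Longrightarrow> m \<le> n \<Longrightarrow> v m = -1 \<Longrightarrow> T m = \<infinity> \<Longrightarrow>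
        x j - x a < x m - x j \<or> x j - x a = x m - x j \<and> s j = -1"
proof -
  obtain \<tau> where \<tau>: "T a = ereal \<tau>" using a nonneg[OF E, of a] by (cases "T a") auto
  obtain j where j: "a < j" "j \<le> n" "T j = ereal \<tau>" "loc j \<tau> = loc a \<tau>" "0 \<le> \<tau>"
    using first_dies_with_partner[OF I E a(1) \<tau>] .
  have aI: "a \<in> I" and jI: "j \<in> I" using I a j by auto
  note S = first_collision_splits[OF I E j(1,2,5) \<tau> j(3,4)]
  have "v j < v a" using velocity_decreasing[OF aI jI j(1,5)] j by simp
  then consider "v j = -1" | "v j = 0" using v[OF jI] a by auto
  then show ?thesis
  proof cases
    case 1
    then have "\<tau> = (x j - x a) / 2" using j(4) a by (simp add: location_def)
    then have "collides a j" using 1 S(1) j \<tau> a by (auto simp: collide_def)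
    then show ?thesis using collision j by auto
  next
    case 2
    have \<tau>x: "\<tau> = x j - x a" using j(4) a 2 by (simp add: location_def)
    have I': "{a..j} \<subseteq> I" using I j by auto
    have "evo ({a..j} - {j}) (T(a := \<infinity>))"
      by (rule remove_pair[OF I' S(1) _ _ _ j(3) \<tau>]) (use j S(3) in auto)
    moreover have "{a..j} - {j} = {a..j - 1}" using j by auto
    ultimately have E': "evo {a..j - 1} (T(a := \<infinity>))" by simp
    have "T i < \<infinity>" if "i \<in> {a<..j - 1}" for i
    proof -
      have "i \<in> {a<..<j}" using that j(1) by auto
      then show ?thesis using S(3)[of i] by auto
    qed
    then have R: "clearsR a (j - 1)" using E' a j by (auto simp: clears_right_def)
    have "x j - x a < x m - x j \<or> x j - x a = x m - x j \<and> s j = -1"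
      if m: "j < m" "m \<le> n" "v m = -1" "T m = \<infinity>" for m
    proof -
      define t where "t = x m - x j"
      have mI: "m \<in> I" using I m j by auto
      have t0: "0 \<le> t" using x[OF jI mI m(1)] by (simp add: t_def)
      have lm: "loc m t = loc j t" using m 2 by (simp add: location_def t_def)
      have in': "a \<in> {a..n}" "j \<in> {a..n}" "m \<in> {a..n}" using j m a by auto
      have "\<tau> \<le> t"
      proof (rule ccontr)
        assume "\<not> \<tau> \<le> t"
        then have Tj: "ereal t \<le> T j" "T j \<noteq> ereal t" using j by auto
        have "struck {a..n} T j t"
          by (rule hit_static[OF I in'(2) 2, of _ _ m]) (use m in' lm in \<open>auto simp: meets_def\<close>)
        then show False using dies_iff[OF I E in'(2) t0 Tj(1)] Tj by simp
      qed
      moreover have "s j = -1" if "t = \<tau>"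
      proof -
        have "struck {a..n} T a \<tau>" using dies_iff[OF I E in'(1) j(5)] \<tau> by simp
        moreover have "meet {a..n} T a \<tau> j" "meet {a..n} T a \<tau> m"
          using in' j m lm that by (auto simp: meets_def)
        ultimately have "s j \<noteq> 1" unfolding hit_def using 2 m a by force
        then show ?thesis using s[OF jI] by simp
      qed
      ultimately show ?thesis by (auto simp: t_def \<tau>x)
    qed
    then show ?thesis using obstacle[of j] j 2 R S(2) by auto
  qed
qed

lemma clears_left_right:
  assumes I: "{a..b} \<subseteq> I" and va: "v a = 1"
  shows "clearsL a b \<longleftrightarrow> (\<exists>j. opens a j b) \<or> (\<exists>k. a < k \<and> k < b \<and> collides a k \<and> clearsL (Suc k) b)"
proof
  assume L: "clearsL a b"
  then obtain T where T: "evo {a..b} T" "T b = \<infinity>" "v b = -1" "a \<le> b"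
    "\<And>i. i \<in> {a..<b} \<Longrightarrow> T i < \<infinity>"
    unfolding clears_left_def by auto
  have "a \<noteq> b" using va T by auto
  then have ab: "a < b" using T by simp
  have Ta: "T a < \<infinity>" using T(5) ab by simp
  show "(\<exists>j. opens a j b) \<or> (\<exists>k. a < k \<and> k < b \<and> collides a k \<and> clearsL (Suc k) b)"
  proof (cases rule: right_fate[OF I T(1) T(4) va Ta, case_names collision obstacle])
    case (collision k)
    then have "k < b" using T(2) by (cases "k = b") auto
    moreover from this have "{a..k} \<subseteq> I" using I by auto
    ultimately show ?thesis using collision collide_skip(1)[of a k b] I L by auto
  next
    case (obstacle j)
    then have jb: "j < b" using T(2) by (cases "j = b") auto
    have "clearsL (Suc j) b" by (rule clears_leftI[OF obstacle(6)]) (use jb obstacle T in auto)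
    then have "opens a j b" using obstacle jb T by (auto simp: opens_way_def)
    then show ?thesis by blast
  qed
next
  assume "(\<exists>j. opens a j b) \<or> (\<exists>k. a < k \<and> k < b \<and> collides a k \<and> clearsL (Suc k) b)"
  then show "clearsL a b"
  proof (elim disjE exE conjE)
    fix k assume k: "a < k" "k < b" "collides a k" "clearsL (Suc k) b"
    have "{a..k} \<subseteq> I" using I k by auto
    then show "clearsL a b" using collide_skip(1)[OF _ I k(3)] k by blast
  qed (rule opens_way_clears[OF I])
qed

text \<open>The blocks that would be crossed if the right-moving \<open>a\<close> were absent, sorted by what the presence of \<open>a\<close>
  changes. If \<open>a\<close> is stopped by a static particle \<open>j\<close>, some later particle \<open>m\<close> has to arrive at \<open>j\<close>, as \<open>j\<close>
  is removed in the absence of \<open>a\<close>.\<close>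

lemma clears_left_beyond_right:
  assumes I: "{a..k} \<subseteq> I" and va: "v a = 1" and ak: "a < k"
  shows "clearsL (Suc a) k \<longleftrightarrow> collides a k \<or> (\<exists>m j. m < k \<and> opens a j m \<and> clearsL (Suc m) k)"
proof
  assume L: "clearsL (Suc a) k"
  have I': "{Suc a..k} \<subseteq> I" using I by auto
  obtain T where T: "evo {a..k} T" using evolution_ex[OF I] by blast
  have kI: "k \<in> I" "a \<in> I" using I ak by auto
  have vk: "v k = -1" using clears_left_ends[OF L] by simp
  have Ta: "T a < \<infinity>"
  proof (rule ccontr)
    assume "\<not> T a < \<infinity>"
    then have inf: "T a = \<infinity>" by simp
    from clears_left_mortal(1)[OF drop_first[OF I T inf] L] have "T k = \<infinity>" .
    moreover have "0 \<le> x k - x a" using x[of a k] kI ak by auto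
    ultimately have "loc a (x k - x a) \<le> loc k (x k - x a)"
      using order_preserved[OF I T, of a k "x k - x a"] inf ak by auto
    then show False using x[of a k] kI ak va vk by (simp add: location_def)
  qed
  show "collides a k \<or> (\<exists>m j. m < k \<and> opens a j m \<and> clearsL (Suc m) k)"
  proof (cases rule: right_fate[OF I T less_imp_le[OF ak] va Ta, case_names collision obstacle])
    case (collision c)
    have I2: "{a..c} \<subseteq> I" using I collision by auto
    have "clearsL (Suc a) c" by (rule collide_skip(2)[OF I2 I collision(3)])
    then have "k = c" using clears_left_unique[OF I' L] collision by simp
    then show ?thesis using collision by simp
  next
    case (obstacle j)
    have jk: "j < k" using obstacle vk va by (cases "j = k") auto
    have jI: "j \<in> I" "{j} \<subseteq> I" and K: "{Suc j..k} \<subseteq> I" using I obstacle by auto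
    have "\<exists>m\<in>{Suc j..k}. v m = -1 \<and> T m = \<infinity>"
    proof (rule ccontr)
      assume none: "\<not> ?thesis"
      have above: "x j < loc i t" if i: "i \<in> {Suc j..k}" "0 \<le> t" "ereal t \<le> T i" for i t
      proof (cases "v i = -1")
        case True
        then have "T i < \<infinity>" using none i by auto
        then show ?thesis
          by (intro mortal_right_of[OF K obstacle(6) i(1) _ i(2,3)]) (use x jI K in auto)
      next
        case False
        then have "0 \<le> v i * t" using v[of i] subsetD[OF K i(1)] i(2) by auto
        moreover have "x j < x i" using x[of j i] jI subsetD[OF K i(1)] i(1) by auto
        ultimately show ?thesis by (simp add: location_def)
      qed
      \<comment> \<open>nothing from the right reaches \<open>j\<close>, which therefore survives if \<open>a\<close> is absent\<close>
      define T' where "T' = T(j := \<infinity>)"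
      have lj: "loc j t = x j" for t using obstacle by (simp add: location_def)
      have "evo {j} T'" unfolding evolution_iff[OF jI(2)]
        by (auto simp: T'_def hit_def meets_def)
      moreover have "evo {Suc j..k} T'"
        using obstacle(6) evolution_cong[of "{Suc j..k}" T T'] by (auto simp: T'_def)
      moreover have "evo ({j} \<union> {Suc j..k}) T' \<longleftrightarrow> evo {j} T' \<and> evo {Suc j..k} T'"
      proof (rule evolution_union[OF jI(2) K])
        fix i m t assume "i \<in> {j}" "m \<in> {Suc j..k}" "(0::real) \<le> t" "ereal t \<le> T' m" "loc i t = loc m t"
        then have False using above[of m t] lj by (auto simp: T'_def)
        then show "v m = -1 \<and> (\<exists>j'\<in>{j}. \<exists>a'\<in>{j}. ereal t \<le> T' j' \<and> ereal t \<le> T' a' \<and>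
          loc j' t = loc m t \<and> loc a' t = loc m t \<and> v a' = 1 \<and> v j' = 0 \<and> s j' = -1)" ..
      qed auto
      moreover have "{j} \<union> {Suc j..k} = {j..k}" using jk by auto
      ultimately have E': "evo {j..k} T'" by simp
      have "x j \<le> loc i t" if "i \<in> {j..k}" "0 \<le> t" "ereal t \<le> T' i" for i t
        using above[of i t] lj that by (cases "i = j") (auto simp: T'_def)
      then obtain T2 where T2: "evo {Suc a..k} T2" "\<And>i. i \<in> {j..k} \<Longrightarrow> T2 i = T' i"
        using without_right_clearer[OF I obstacle(1,2,3,5) E'] by blast
      then have "T2 j = \<infinity>" using jk by (simp add: T'_def)
      then show False using clears_left_mortal(2)[OF T2(1) L, of j] obstacle jk by auto
    qed
    then obtain m' where "m' \<in> {Suc j..k}" "v m' = -1" "T m' = \<infinity>" by blast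
    then obtain m where m: "m \<le> m'" "clearsL (Suc j) m" "T m = \<infinity>" "m' \<le> k"
      using left_survivor[OF K obstacle(6)] by (metis atLeastAtMost_iff)
    have m': "j < m" "v m = -1" using clears_left_ends[OF m(2)] by auto
    then have O: "opens a j m" using obstacle m by (auto simp: opens_way_def)
    have "{a..m} \<subseteq> I" using I m by auto
    then show ?thesis using opens_way_skip[OF _ I O] L O by blast
  qed
next
  assume "collides a k \<or> (\<exists>m j. m < k \<and> opens a j m \<and> clearsL (Suc m) k)"
  then show "clearsL (Suc a) k"
  proof (elim disjE exE conjE)
    assume "collides a k" then show ?thesis using collide_skip(2)[OF I I] by blast
  next
    fix m j assume m: "m < k" "opens a j m" "clearsL (Suc m) k"
    have "{a..m} \<subseteq> I" using I m by auto
    then show ?thesis using opens_way_skip[OF _ I m(2)] m by blast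
  qed
qed

lemma opens_way_not_collide:
  assumes I: "{a..n} \<subseteq> I" and mk: "m \<le> n" "k \<le> n" and O: "opens a j m" and C: "collides a k"
  shows False
proof -
  have I': "{a..m} \<subseteq> I" "{a..k} \<subseteq> I" using I mk by auto
  have "k < m" using collide_skip(1)[OF I'(2,1) C] opens_way_clears[OF I'(1) O] by simp
  moreover have "m < k" using opens_way_skip[OF I' O] collide_skip(2)[OF I'(2,1) C] by simp
  ultimately show False by simp
qed

end

section \<open>Symmetries of the dynamics\<close>

lemma annihilated_image:
  assumes f: "inj_on f J" and C: "C \<subseteq> J" and e: "e = 1 \<or> e = -1"
    and v: "\<And>i. i \<in> J \<Longrightarrow> v' i = e * v (f i)" and s: "\<And>i. i \<in> J \<Longrightarrow> s' i = e * s (f i)"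
  shows "annihilated v s (f ` C) = f ` annihilated v' s' C"
proof -
  have "card (f ` C) = card C" using card_image[OF inj_on_subset[OF f C]] .
  moreover have "(\<exists>j\<in>f ` C. v j = 0 \<and> v (f i) = s j) \<longleftrightarrow> (\<exists>j\<in>C. v' j = 0 \<and> v' i = s' j)"
    if "i \<in> C" for i
    using v s C e that by (auto simp: subset_iff)
  ultimately show ?thesis by (auto simp: annihilated_def)
qed

text \<open>Relabelling, translation and reflection in one statement: \<open>f\<close> relabels the particles and \<open>e = -1\<close> reflects
  the line, which also reverses the spins, as these name the direction of a survivor.\<close>

lemma evolution_transform:
  assumes f: "inj_on f J" and e: "e = 1 \<or> e = -1"
    and x: "\<And>i. i \<in> J \<Longrightarrow> x' i = e * x (f i) + c" and v: "\<And>i. i \<in> J \<Longrightarrow> v' i = e * v (f i)"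
    and s: "\<And>i. i \<in> J \<Longrightarrow> s' i = e * s (f i)" and T: "\<And>i. i \<in> J \<Longrightarrow> T' i = T (f i)"
  shows "evolution J x' v' s' T' \<longleftrightarrow> evolution (f ` J) x v s T"
proof -
  have P: "present (f ` J) x v T t y = f ` present J x' v' T' t (e * y + c)" for t y
    using e x v T by (auto simp: present_def image_iff)
  have D: "{i \<in> present (f ` J) x v T t y. T i = ereal t}
    = f ` {i \<in> present J x' v' T' t (e * y + c). T' i = ereal t}" for t y
    unfolding P using T by (auto simp: present_def)
  have S: "present J x' v' T' t y \<subseteq> J" for t y by (auto simp: present_def)
  have eq: "{i \<in> present (f ` J) x v T t y. T i = ereal t} = annihilated v s (present (f ` J) x v T t y)
    \<longleftrightarrow> {i \<in> present J x' v' T' t (e * y + c). T' i = ereal t}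
      = annihilated v' s' (present J x' v' T' t (e * y + c))" for t y
  proof -
    have "annihilated v s (f ` present J x' v' T' t (e * y + c))
      = f ` annihilated v' s' (present J x' v' T' t (e * y + c))"
      by (rule annihilated_image[of f J _ e v' v s' s, OF f S e v s])
    then show ?thesis unfolding D unfolding P
      using inj_on_image_eq_iff[OF f, of "{i \<in> present J x' v' T' t (e * y + c). T' i = ereal t}"
          "annihilated v' s' (present J x' v' T' t (e * y + c))"]
        S[of t "e * y + c"] annihilated_subset[of v' s' "present J x' v' T' t (e * y + c)"] by auto
  qed
  have "(\<forall>y. Q (e * y + c)) \<longleftrightarrow> (\<forall>y. Q y)" for Q
  proof -
    have "\<exists>z. y = e * z + c" for y
      by (rule exI[of _ "e * (y - c)"]) (use e in auto)
    then show ?thesis by metis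
  qed
  from this[of "\<lambda>y. {i \<in> present J x' v' T' _ y. T' i = ereal _} = annihilated v' s' (present J x' v' T' _ y)"]
  show ?thesis unfolding evolution_def eq using T by simp
qed

lemma clears_left_shift:
  assumes "\<And>i. i \<in> {a..b} \<Longrightarrow> x' i = x (i + k) + c" "\<And>i. i \<in> {a..b} \<Longrightarrow> v' i = v (i + k)"
    "\<And>i. i \<in> {a..b} \<Longrightarrow> s' i = s (i + k)"
  shows "clears_left x' v' s' a b \<longleftrightarrow> clears_left x v s (a + k) (b + k)"
proof -
  have img: "(\<lambda>i. i + k) ` {a..b} = {a + k..b + k}" by (simp add: image_add_atLeastAtMost')
  have E: "evolution {a..b} x' v' s' T' \<longleftrightarrow> evolution {a + k..b + k} x v s T"
    if "\<And>i. i \<in> {a..b} \<Longrightarrow> T' i = T (i + k)" for T T'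
    unfolding img[symmetric]
    by (rule evolution_transform[where e = 1 and c = c]) (use assms that in auto)
  have mem: "i - k \<in> {a..<b}" "i - k + k = i" if "i \<in> {a + k..<b + k}" for i
    using that by auto
  show ?thesis
  proof (intro iffI)
    assume "clears_left x' v' s' a b"
    then obtain T where T: "a \<le> b" "v' b = -1" "evolution {a..b} x' v' s' T" "T b = \<infinity>"
      "\<forall>i\<in>{a..<b}. T i < \<infinity>" unfolding clears_left_def by auto
    then have "evolution {a + k..b + k} x v s (\<lambda>i. T (i - k))" using E[of T "\<lambda>i. T (i - k)"] by auto
    then show "clears_left x v s (a + k) (b + k)"
      using T assms(2)[of b] mem(1) unfolding clears_left_def
      by (auto intro!: exI[of _ "\<lambda>i. T (i - k)"])
  next
    assume "clears_left x v s (a + k) (b + k)"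
    then obtain T where T: "a \<le> b" "v (b + k) = -1" "evolution {a + k..b + k} x v s T" "T (b + k) = \<infinity>"
      "\<forall>i\<in>{a + k..<b + k}. T i < \<infinity>" unfolding clears_left_def by auto
    then have "evolution {a..b} x' v' s' (\<lambda>i. T (i + k))" using E[of "\<lambda>i. T (i + k)" T] by auto
    then show "clears_left x' v' s' a b"
      using T assms(2)[of b] unfolding clears_left_def
      by (auto intro!: exI[of _ "\<lambda>i. T (i + k)"])
  qed
qed

lemma clears_left_mirror:
  assumes "\<And>i. i \<in> {a..b} \<Longrightarrow> x' i = c - x (n - i)" "\<And>i. i \<in> {a..b} \<Longrightarrow> v' i = - v (n - i)"
    "\<And>i. i \<in> {a..b} \<Longrightarrow> s' i = - s (n - i)" and n: "a \<le> b" "b \<le> n"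
  shows "clears_left x' v' s' a b \<longleftrightarrow> clears_right x v s (n - b) (n - a)"
proof -
  have img: "(\<lambda>i. n - i) ` {a..b} = {n - b..n - a}"
  proof (intro set_eqI iffI)
    fix i assume "i \<in> {n - b..n - a}"
    then show "i \<in> (\<lambda>i. n - i) ` {a..b}" by (intro image_eqI[of _ _ "n - i"]) (use n in auto)
  qed (use n in auto)
  have inj: "inj_on (\<lambda>i. n - i) {a..b}" using n by (auto simp: inj_on_def)
  have E: "evolution {a..b} x' v' s' T' \<longleftrightarrow> evolution {n - b..n - a} x v s T"
    if "\<And>i. i \<in> {a..b} \<Longrightarrow> T' i = T (n - i)" for T T'
    unfolding img[symmetric]
    by (rule evolution_transform[where e = "-1" and c = c, OF inj]) (use assms that in auto)
  have mem: "n - i \<in> {a..<b}" if "i \<in> {n - b<..n - a}" for i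
    using that n by auto
  have mem': "n - i \<in> {n - b<..n - a}" if "i \<in> {a..<b}" for i
    using that n by auto
  show ?thesis
  proof (intro iffI)
    assume "clears_left x' v' s' a b"
    then obtain T where T: "a \<le> b" "v' b = -1" "evolution {a..b} x' v' s' T" "T b = \<infinity>"
      "\<forall>i\<in>{a..<b}. T i < \<infinity>" unfolding clears_left_def by auto
    have "evolution {n - b..n - a} x v s (\<lambda>i. T (n - i))"
      using E[of T "\<lambda>i. T (n - i)"] T n by auto
    then show "clears_right x v s (n - b) (n - a)"
      using T assms(2)[of b] mem n unfolding clears_right_def
      by (auto intro!: exI[of _ "\<lambda>i. T (n - i)"])
  next
    assume "clears_right x v s (n - b) (n - a)"
    then obtain T where T: "v (n - b) = 1" "evolution {n - b..n - a} x v s T" "T (n - b) = \<infinity>"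
      "\<forall>i\<in>{n - b<..n - a}. T i < \<infinity>" unfolding clears_right_def by auto
    then have "evolution {a..b} x' v' s' (\<lambda>i. T (n - i))" using E[of "\<lambda>i. T (n - i)" T] by auto
    then show "clears_left x' v' s' a b"
      using T assms(2)[of b] mem' n unfolding clears_left_def
      by (auto intro!: exI[of _ "\<lambda>i. T (n - i)"])
  qed
qed

section \<open>The first crossing\<close>

lemma configuration_subset: "configuration I x v s \<Longrightarrow> J \<subseteq> I \<Longrightarrow> configuration J x v s"
  by (simp add: configuration_def subset_iff)

lemma first_crossing_eq_iff:
  "first_crossing x v s = enat n \<longleftrightarrow>
     1 \<le> n \<and> crosses_zero x v s n \<and> (\<forall>m. 1 \<le> m \<and> m < n \<longrightarrow> \<not> crosses_zero x v s m)"
proof -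
  define S where "S = {n. 1 \<le> n \<and> crosses_zero x v s n}"
  have fc: "first_crossing x v s = (INF n\<in>S. enat n)" by (simp add: first_crossing_def S_def)
  have "(INF n\<in>S. enat n) = enat n \<longleftrightarrow> n \<in> S \<and> (\<forall>m\<in>S. n \<le> m)"
  proof (intro iffI)
    assume I: "(INF n\<in>S. enat n) = enat n"
    then have "S \<noteq> {}" by (auto simp: top_enat_def)
    then obtain m where "m \<in> S" by blast
    then have "(INF n\<in>S. enat n) \<in> enat ` S" by (intro wellorder_InfI[of "enat m"]) simp
    moreover have "enat n \<le> enat m" if "m \<in> S" for m unfolding I[symmetric] by (rule INF_lower[OF that])
    ultimately show "n \<in> S \<and> (\<forall>m\<in>S. n \<le> m)" using I by auto
  next
    assume "n \<in> S \<and> (\<forall>m\<in>S. n \<le> m)"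
    then show "(INF n\<in>S. enat n) = enat n"
      by (intro antisym INF_lower2[of n] INF_greatest) auto
  qed
  then show ?thesis unfolding fc by (auto simp: S_def not_le[symmetric])
qed

text \<open>A left-moving particle that reaches \<open>0\<close> has left the hull of the initial positions, outside of which
  nothing dies.\<close>

lemma (in configuration) crosses_zero_iff_immortal:
  assumes I: "{1..n} \<subseteq> I" and n: "1 \<le> n" and pos: "\<And>i. i \<in> {1..n} \<Longrightarrow> 0 < x i"
  shows "crosses_zero x v s n \<longleftrightarrow> v n = -1 \<and> (\<exists>T. evo {1..n} T \<and> T n = \<infinity>)"
proof -
  have "T n = \<infinity>" if T: "evo {1..n} T" "ereal (x n) < T n" and vn: "v n = -1" for T
  proof (rule ccontr)
    assume inf: "T n \<noteq> \<infinity>"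
    have "n \<in> {1..n}" using n by simp
    then have "0 < loc n (x n)"
      by (rule mortal_right_of[OF I T(1)]) (use pos inf n T(2) in \<open>auto intro: less_imp_le\<close>)
    then show False using vn by (simp add: location_def)
  qed
  then show ?thesis unfolding crosses_zero_def by fastforce
qed

text \<open>If \<open>n\<close> is the first to cross, then it is the leftmost survivor moving left, and so all particles
  before it are dead.\<close>

lemma (in configuration) first_crossing_iff:
  assumes I: "{1..} \<subseteq> I" and pos: "\<And>i. 1 \<le> i \<Longrightarrow> 0 < x i"
  shows "first_crossing x v s = enat n \<longleftrightarrow> 1 \<le> n \<and> clearsL 1 n"
proof -
  have I': "{1..n} \<subseteq> I" for n using I by auto
  have cz: "crosses_zero x v s n \<longleftrightarrow> v n = -1 \<and> (\<exists>T. evo {1..n} T \<and> T n = \<infinity>)" if "1 \<le> n" for n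
    by (rule crosses_zero_iff_immortal[OF I' that]) (use pos in auto)
  have lc: "crosses_zero x v s m" if "clearsL 1 m" for m
    using that cz[of m] by (auto simp: clears_left_def)
  have ex: "\<exists>m. 1 \<le> m \<and> m \<le> n \<and> clearsL 1 m" if c: "crosses_zero x v s n" and n: "1 \<le> n" for n
  proof -
    obtain T where T: "v n = -1" "evo {1..n} T" "T n = \<infinity>" using c cz[OF n] by blast
    then show ?thesis using left_survivor[OF I' T(2), of n] n clears_left_ends
      by (metis atLeastAtMost_iff order_refl)
  qed
  show ?thesis unfolding first_crossing_eq_iff
  proof (intro iffI conjI allI impI)
    assume a: "1 \<le> n \<and> crosses_zero x v s n \<and> (\<forall>m. 1 \<le> m \<and> m < n \<longrightarrow> \<not> crosses_zero x v s m)"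
    then obtain m where "1 \<le> m" "m \<le> n" "clearsL 1 m" using ex by blast
    then show "clearsL 1 n" using a lc[of m] by (cases "m = n") auto
  next
    fix m assume n: "1 \<le> n \<and> clearsL 1 n" and m: "1 \<le> m \<and> m < n"
    show "\<not> crosses_zero x v s m"
    proof
      assume "crosses_zero x v s m"
      then obtain k where "k \<le> m" "clearsL 1 k" using ex m by blast
      then show False using clears_left_unique[OF I', of n k] n m by auto
    qed
  qed (use lc in auto)
qed

section \<open>Measurability\<close>

lemma (in configuration) collide_iff:
  assumes I: "{a..k} \<subseteq> I" and va: "v a = 1" and ak: "a < k"
  shows "collides a k \<longleftrightarrow> clearsL (Suc a) k \<and> \<not> (\<exists>m\<in>{a..<k}. \<exists>j\<in>{a<..<m}. opens a j m \<and> clearsL (Suc m) k)"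
proof -
  have "j \<in> {a<..<m} \<and> m \<in> {a..<k} \<longleftrightarrow> m < k" if "opens a j m" for m j
    using that by (auto simp: opens_way_def)
  then show ?thesis
    using clears_left_beyond_right[OF assms] opens_way_not_collide[OF I _ order_refl]
    by (metis less_imp_le)
qed

text \<open>The three cases for the velocity of the first particle, in the form used for measurability.\<close>

lemma (in configuration) clears_left_rec:
  assumes I: "{a..b} \<subseteq> I"
  shows "clearsL a b \<longleftrightarrow> a \<le> b \<and> (v a = -1 \<and> b = a
    \<or> v a = 0 \<and> (\<exists>c\<in>{a<..<b}. clearsL (Suc a) c \<and> clearsL (Suc c) b)
    \<or> v a = 1 \<and> ((\<exists>j\<in>{a<..<b}. opens a j b) \<or> (\<exists>k\<in>{a<..<b}. collides a k \<and> clearsL (Suc k) b)))"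
proof (cases "a \<le> b")
  case False
  then show ?thesis by (simp add: clears_left_def)
next
  case True
  then have "a \<in> I" using I by auto
  have j: "j \<in> {a<..<b}" if "opens a j b" for j using that by (auto simp: opens_way_def)
  show ?thesis
    using v[OF \<open>a \<in> I\<close>] clears_left_left[OF I] clears_left_static[OF I] clears_left_right[OF I] True j
    by (elim disjE) (auto simp: Bex_def)
qed

definition random_configuration ::
  "'w measure \<Rightarrow> nat set \<Rightarrow> (nat \<Rightarrow> 'w \<Rightarrow> real) \<Rightarrow> (nat \<Rightarrow> 'w \<Rightarrow> real) \<Rightarrow> (nat \<Rightarrow> 'w \<Rightarrow> real) \<Rightarrow> bool" where
  "random_configuration M I x v s \<longleftrightarrow>
     (\<forall>i\<in>I. x i \<in> borel_measurable M \<and> v i \<in> borel_measurable M \<and> s i \<in> borel_measurable M) \<and>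
     (\<forall>\<omega>\<in>space M. configuration I (\<lambda>i. x i \<omega>) (\<lambda>i. v i \<omega>) (\<lambda>i. s i \<omega>))"

lemma random_configuration_subset:
  "random_configuration M I x v s \<Longrightarrow> J \<subseteq> I \<Longrightarrow> random_configuration M J x v s"
  by (auto simp: random_configuration_def intro: configuration_subset)

lemma random_configuration_mirror:
  assumes R: "random_configuration M {a..b} x v s"
  shows "random_configuration M {a..b} (\<lambda>i \<omega>. - x (a + b - i) \<omega>) (\<lambda>i \<omega>. - v (a + b - i) \<omega>)
    (\<lambda>i \<omega>. - s (a + b - i) \<omega>)"
proof -
  have i: "a + b - i \<in> {a..b}" if "i \<in> {a..b}" for i using that by auto
  have "configuration {a..b} (\<lambda>i. - x (a + b - i) \<omega>) (\<lambda>i. - v (a + b - i) \<omega>)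
    (\<lambda>i. - s (a + b - i) \<omega>)" if "\<omega> \<in> space M" for \<omega>
  proof -
    interpret C: configuration "{a..b}" "\<lambda>i. x i \<omega>" "\<lambda>i. v i \<omega>" "\<lambda>i. s i \<omega>"
      using R that by (simp add: random_configuration_def)
    show ?thesis
    proof
      fix i j assume "i \<in> {a..b}" "j \<in> {a..b}" "i < j"
      then show "- x (a + b - i) \<omega> < - x (a + b - j) \<omega>"
        using C.x[of "a + b - j" "a + b - i"] i by auto
    next
      fix k assume "k \<in> {a..b}"
      then show "- v (a + b - k) \<omega> = - 1 \<or> - v (a + b - k) \<omega> = 0 \<or> - v (a + b - k) \<omega> = 1"
        "- s (a + b - k) \<omega> = - 1 \<or> - s (a + b - k) \<omega> = 1"
        using C.v[OF i] C.s[OF i] by force+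
    qed
  qed
  then show ?thesis using R i by (simp add: random_configuration_def)
qed

abbreviation random_clears_left ("LEFT") where
  "LEFT x v s a b \<omega> \<equiv> clears_left (\<lambda>i. x i \<omega>) (\<lambda>i. v i \<omega>) (\<lambda>i. s i \<omega>) a b"
abbreviation random_clears_right ("RIGHT") where
  "RIGHT x v s a b \<omega> \<equiv> clears_right (\<lambda>i. x i \<omega>) (\<lambda>i. v i \<omega>) (\<lambda>i. s i \<omega>) a b"
abbreviation random_opens_way ("OPENS") where
  "OPENS x v s a j b \<omega> \<equiv> opens_way (\<lambda>i. x i \<omega>) (\<lambda>i. v i \<omega>) (\<lambda>i. s i \<omega>) a j b"
abbreviation random_collide ("COLLIDE") where
  "COLLIDE x v s a b \<omega> \<equiv> collide (\<lambda>i. x i \<omega>) (\<lambda>i. v i \<omega>) (\<lambda>i. s i \<omega>) a b"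

lemma clears_right_eq_mirror:
  assumes "a \<le> b"
  shows "RIGHT x v s a b \<omega> =
    LEFT (\<lambda>i \<omega>. - x (a + b - i) \<omega>) (\<lambda>i \<omega>. - v (a + b - i) \<omega>) (\<lambda>i \<omega>. - s (a + b - i) \<omega>) a b \<omega>"
  using assms by (subst clears_left_mirror[where c = 0 and n = "a + b"]) auto

lemma pred_opens_way_if:
  assumes R: "random_configuration M {a..b} x v s"
    and "Measurable.pred M (RIGHT x v s a (j - 1))" "Measurable.pred M (LEFT x v s (Suc j) b)"
  shows "Measurable.pred M (OPENS x v s a j b)"
proof (cases "a < j \<and> j < b")
  case True
  then have "x a \<in> borel_measurable M" "x j \<in> borel_measurable M" "x b \<in> borel_measurable M"
    "v j \<in> borel_measurable M" "s j \<in> borel_measurable M"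
    using R by (auto simp: random_configuration_def)
  note [measurable] = this assms(2,3)
  show ?thesis unfolding opens_way_def by measurable
next
  case False
  then have "OPENS x v s a j b = (\<lambda>_. False)" by (auto simp: opens_way_def fun_eq_iff)
  then show ?thesis by simp
qed

lemma pred_collide_if:
  assumes R: "random_configuration M {a..k} x v s" and ak: "a < k"
    and L: "\<And>m. m \<in> {a..<k} \<Longrightarrow> Measurable.pred M (LEFT x v s (Suc m) k)"
    and O: "\<And>m j. m \<in> {a..<k} \<Longrightarrow> j \<in> {a<..<m} \<Longrightarrow> Measurable.pred M (OPENS x v s a j m)"
  shows "Measurable.pred M (COLLIDE x v s a k)"
proof -
  have "v a \<in> borel_measurable M" using R ak by (auto simp: random_configuration_def)
  then have pv: "Measurable.pred M (\<lambda>\<omega>. v a \<omega> = 1)" by simp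
  have "Measurable.pred M (\<lambda>\<omega>. v a \<omega> = 1 \<and> LEFT x v s (Suc a) k \<omega> \<and>
      \<not> (\<exists>m\<in>{a..<k}. \<exists>j\<in>{a<..<m}. OPENS x v s a j m \<omega> \<and> LEFT x v s (Suc m) k \<omega>))"
    by (intro pred_intros_logic(2,3) pred_intros_countable_bounded(4) L O pv) (use ak in auto)
  also have "?this \<longleftrightarrow> ?thesis"
  proof (rule measurable_cong)
    fix \<omega> assume "\<omega> \<in> space M"
    then interpret C: configuration "{a..k}" "\<lambda>i. x i \<omega>" "\<lambda>i. v i \<omega>" "\<lambda>i. s i \<omega>"
      using R by (simp add: random_configuration_def)
    show "(v a \<omega> = 1 \<and> LEFT x v s (Suc a) k \<omega> \<and>
      \<not> (\<exists>m\<in>{a..<k}. \<exists>j\<in>{a<..<m}. OPENS x v s a j m \<omega> \<and> LEFT x v s (Suc m) k \<omega>))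
      \<longleftrightarrow> COLLIDE x v s a k \<omega>"
      using C.collide_iff[OF order_refl _ ak] by (auto simp: collide_def)
  qed
  finally show ?thesis .
qed

text \<open>The dynamics is a complicated function of the real positions, but the recursion expresses
  \<open>clears_left\<close> by shorter blocks, their mirror images and comparisons of distances. The induction is over all random
  configurations at once, since it passes to mirror images.\<close>

lemma pred_clears_left:
  "random_configuration M {a..b} x v s \<Longrightarrow> Measurable.pred M (LEFT x v s a b)"
proof (induction "b - a" arbitrary: a b x v s rule: less_induct)
  case less
  note R = less.prems
  have clearsL: "Measurable.pred M (LEFT x v s c d)" if "a < c" "d \<le> b" "c \<le> d" for c d
    by (rule less.hyps) (use that random_configuration_subset[OF R] in auto)
  have clearsR: "Measurable.pred M (RIGHT x v s a d)" if "a \<le> d" "d < b" for d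
    unfolding clears_right_eq_mirror[OF that(1)]
    by (rule less.hyps)
      (use that random_configuration_mirror[OF random_configuration_subset[OF R]] in auto)
  have opens: "Measurable.pred M (OPENS x v s a j d)" if "j \<in> {a<..<d}" "d \<le> b" for j d
    by (rule pred_opens_way_if[OF random_configuration_subset[OF R]]) (use that clearsL clearsR in auto)
  have collides: "Measurable.pred M (COLLIDE x v s a k)" if "k \<in> {a<..<b}" for k
    by (rule pred_collide_if[OF random_configuration_subset[OF R]]) (use that clearsL opens in auto)
  show ?case
  proof (cases "a \<le> b")
    case False
    then show ?thesis by (simp add: clears_left_def)
  next
    case True
    then have va: "v a \<in> borel_measurable M" using R by (auto simp: random_configuration_def)
    have pv: "Measurable.pred M (\<lambda>\<omega>. v a \<omega> = c)" for c using va by simp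
    have "Measurable.pred M (\<lambda>\<omega>. a \<le> b \<and> (v a \<omega> = -1 \<and> b = a
      \<or> v a \<omega> = 0 \<and> (\<exists>c\<in>{a<..<b}. LEFT x v s (Suc a) c \<omega> \<and> LEFT x v s (Suc c) b \<omega>)
      \<or> v a \<omega> = 1 \<and> ((\<exists>j\<in>{a<..<b}. OPENS x v s a j b \<omega>) \<or>
          (\<exists>k\<in>{a<..<b}. COLLIDE x v s a k \<omega> \<and> LEFT x v s (Suc k) b \<omega>))))"
      by (intro pred_intros_logic(3,5) pred_intros_countable_bounded(4) clearsL opens collides pv) (use True in auto)
    also have "?this \<longleftrightarrow> ?thesis"
    proof (rule measurable_cong)
      fix \<omega> assume "\<omega> \<in> space M"
      then interpret C: configuration "{a..b}" "\<lambda>i. x i \<omega>" "\<lambda>i. v i \<omega>" "\<lambda>i. s i \<omega>"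
        using R by (simp add: random_configuration_def)
      show "(a \<le> b \<and> (v a \<omega> = -1 \<and> b = a
        \<or> v a \<omega> = 0 \<and> (\<exists>c\<in>{a<..<b}. LEFT x v s (Suc a) c \<omega> \<and> LEFT x v s (Suc c) b \<omega>)
        \<or> v a \<omega> = 1 \<and> ((\<exists>j\<in>{a<..<b}. OPENS x v s a j b \<omega>) \<or>
          (\<exists>k\<in>{a<..<b}. COLLIDE x v s a k \<omega> \<and> LEFT x v s (Suc k) b \<omega>))))
        \<longleftrightarrow> LEFT x v s a b \<omega>"
        unfolding C.clears_left_rec[OF order_refl] ..
    qed
    finally show ?thesis .
  qed
qed

lemma pred_clears_right:
  assumes "random_configuration M {a..b} x v s"
  shows "Measurable.pred M (RIGHT x v s a b)"
proof (cases "a \<le> b")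
  case True
  show ?thesis unfolding clears_right_eq_mirror[OF True]
    by (rule pred_clears_left[OF random_configuration_mirror[OF assms]])
qed (simp add: clears_right_def)

lemma pred_opens_way:
  assumes "random_configuration M {a..b} x v s"
  shows "Measurable.pred M (OPENS x v s a j b)"
proof (cases "a < j \<and> j < b")
  case True
  show ?thesis
    by (rule pred_opens_way_if[OF assms])
      (use True in \<open>auto intro!: pred_clears_left pred_clears_right random_configuration_subset[OF assms]\<close>)
next
  case False
  then have "OPENS x v s a j b = (\<lambda>_. False)" by (auto simp: opens_way_def fun_eq_iff)
  then show ?thesis by simp
qed

lemma pred_collide:
  assumes "random_configuration M {a..b} x v s"
  shows "Measurable.pred M (COLLIDE x v s a b)"
proof (cases "a < b")
  case True
  show ?thesis
    by (rule pred_collide_if[OF assms True])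
      (auto intro!: pred_clears_left pred_opens_way random_configuration_subset[OF assms])
qed (simp add: collide_def)

section \<open>Laws of the model\<close>

text \<open>All lengths, velocities and spins form one independent family, indexed by a disjoint sum. In this way lengths
  and velocities can be permuted differently: reversing a block of particles shifts the lengths against the
  velocities.\<close>

type_synonym index = "nat + nat + nat"

definition lengths :: "(index \<Rightarrow> real) \<Rightarrow> nat \<Rightarrow> real" where "lengths q i = q (Inl i)"
definition velocities :: "(index \<Rightarrow> real) \<Rightarrow> nat \<Rightarrow> real" where "velocities q i = q (Inr (Inl i))"
definition spins :: "(index \<Rightarrow> real) \<Rightarrow> nat \<Rightarrow> real" where "spins q i = q (Inr (Inr i))"

definition indices :: "nat set \<Rightarrow> index set" where
  "indices A = A <+> (A <+> A)"

lemma indices_simps [simp]: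
  "Inl i \<in> indices A \<longleftrightarrow> i \<in> A" "Inr (Inl i) \<in> indices A \<longleftrightarrow> i \<in> A" "Inr (Inr i) \<in> indices A \<longleftrightarrow> i \<in> A"
  by (auto simp: indices_def)

lemma indices_mono: "A \<subseteq> B \<Longrightarrow> indices A \<subseteq> indices B"
  by (auto simp: indices_def)

lemma indices_disjoint: "A \<inter> B = {} \<Longrightarrow> indices A \<inter> indices B = {}"
  by (auto simp: indices_def)

definition laws :: "real \<Rightarrow> real measure \<Rightarrow> index \<Rightarrow> real measure" where
  "laws p m = case_sum (\<lambda>_. m) (case_sum (\<lambda>_. velocity_law p) (\<lambda>_. spin_law))"

lemma laws_simps [simp]:
  "laws p m (Inl i) = m" "laws p m (Inr (Inl i)) = velocity_law p" "laws p m (Inr (Inr i)) = spin_law"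
  by (simp_all add: laws_def)

lemma space_velocity_law [simp]: "space (velocity_law p) = {-1, 0, 1}"
  by (simp add: velocity_law_def space_point_measure)

lemma sets_velocity_law [simp]: "sets (velocity_law p) = Pow {-1, 0, 1}"
  by (simp add: velocity_law_def sets_point_measure)

lemma space_spin_law [simp]: "space spin_law = {-1, 1}"
  by (simp add: spin_law_def space_uniform_count_measure)

lemma sets_spin_law [simp]: "sets spin_law = Pow {-1, 1}"
  by (simp add: spin_law_def sets_uniform_count_measure)

lemma emeasure_velocity_law:
  assumes "X \<subseteq> {-1, 0, 1}"
  shows "emeasure (velocity_law p) X = (\<Sum>u\<in>X. ennreal (if u = 0 then p else (1 - p) / 2))"
  unfolding velocity_law_def by (rule emeasure_point_measure_finite) (use assms in auto)

lemma emeasure_spin_law: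
  assumes "X \<subseteq> {-1, 1}"
  shows "emeasure spin_law X = ennreal (card X / 2)"
  unfolding spin_law_def using assms by (subst emeasure_uniform_count_measure) auto

lemma prob_space_velocity_law: "0 \<le> p \<Longrightarrow> p \<le> 1 \<Longrightarrow> prob_space (velocity_law p)"
  by (rule prob_spaceI) (simp add: emeasure_velocity_law flip: ennreal_plus)

lemma prob_space_spin_law: "prob_space spin_law"
  by (rule prob_spaceI) (simp add: emeasure_spin_law)

lemma velocity_law_symmetric: "distr (velocity_law p) (velocity_law p) uminus = velocity_law p"
proof (rule measure_eqI)
  fix X assume "X \<in> sets (distr (velocity_law p) (velocity_law p) uminus)"
  then have X: "X \<subseteq> {-1, 0, 1}" by simp
  have v: "uminus -` X \<inter> {-1, 0, 1} = uminus ` X" using X by (auto simp: image_iff)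
  have "uminus ` X \<subseteq> {-1, 0, 1}" using X by auto
  then show "emeasure (distr (velocity_law p) (velocity_law p) uminus) X = emeasure (velocity_law p) X"
    using X by (subst emeasure_distr)
      (auto simp: v emeasure_velocity_law sum.reindex measurable_def intro!: sum.cong)
qed simp

lemma spin_law_symmetric: "distr spin_law spin_law uminus = spin_law"
proof (rule measure_eqI)
  fix X assume "X \<in> sets (distr spin_law spin_law uminus)"
  then have X: "X \<subseteq> {-1, 1}" by simp
  have v: "uminus -` X \<inter> {-1, 1} = uminus ` X" using X by (auto simp: image_iff)
  have "uminus ` X \<subseteq> {-1, 1}" using X by auto
  then show "emeasure (distr spin_law spin_law uminus) X = emeasure spin_law X"
    using X by (subst emeasure_distr)
      (auto simp: v emeasure_spin_law card_image measurable_def)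
qed simp

section \<open>Observables\<close>

context ballistic_annihilation
begin

abbreviation "N \<equiv> laws p m"

definition Y :: "'a \<Rightarrow> index \<Rightarrow> real" where
  "Y \<omega> i = case_sum l (case_sum v s) i \<omega>"

lemma Y_simps: "lengths (Y \<omega>) = (\<lambda>i. l i \<omega>)" "velocities (Y \<omega>) = (\<lambda>i. v i \<omega>)" "spins (Y \<omega>) = (\<lambda>i. s i \<omega>)"
  by (auto simp: fun_eq_iff Y_def lengths_def velocities_def spins_def)

lemma space_m: "space m = {0<..}"
  using sets_eq_imp_space_eq[OF m(2)] by (simp add: space_restrict_space)

lemma prob_space_laws: "prob_space (N i)"
  using m(1) prob_space_velocity_law[OF p] prob_space_spin_law by (auto simp: laws_def split: sum.split)

lemma laws_borel: "(\<lambda>x. x) \<in> measurable (N i) borel"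
proof -
  have "(\<lambda>x. x) \<in> measurable m borel"
    by (subst measurable_cong_sets[OF m(2) refl]) (auto intro: measurable_restrict_space1)
  then show ?thesis by (auto simp: laws_def measurable_def split: sum.split)
qed

definition valid :: "(index \<Rightarrow> real) \<Rightarrow> bool" where
  "valid q \<longleftrightarrow> (\<forall>i\<in>indices {1..}. q i \<in> space (N i))"

lemma Y_rv: "i \<in> indices {1..} \<Longrightarrow> (\<lambda>\<omega>. Y \<omega> i) \<in> measurable M (N i)"
  using law_l(1) law_v(1) law_s(1) by (auto simp: indices_def Y_def)

lemma Y_law: "i \<in> indices {1..} \<Longrightarrow> distr M (N i) (\<lambda>\<omega>. Y \<omega> i) = N i"
  using law_l(2) law_v(2) law_s(2) by (auto simp: indices_def Y_def)

lemma Y_valid: "\<omega> \<in> space M \<Longrightarrow> valid (Y \<omega>)"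
  using measurable_space[OF Y_rv] by (auto simp: valid_def)

lemma Y_indep: "indep_vars N (\<lambda>i \<omega>. Y \<omega> i) (indices {1..})"
proof -
  have "(\<lambda>i \<omega>. Y \<omega> i) = case_sum l (case_sum v s)" by (simp add: Y_def fun_eq_iff)
  then show ?thesis using indep by (simp add: laws_def indices_def)
qed

text \<open>Permuting the indices and applying measure preserving maps to the coordinates does not change the law of an
  independent family whose members at exchanged indices have the same law.\<close>

lemma law_of_transformed_family:
  assumes K: "K \<noteq> {}" and \<pi>: "inj_on \<pi> K" "\<pi> ` K \<subseteq> indices {1..}" "\<And>i. i \<in> K \<Longrightarrow> N (\<pi> i) = N i"
    and g: "\<And>i. i \<in> K \<Longrightarrow> g i \<in> measurable (N i) (N i)" "\<And>i. i \<in> K \<Longrightarrow> distr (N i) (N i) (g i) = N i"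
  shows "distr M (PiM K N) (\<lambda>\<omega>. \<lambda>i\<in>K. g i (Y \<omega> (\<pi> i))) = PiM K N"
proof -
  define J where "J = \<pi> ` K"
  have J: "J \<noteq> {}" "J \<subseteq> indices {1..}" using K \<pi> by (auto simp: J_def)
  have rv: "(\<lambda>\<omega>. Y \<omega> i) \<in> measurable M (N i)" if "i \<in> J" for i using Y_rv that J by auto
  interpret P: product_prob_space N J
    by (intro product_prob_spaceI prob_space_laws)
  have "indep_vars N (\<lambda>i \<omega>. Y \<omega> i) J" by (rule indep_vars_subset[OF Y_indep J(2)])
  then have D: "distr M (PiM J N) (\<lambda>\<omega>. \<lambda>i\<in>J. Y \<omega> i) = PiM J (\<lambda>i. distr M (N i) (\<lambda>\<omega>. Y \<omega> i))"
    using indep_vars_iff_distr_eq_PiM'[OF J(1), of "\<lambda>i \<omega>. Y \<omega> i" N] rv by simp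
  also have "\<dots> = PiM J N" by (rule PiM_cong) (use Y_law J in auto)
  finally have D: "distr M (PiM J N) (\<lambda>\<omega>. \<lambda>i\<in>J. Y \<omega> i) = PiM J N" .
  have mY: "(\<lambda>\<omega>. \<lambda>i\<in>J. Y \<omega> i) \<in> measurable M (PiM J N)" by (intro measurable_restrict rv)
  have mr: "(\<lambda>\<omega>. \<lambda>n\<in>K. \<omega> (\<pi> n)) \<in> measurable (PiM J N) (PiM K (\<lambda>i. N (\<pi> i)))"
    by (intro measurable_restrict measurable_component_singleton) (auto simp: J_def)
  have "PiM K (\<lambda>i. N (\<pi> i)) = distr (PiM J N) (PiM K (\<lambda>i. N (\<pi> i))) (\<lambda>\<omega>. \<lambda>n\<in>K. \<omega> (\<pi> n))"
    by (rule distr_PiM_reindex[symmetric]) (use \<pi> prob_space_laws in \<open>auto simp: J_def\<close>)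
  also have "\<dots> = distr M (PiM K (\<lambda>i. N (\<pi> i))) (\<lambda>\<omega>. \<lambda>n\<in>K. Y \<omega> (\<pi> n))"
    by (subst D[symmetric], subst distr_distr[OF mr mY]) (auto simp: comp_def J_def intro!: distr_cong)
  also have "PiM K (\<lambda>i. N (\<pi> i)) = PiM K N" by (rule PiM_cong) (use \<pi> in auto)
  finally have E: "distr M (PiM K N) (\<lambda>\<omega>. \<lambda>n\<in>K. Y \<omega> (\<pi> n)) = PiM K N" ..
  have rv2: "(\<lambda>\<omega>. Y \<omega> (\<pi> i)) \<in> measurable M (N i)" if "i \<in> K" for i
    using rv[of "\<pi> i"] \<pi>(3)[OF that] that by (simp add: J_def)
  have law2: "distr M (N i) (\<lambda>\<omega>. Y \<omega> (\<pi> i)) = N i" if "i \<in> K" for i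
    using Y_law[of "\<pi> i"] \<pi>(2,3) that by auto
  have "indep_vars N (\<lambda>i \<omega>. Y \<omega> (\<pi> i)) K"
    by (subst indep_vars_iff_distr_eq_PiM'[OF K rv2])
      (use E law2 in \<open>auto intro!: PiM_cong\<close>)
  then have "indep_vars N (\<lambda>i \<omega>. g i (Y \<omega> (\<pi> i))) K"
    by (rule indep_vars_compose2) (rule g(1))
  then have "distr M (PiM K N) (\<lambda>\<omega>. \<lambda>i\<in>K. g i (Y \<omega> (\<pi> i)))
    = PiM K (\<lambda>i. distr M (N i) (\<lambda>\<omega>. g i (Y \<omega> (\<pi> i))))"
    by (subst (asm) indep_vars_iff_distr_eq_PiM'[OF K])
      (use measurable_compose[OF rv2 g(1)] in auto)
  also have "\<dots> = PiM K N"
  proof (rule PiM_cong)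
    fix i assume i: "i \<in> K"
    have "distr M (N i) (\<lambda>\<omega>. g i (Y \<omega> (\<pi> i))) = distr (distr M (N i) (\<lambda>\<omega>. Y \<omega> (\<pi> i))) (N i) (g i)"
      by (subst distr_distr[OF g(1)[OF i] rv2[OF i]]) (simp add: comp_def)
    then show "distr M (N i) (\<lambda>\<omega>. g i (Y \<omega> (\<pi> i))) = N i" using law2[OF i] g(2)[OF i] by simp
  qed simp
  finally show ?thesis .
qed

text \<open>The bounded functions of the coordinates in \<open>K\<close>. The bound 1 makes them closed under products and
  integrable.\<close>

definition observable :: "index set \<Rightarrow> ((index \<Rightarrow> real) \<Rightarrow> complex) \<Rightarrow> bool" where
  "observable K \<Phi> \<longleftrightarrow> \<Phi> \<in> borel_measurable (PiM K N) \<and> (\<forall>q. norm (\<Phi> q) \<le> 1) \<and>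
     (\<forall>q q'. (\<forall>i\<in>K. q i = q' i) \<longrightarrow> \<Phi> q = \<Phi> q')"

definition expct :: "((index \<Rightarrow> real) \<Rightarrow> complex) \<Rightarrow> complex" where
  "expct \<Phi> = (\<integral>\<omega>. \<Phi> (Y \<omega>) \<partial>M)"

lemma observable_restrict: "observable K \<Phi> \<Longrightarrow> \<Phi> (restrict q K) = \<Phi> q"
  unfolding observable_def by (auto simp: restrict_def)

lemma observable_mono:
  assumes "observable K \<Phi>" "K \<subseteq> K'"
  shows "observable K' \<Phi>"
proof -
  have "(\<lambda>q. \<Phi> (restrict q K)) \<in> borel_measurable (PiM K' N)"
    using assms unfolding observable_def by (intro measurable_compose[OF measurable_restrict_subset]) auto
  then show ?thesis using assms observable_restrict[OF assms(1)]
    unfolding observable_def by (auto simp: subset_iff)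
qed

lemma observable_mult:
  assumes "observable K \<Phi>" "observable K \<Psi>"
  shows "observable K (\<lambda>q. \<Phi> q * \<Psi> q)"
proof -
  have "norm (\<Phi> q * \<Psi> q) \<le> 1" for q
    using assms by (auto simp: observable_def norm_mult intro!: mult_le_one)
  then show ?thesis using assms unfolding observable_def by (auto; metis)
qed

lemma observable_if:
  assumes "Measurable.pred (PiM K N) P" "\<And>q q'. (\<And>i. i \<in> K \<Longrightarrow> q i = q' i) \<Longrightarrow> P q = P q'" "observable K \<Phi>"
  shows "observable K (\<lambda>q. if P q then \<Phi> q else 0)"
proof -
  have "(\<lambda>q. if P q then \<Phi> q else 0) \<in> borel_measurable (PiM K N)"
    using assms(1,3) unfolding observable_def by (intro measurable_If_set measurable_If) auto
  moreover have "(if P q then \<Phi> q else 0) = (if P q' then \<Phi> q' else 0)" if "\<forall>i\<in>K. q i = q' i" for q q'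
    using assms(2)[of q q'] assms(3) that unfolding observable_def by metis
  ultimately show ?thesis using assms(3) unfolding observable_def by auto
qed

lemma observable_rv:
  assumes "observable K \<Phi>" "K \<subseteq> indices {1..}"
  shows "(\<lambda>\<omega>. \<Phi> (Y \<omega>)) \<in> borel_measurable M"
proof -
  have "(\<lambda>\<omega>. \<lambda>i\<in>K. Y \<omega> i) \<in> measurable M (PiM K N)"
    by (intro measurable_restrict Y_rv) (use assms in auto)
  then have "(\<lambda>\<omega>. \<Phi> (\<lambda>i\<in>K. Y \<omega> i)) \<in> borel_measurable M"
    by (rule measurable_compose) (use assms in \<open>simp add: observable_def\<close>)
  then show ?thesis by (simp add: observable_restrict[OF assms(1)])
qed

lemma observable_integrable:
  assumes "observable K \<Phi>" "K \<subseteq> indices {1..}"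
  shows "integrable M (\<lambda>\<omega>. \<Phi> (Y \<omega>))"
  by (rule integrable_const_bound[where B = 1])
    (use assms observable_rv in \<open>auto simp: observable_def\<close>)

lemma expct_mult:
  assumes \<Phi>: "observable K \<Phi>" "K \<subseteq> indices {1..}" and \<Psi>: "observable K' \<Psi>" "K' \<subseteq> indices {1..}"
    and "K \<inter> K' = {}"
  shows "expct (\<lambda>q. \<Phi> q * \<Psi> q) = expct \<Phi> * expct \<Psi>"
proof -
  have "indep_var (PiM K N) (\<lambda>\<omega>. \<lambda>i\<in>K. Y \<omega> i) (PiM K' N) (\<lambda>\<omega>. \<lambda>i\<in>K'. Y \<omega> i)"
    by (rule indep_var_restrict[OF Y_indep]) (use assms in auto)
  then have "indep_var borel (\<Phi> \<circ> (\<lambda>\<omega>. \<lambda>i\<in>K. Y \<omega> i)) borel (\<Psi> \<circ> (\<lambda>\<omega>. \<lambda>i\<in>K'. Y \<omega> i))"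
    by (rule indep_var_compose) (use \<Phi> \<Psi> in \<open>auto simp: observable_def\<close>)
  then have "indep_var borel (\<lambda>\<omega>. \<Phi> (Y \<omega>)) borel (\<lambda>\<omega>. \<Psi> (Y \<omega>))"
    by (simp add: comp_def observable_restrict[OF \<Phi>(1)] observable_restrict[OF \<Psi>(1)])
  then show ?thesis unfolding expct_def
    using observable_integrable[OF \<Phi>] observable_integrable[OF \<Psi>]
    by (intro indep_var_lebesgue_integral)
qed

lemma expct_sum:
  assumes "finite A" "\<And>a. a \<in> A \<Longrightarrow> observable K (\<Phi> a)" "K \<subseteq> indices {1..}"
  shows "expct (\<lambda>q. \<Sum>a\<in>A. \<Phi> a q) = (\<Sum>a\<in>A. expct (\<Phi> a))"
  unfolding expct_def by (rule Bochner_Integration.integral_sum) (use observable_integrable assms in auto)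

lemma expct_cong:
  assumes "\<And>q. valid q \<Longrightarrow> \<Phi> q = \<Psi> q"
  shows "expct \<Phi> = expct \<Psi>"
  unfolding expct_def by (rule Bochner_Integration.integral_cong) (use assms Y_valid in auto)

text \<open>The symmetries of the model: lengths are permuted by \<open>\<sigma>\<close>, particles by \<open>\<tau>\<close>, and \<open>\<epsilon>\<close> reverses the
  direction of particles together with their spins.\<close>

definition transform :: "(nat \<Rightarrow> nat) \<Rightarrow> (nat \<Rightarrow> nat) \<Rightarrow> (nat \<Rightarrow> real) \<Rightarrow> (index \<Rightarrow> real) \<Rightarrow> index \<Rightarrow> real" where
  "transform \<sigma> \<tau> \<epsilon> q = case_sum (\<lambda>i. q (Inl (\<sigma> i)))
     (case_sum (\<lambda>i. \<epsilon> i * q (Inr (Inl (\<tau> i)))) (\<lambda>i. \<epsilon> i * q (Inr (Inr (\<tau> i)))))"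

lemma transform_simps:
  "lengths (transform \<sigma> \<tau> \<epsilon> q) = (\<lambda>i. lengths q (\<sigma> i))"
  "velocities (transform \<sigma> \<tau> \<epsilon> q) = (\<lambda>i. \<epsilon> i * velocities q (\<tau> i))"
  "spins (transform \<sigma> \<tau> \<epsilon> q) = (\<lambda>i. \<epsilon> i * spins q (\<tau> i))"
  by (auto simp: transform_def lengths_def velocities_def spins_def)

lemma expct_transform:
  assumes \<Phi>: "observable (indices A) \<Phi>" "A \<noteq> {}" "A \<subseteq> {1..}"
    and \<sigma>: "inj_on \<sigma> A" "\<sigma> ` A \<subseteq> {1..}" and \<tau>: "inj_on \<tau> A" "\<tau> ` A \<subseteq> {1..}"
    and \<epsilon>: "\<And>i. i \<in> A \<Longrightarrow> \<epsilon> i = 1 \<or> \<epsilon> i = -1"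
  shows "expct \<Phi> = expct (\<lambda>q. \<Phi> (transform \<sigma> \<tau> \<epsilon> q))"
proof -
  define K where "K = indices A"
  have K: "K \<noteq> {}" "K \<subseteq> indices {1..}" using \<Phi> by (auto simp: K_def indices_def)
  define \<pi> where "\<pi> = map_sum \<sigma> (map_sum \<tau> \<tau>)"
  define g where "g = (\<lambda>i::index. \<lambda>y::real. (case i of Inl _ \<Rightarrow> y | Inr (Inl k) \<Rightarrow> \<epsilon> k * y | Inr (Inr k) \<Rightarrow> \<epsilon> k * y))"
  have g_cases: "g i = (\<lambda>y. y) \<or> g i = uminus \<and> (\<exists>k. i = Inr k)" if "i \<in> K" for i
  proof -
    have "\<epsilon> k = 1 \<or> \<epsilon> k = -1" if "i = Inr (Inl k) \<or> i = Inr (Inr k)" for k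
      using \<epsilon>[of k] \<open>i \<in> K\<close> that by (auto simp: K_def)
    then show ?thesis
    proof (cases i)
      case (Inr j)
      then show ?thesis
        using \<open>\<And>k. i = Inr (Inl k) \<or> i = Inr (Inr k) \<Longrightarrow> \<epsilon> k = 1 \<or> \<epsilon> k = -1\<close>
        by (cases j) (auto simp: g_def fun_eq_iff)
    qed (simp add: g_def)
  qed
  have T: "transform \<sigma> \<tau> \<epsilon> q i = g i (q (\<pi> i))" for q i
  proof (cases i)
    case (Inr j)
    then show ?thesis by (cases j) (simp_all add: transform_def g_def \<pi>_def)
  qed (simp add: transform_def g_def \<pi>_def)
  have "distr M (PiM K N) (\<lambda>\<omega>. \<lambda>i\<in>K. g i (Y \<omega> (\<pi> i))) = PiM K N"
  proof (rule law_of_transformed_family[OF K(1)])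
    show "inj_on \<pi> K" 
      by (rule inj_onI) (auto simp: \<pi>_def K_def indices_def dest: inj_onD[OF \<sigma>(1)] inj_onD[OF \<tau>(1)])
    show "\<pi> ` K \<subseteq> indices {1..}" 
      using \<sigma>(2) \<tau>(2) by (auto simp: \<pi>_def K_def indices_def image_subset_iff)
    show "N (\<pi> i) = N i" if "i \<in> K" for i
      using that by (auto simp: \<pi>_def K_def indices_def)
    fix i assume i: "i \<in> K"
    show "g i \<in> measurable (N i) (N i)"
      using g_cases[OF i] by (auto simp: laws_def measurable_def split: sum.splits)
    show "distr (N i) (N i) (g i) = N i"
      using g_cases[OF i] velocity_law_symmetric[of p] spin_law_symmetric
      by (auto simp: laws_def distr_id2 split: sum.splits)
  qed
  moreover have "distr M (PiM K N) (\<lambda>\<omega>. \<lambda>i\<in>K. Y \<omega> i) = PiM K N"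
    using law_of_transformed_family[OF K(1), of "\<lambda>i. i" "\<lambda>_ y. y"] K(2) by (auto simp: distr_id2)
  ultimately have D: "distr M (PiM K N) (\<lambda>\<omega>. \<lambda>i\<in>K. g i (Y \<omega> (\<pi> i))) = distr M (PiM K N) (\<lambda>\<omega>. \<lambda>i\<in>K. Y \<omega> i)"
    by simp
  have m\<Phi>: "\<Phi> \<in> borel_measurable (PiM K N)" using \<Phi> by (simp add: observable_def K_def)
  have m1: "(\<lambda>\<omega>. \<lambda>i\<in>K. Y \<omega> i) \<in> measurable M (PiM K N)"
    by (intro measurable_restrict Y_rv) (use K in auto)
  have m2: "(\<lambda>\<omega>. \<lambda>i\<in>K. g i (Y \<omega> (\<pi> i))) \<in> measurable M (PiM K N)"
  proof (intro measurable_restrict)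
    fix i assume i: "i \<in> K"
    have "\<pi> i \<in> indices {1..}" "N (\<pi> i) = N i"
      using \<sigma>(2) \<tau>(2) i by (auto simp: \<pi>_def K_def indices_def image_subset_iff)
    then have "(\<lambda>\<omega>. Y \<omega> (\<pi> i)) \<in> measurable M (N i)" using Y_rv by metis
    moreover have "g i \<in> measurable (N i) (N i)"
      using g_cases[OF i] by (auto simp: laws_def measurable_def split: sum.splits)
    ultimately show "(\<lambda>\<omega>. g i (Y \<omega> (\<pi> i))) \<in> measurable M (N i)" by (rule measurable_compose)
  qed
  have "expct \<Phi> = (\<integral>\<omega>. \<Phi> (\<lambda>i\<in>K. Y \<omega> i) \<partial>M)"
    unfolding expct_def using observable_restrict[OF \<Phi>(1)] by (simp add: K_def)
  also have "\<dots> = integral\<^sup>L (distr M (PiM K N) (\<lambda>\<omega>. \<lambda>i\<in>K. Y \<omega> i)) \<Phi>"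
    by (rule integral_distr[OF m1 m\<Phi>, symmetric])
  also have "\<dots> = (\<integral>\<omega>. \<Phi> (\<lambda>i\<in>K. g i (Y \<omega> (\<pi> i))) \<partial>M)"
    unfolding D[symmetric] by (rule integral_distr[OF m2 m\<Phi>])
  also have "\<dots> = (\<integral>\<omega>. \<Phi> (restrict (transform \<sigma> \<tau> \<epsilon> (Y \<omega>)) K) \<partial>M)"
    by (simp add: T[abs_def])
  also have "\<dots> = expct (\<lambda>q. \<Phi> (transform \<sigma> \<tau> \<epsilon> q))"
    unfolding expct_def using observable_restrict[OF \<Phi>(1)] by (simp add: K_def)
  finally show ?thesis .
qed

end

section \<open>Weighted events\<close>

text \<open>The positions, measured from the particle \<open>a - 1\<close>, so that they depend only on the lengths of the block that
  begins at \<open>a\<close>.\<close>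

definition pos :: "nat \<Rightarrow> (index \<Rightarrow> real) \<Rightarrow> nat \<Rightarrow> real" where
  "pos a q i = (\<Sum>k=a..i. lengths q k)"

lemma pos_split: "a \<le> Suc c \<Longrightarrow> c \<le> b \<Longrightarrow> pos a q b = pos a q c + pos (Suc c) q b"
  unfolding pos_def using sum.ub_add_nat[of a c "lengths q" "b - c"] by simp

lemma pos_Suc: "a \<le> Suc i \<Longrightarrow> pos a q (Suc i) = pos a q i + lengths q (Suc i)"
  by (simp add: pos_def)

lemma pos_same: "pos a q a = lengths q a"
  by (simp add: pos_def)

lemma pos_first: "1 \<le> j \<Longrightarrow> pos 1 q j = lengths q 1 + pos 2 q j"
  using pos_split[of 1 1 j q] by (simp add: pos_same numeral_2_eq_2)

lemma clears_left_cong: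
  assumes "\<And>i. i \<in> {a..b} \<Longrightarrow> x' i = x i + c" "\<And>i. i \<in> {a..b} \<Longrightarrow> v' i = v i"
    "\<And>i. i \<in> {a..b} \<Longrightarrow> s' i = s i"
  shows "clears_left x' v' s' a b \<longleftrightarrow> clears_left x v s a b"
  using clears_left_shift[of a b x' x 0 c v' v s' s] assms by simp

lemma clears_right_cong:
  assumes "\<And>i. i \<in> {a..b} \<Longrightarrow> x' i = x i" "\<And>i. i \<in> {a..b} \<Longrightarrow> v' i = v i"
    "\<And>i. i \<in> {a..b} \<Longrightarrow> s' i = s i"
  shows "clears_right x' v' s' a b \<longleftrightarrow> clears_right x v s a b"
proof (cases "a \<le> b")
  case True
  have m: "a + b - i \<in> {a..b}" if "i \<in> {a..b}" for i using that by auto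
  have 1: "clears_left (\<lambda>i. - x' (a + b - i)) (\<lambda>i. - v' (a + b - i)) (\<lambda>i. - s' (a + b - i)) a b
    \<longleftrightarrow> clears_right x' v' s' (a + b - b) (a + b - a)"
    by (rule clears_left_mirror[where c = 0]) (use True in auto)
  have 2: "clears_left (\<lambda>i. - x' (a + b - i)) (\<lambda>i. - v' (a + b - i)) (\<lambda>i. - s' (a + b - i)) a b
    \<longleftrightarrow> clears_right x v s (a + b - b) (a + b - a)"
    by (rule clears_left_mirror[where c = 0])
      (use True m assms(1)[OF m] assms(2)[OF m] assms(3)[OF m] in auto)
  show ?thesis using 1 2 by simp
qed (simp add: clears_right_def)

lemma opens_way_cong:
  assumes "\<And>i. i \<in> {a..b} \<Longrightarrow> x' i = x i" "\<And>i. i \<in> {a..b} \<Longrightarrow> v' i = v i"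
    "\<And>i. i \<in> {a..b} \<Longrightarrow> s' i = s i"
  shows "opens_way x' v' s' a j b \<longleftrightarrow> opens_way x v s a j b"
proof (cases "a < j \<and> j < b")
  case True
  have "clears_right x' v' s' a (j - 1) \<longleftrightarrow> clears_right x v s a (j - 1)"
    by (rule clears_right_cong) (use True assms in auto)
  moreover have "clears_left x' v' s' (Suc j) b \<longleftrightarrow> clears_left x v s (Suc j) b"
    by (rule clears_left_cong[where c = 0]) (use True assms in auto)
  ultimately show ?thesis using True assms by (simp add: opens_way_def)
qed (auto simp: opens_way_def)

lemma collide_cong:
  assumes "\<And>i. i \<in> {a..b} \<Longrightarrow> x' i = x i" "\<And>i. i \<in> {a..b} \<Longrightarrow> v' i = v i"
    "\<And>i. i \<in> {a..b} \<Longrightarrow> s' i = s i"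
  shows "collide x' v' s' a b \<longleftrightarrow> collide x v s a b"
proof (cases "a < b")
  case True
  have "evolution {a..b} x' v' s' T \<longleftrightarrow> evolution {a..b} x v s T" for T
    using evolution_transform[of "\<lambda>i. i" "{a..b}" 1 x' x 0 v' v s' s T T] assms by simp
  then show ?thesis using True assms by (simp add: collide_def)
qed (auto simp: collide_def)

text \<open>Sums over disjoint events: at most one of the alternatives \<open>P i\<close> holds.\<close>

lemma sum_if_unique:
  fixes f :: "'c::comm_monoid_add"
  assumes "finite S" "\<And>i j. i \<in> S \<Longrightarrow> j \<in> S \<Longrightarrow> P i \<Longrightarrow> P j \<Longrightarrow> i = j"
  shows "(\<Sum>i\<in>S. if P i then f else 0) = (if \<exists>i\<in>S. P i then f else 0)"
proof (cases "\<exists>i\<in>S. P i")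
  case True
  then obtain i where i: "i \<in> S" "P i" by blast
  have "(\<Sum>j\<in>S. if P j then f else 0) = (\<Sum>j\<in>S. if j = i then f else 0)"
    by (rule sum.cong) (use assms(2) i in auto)
  then show ?thesis using assms(1) i by auto
qed (auto intro: sum.neutral)

context ballistic_annihilation
begin

lemma validD:
  assumes "valid q" "1 \<le> i"
  shows "0 < lengths q i" "velocities q i = -1 \<or> velocities q i = 0 \<or> velocities q i = 1"
    "spins q i = -1 \<or> spins q i = 1"
proof -
  have "Inl i \<in> indices {1..}" "Inr (Inl i) \<in> indices {1..}" "Inr (Inr i) \<in> indices {1..}"
    using assms(2) by auto
  then have "q (Inl i) \<in> space (N (Inl i))" "q (Inr (Inl i)) \<in> space (N (Inr (Inl i)))"
    "q (Inr (Inr i)) \<in> space (N (Inr (Inr i)))"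
    using assms(1) unfolding valid_def by blast+
  then show "0 < lengths q i" "velocities q i = -1 \<or> velocities q i = 0 \<or> velocities q i = 1"
    "spins q i = -1 \<or> spins q i = 1"
    by (auto simp: lengths_def velocities_def spins_def space_m)
qed

lemma pos_nonneg: "valid q \<Longrightarrow> 1 \<le> a \<Longrightarrow> 0 \<le> pos a q i"
  unfolding pos_def by (intro sum_nonneg) (use validD(1) in \<open>force intro: less_imp_le\<close>)

lemma configuration_pos:
  assumes "valid q"
  shows "configuration {1..} (pos 1 q) (velocities q) (spins q)"
proof
  fix i j :: nat assume ij: "i \<in> {1..}" "j \<in> {1..}" "i < j"
  have "pos 1 q j = pos 1 q i + pos (Suc i) q j" using pos_split[of 1 i j q] ij by simp
  moreover have "0 < pos (Suc i) q j"
    unfolding pos_def by (rule sum_pos) (use ij validD(1)[OF assms] in auto)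
  ultimately show "pos 1 q i < pos 1 q j" by simp
qed (use validD(2,3)[OF assms] in auto)

end

text \<open>Bounding \<open>\<phi>\<close> on the whole line, and not only on the distances that occur, keeps all weights bounded
  without side conditions.\<close>

locale weighted_annihilation = ballistic_annihilation M p m l v s
  for M :: "'a measure" and p :: real and m :: "real measure" and l v s :: "nat \<Rightarrow> 'a \<Rightarrow> real" +
  fixes \<phi> :: "real \<Rightarrow> complex"
  assumes \<phi>_measurable [measurable]: "\<phi> \<in> borel_measurable borel"
    and \<phi>_bounded: "norm (\<phi> y) \<le> 1"
    and \<phi>_add: "0 \<le> y \<Longrightarrow> 0 \<le> z \<Longrightarrow> \<phi> (y + z) = \<phi> y * \<phi> z"
begin

abbreviation "LEFTQ a b q \<equiv> clears_left (pos 1 q) (velocities q) (spins q) a b"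
abbreviation "OPENSQ j b q \<equiv> opens_way (pos 1 q) (velocities q) (spins q) 1 j b"
abbreviation "COLLIDEQ b q \<equiv> collide (pos 1 q) (velocities q) (spins q) 1 b"

text \<open>The weights of the events in the recursion. In \<open>mirror_open\<close> the block up to the static particle of \<open>open_at\<close>
  has been reversed: the static particle comes first, with reversed spin.\<close>

definition start where "start u q = (if velocities q 1 = u then \<phi> (lengths q 1) else 0)"
definition cross where
  "cross a b q = (if clears_left (pos a q) (velocities q) (spins q) a b then \<phi> (pos a q b) else 0)"
definition duel where "duel b q = (if COLLIDEQ b q then \<phi> (pos 1 q b) else 0)"
definition open_at where "open_at j b q = (if OPENSQ j b q then \<phi> (pos 1 q b) else 0)"
definition open_any where "open_any b q = (if \<exists>j\<in>{1<..<b}. OPENSQ j b q then \<phi> (pos 1 q b) else 0)"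
definition mirror_open where "mirror_open j b q = (if pos 2 q j < pos (Suc j) q b \<or> pos 2 q j = pos (Suc j) q b \<and> spins q 1 = 1
  then start 0 q * cross 2 j q * cross (Suc j) b q else 0)"

lemma cross_eq:
  assumes "1 \<le> a"
  shows "cross a b q = (if LEFTQ a b q then \<phi> (pos a q b) else 0)"
proof -
  have "LEFTQ a b q \<longleftrightarrow> clears_left (pos a q) (velocities q) (spins q) a b"
  proof (rule clears_left_cong[where c = "pos 1 q (a - 1)"])
    fix i assume "i \<in> {a..b}"
    then have "a - 1 \<le> i" by auto
    then show "pos 1 q i = pos a q i + pos 1 q (a - 1)"
      using pos_split[of 1 "a - 1" i q] assms by simp
  qed auto
  then show ?thesis by (simp add: cross_def)
qed

lemma \<phi>_pos:
  assumes "valid q" "1 \<le> a" "a \<le> Suc c" "c \<le> b"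
  shows "\<phi> (pos a q b) = \<phi> (pos a q c) * \<phi> (pos (Suc c) q b)"
  using assms by (subst pos_split[OF assms(3,4)]) (simp add: \<phi>_add pos_nonneg)

lemma cross_recursion:
  assumes q: "valid q" and n: "1 \<le> n"
  shows "cross 1 n q = (if n = 1 then start (-1) q else 0) + (\<Sum>c\<in>{1<..<n}. start 0 q * cross 2 c q * cross (Suc c) n q)
    + open_any n q + (\<Sum>k\<in>{1<..<n}. duel k q * cross (Suc k) n q)"
proof -
  interpret C: configuration "{1..}" "pos 1 q" "velocities q" "spins q" by (rule configuration_pos[OF q])
  have I: "{1..k} \<subseteq> {1..}" for k :: nat by auto
  have v1: "velocities q 1 = -1 \<or> velocities q 1 = 0 \<or> velocities q 1 = 1" using validD[OF q] by simp
  have opens: "velocities q 1 = 1" if "OPENSQ j n q" for j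
    using that by (simp add: opens_way_def clears_right_def)
  have collides: "velocities q 1 = 1" if "COLLIDEQ k q" for k
    using that by (simp add: collide_def)
  have S: "(\<Sum>c\<in>{1<..<n}. start 0 q * cross 2 c q * cross (Suc c) n q)
    = (\<Sum>c\<in>{1<..<n}. if velocities q 1 = 0 \<and> LEFTQ 2 c q \<and> LEFTQ (Suc c) n q then \<phi> (pos 1 q n) else 0)"
  proof (rule sum.cong[OF refl])
    fix c assume c: "c \<in> {1<..<n}"
    have "\<phi> (pos 1 q n) = \<phi> (lengths q 1) * \<phi> (pos 2 q c) * \<phi> (pos (Suc c) q n)"
      using \<phi>_pos[OF q, of 1 c n] \<phi>_pos[OF q, of 1 1 c] c by (simp add: pos_same numeral_2_eq_2)
    then show "start 0 q * cross 2 c q * cross (Suc c) n q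
      = (if velocities q 1 = 0 \<and> LEFTQ 2 c q \<and> LEFTQ (Suc c) n q then \<phi> (pos 1 q n) else 0)"
      by (simp add: start_def cross_eq)
  qed
  also have "\<dots> = (if \<exists>c\<in>{1<..<n}. velocities q 1 = 0 \<and> LEFTQ 2 c q \<and> LEFTQ (Suc c) n q
    then \<phi> (pos 1 q n) else 0)"
  proof (rule sum_if_unique)
    fix i j assume "velocities q 1 = 0 \<and> LEFTQ 2 i q \<and> LEFTQ (Suc i) n q"
      "velocities q 1 = 0 \<and> LEFTQ 2 j q \<and> LEFTQ (Suc j) n q"
    then show "i = j"
      using C.clears_left_unique[of 2 i j] C.clears_left_unique[of 2 j i]
      by (cases "i \<le> j") auto
  qed simp
  finally have S: "(\<Sum>c\<in>{1<..<n}. start 0 q * cross 2 c q * cross (Suc c) n q) = \<dots>" .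
  have "(\<Sum>k\<in>{1<..<n}. duel k q * cross (Suc k) n q)
    = (\<Sum>k\<in>{1<..<n}. if COLLIDEQ k q \<and> LEFTQ (Suc k) n q then \<phi> (pos 1 q n) else 0)"
  proof (rule sum.cong[OF refl])
    fix k assume k: "k \<in> {1<..<n}"
    then show "duel k q * cross (Suc k) n q = (if COLLIDEQ k q \<and> LEFTQ (Suc k) n q then \<phi> (pos 1 q n) else 0)"
      using \<phi>_pos[OF q, of 1 k n] by (simp add: duel_def cross_eq)
  qed
  also have "\<dots> = (if \<exists>k\<in>{1<..<n}. COLLIDEQ k q \<and> LEFTQ (Suc k) n q then \<phi> (pos 1 q n) else 0)"
  proof (rule sum_if_unique)
    fix i j assume "COLLIDEQ i q \<and> LEFTQ (Suc i) n q" "COLLIDEQ j q \<and> LEFTQ (Suc j) n q"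
    then have "LEFTQ 2 i q" "LEFTQ 2 j q"
      using C.collide_skip(2)[OF I I, of i] C.collide_skip(2)[OF I I, of j] by (auto simp: numeral_2_eq_2)
    then show "i = j"
      using C.clears_left_unique[of 2 i j] C.clears_left_unique[of 2 j i]
      by (cases "i \<le> j") auto
  qed simp
  finally have S2: "(\<Sum>k\<in>{1<..<n}. duel k q * cross (Suc k) n q) = \<dots>" .
  have excl: "\<not> (OPENSQ j n q \<and> k < n \<and> COLLIDEQ k q)" for j k
    using C.opens_way_not_collide[OF I order_refl less_imp_le] by blast
  have rec: "LEFTQ 1 n q \<longleftrightarrow> (velocities q 1 = -1 \<and> n = 1
    \<or> velocities q 1 = 0 \<and> (\<exists>c\<in>{1<..<n}. LEFTQ 2 c q \<and> LEFTQ (Suc c) n q)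
    \<or> velocities q 1 = 1 \<and> ((\<exists>j\<in>{1<..<n}. OPENSQ j n q) \<or> (\<exists>k\<in>{1<..<n}. COLLIDEQ k q \<and> LEFTQ (Suc k) n q)))"
    using C.clears_left_rec[OF I, of n] n by (simp add: numeral_2_eq_2)
  have cross: "cross 1 n q = (if LEFTQ 1 n q then \<phi> (pos 1 q n) else 0)" by (simp add: cross_eq)
  show ?thesis using v1
  proof (elim disjE)
    assume v: "velocities q 1 = -1"
    then have "\<not> OPENSQ j n q" "\<not> COLLIDEQ k q" for j k using opens[of j] collides[of k] by auto
    then show ?thesis unfolding S S2 cross rec unfolding open_any_def start_def using v by (simp add: pos_same)
  next
    assume v: "velocities q 1 = 0"
    then have "\<not> OPENSQ j n q" "\<not> COLLIDEQ k q" for j k using opens[of j] collides[of k] by auto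
    then show ?thesis unfolding S S2 cross rec unfolding open_any_def start_def using v by simp
  next
    assume v: "velocities q 1 = 1"
    show ?thesis
    proof (cases "\<exists>j\<in>{1<..<n}. OPENSQ j n q")
      case True
      then have "\<not> COLLIDEQ k q" if "k < n" for k using excl that by blast
      then show ?thesis unfolding S S2 cross rec unfolding open_any_def start_def using v True by auto
    next
      case False
      then show ?thesis unfolding S S2 cross rec unfolding open_any_def start_def using v by simp
    qed
  qed
qed

lemma cross_beyond_recursion:
  assumes q: "valid q" and n: "1 \<le> n"
  shows "start 1 q * cross 2 n q = duel n q + (\<Sum>k\<in>{1..<n}. open_any k q * cross (Suc k) n q)"
proof (cases "n = 1 \<or> velocities q 1 \<noteq> 1")
  case True
  have "\<not> OPENSQ j k q" if "velocities q 1 \<noteq> 1" for j k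
    using that by (simp add: opens_way_def clears_right_def)
  moreover have "\<not> COLLIDEQ n q" using True by (auto simp: collide_def)
  moreover have "start 1 q * cross 2 n q = 0"
    using True by (auto simp: start_def cross_def clears_left_def)
  ultimately show ?thesis using True by (auto simp: duel_def open_any_def)
next
  case False
  then have n1: "1 < n" and v: "velocities q 1 = 1" using n by auto
  interpret C: configuration "{1..}" "pos 1 q" "velocities q" "spins q" by (rule configuration_pos[OF q])
  have I: "{1..k} \<subseteq> {1..}" for k :: nat by auto
  have j: "j \<in> {1<..<k}" if "OPENSQ j k q" for j k using that by (simp add: opens_way_def)
  have "(\<Sum>k\<in>{1..<n}. open_any k q * cross (Suc k) n q)
    = (\<Sum>k\<in>{1..<n}. if (\<exists>j\<in>{1<..<k}. OPENSQ j k q) \<and> LEFTQ (Suc k) n q then \<phi> (pos 1 q n) else 0)"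
  proof (rule sum.cong[OF refl])
    fix k assume k: "k \<in> {1..<n}"
    then show "open_any k q * cross (Suc k) n q
      = (if (\<exists>j\<in>{1<..<k}. OPENSQ j k q) \<and> LEFTQ (Suc k) n q then \<phi> (pos 1 q n) else 0)"
      using \<phi>_pos[OF q, of 1 k n] by (simp add: open_any_def cross_eq)
  qed
  also have "\<dots> = (if \<exists>k\<in>{1..<n}. (\<exists>j\<in>{1<..<k}. OPENSQ j k q) \<and> LEFTQ (Suc k) n q
    then \<phi> (pos 1 q n) else 0)"
  proof (rule sum_if_unique)
    fix i k assume "(\<exists>j\<in>{1<..<i}. OPENSQ j i q) \<and> LEFTQ (Suc i) n q"
      "(\<exists>j\<in>{1<..<k}. OPENSQ j k q) \<and> LEFTQ (Suc k) n q"
    then have "LEFTQ 1 i q" "LEFTQ 1 k q" using C.opens_way_clears[OF I] by blast+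
    then show "i = k"
      using C.clears_left_unique[of 1 i k] C.clears_left_unique[of 1 k i]
      by (cases "i \<le> k") auto
  qed simp
  finally have S: "(\<Sum>k\<in>{1..<n}. open_any k q * cross (Suc k) n q) = \<dots>" .
  have "LEFTQ 2 n q \<longleftrightarrow> COLLIDEQ n q \<or> (\<exists>k\<in>{1..<n}. (\<exists>j\<in>{1<..<k}. OPENSQ j k q) \<and> LEFTQ (Suc k) n q)"
    using C.clears_left_beyond_right[OF I v n1] j by (fastforce simp: numeral_2_eq_2)
  moreover have "\<not> (COLLIDEQ n q \<and> (\<exists>k\<in>{1..<n}. (\<exists>j\<in>{1<..<k}. OPENSQ j k q) \<and> LEFTQ (Suc k) n q))"
    using C.opens_way_not_collide[OF I less_imp_le order_refl] by fastforce
  moreover have "\<phi> (pos 1 q n) = \<phi> (lengths q 1) * \<phi> (pos 2 q n)"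
    using \<phi>_pos[OF q, of 1 1 n] n1 by (simp add: pos_same numeral_2_eq_2)
  ultimately show ?thesis unfolding S using v by (auto simp: duel_def cross_eq start_def)
qed

lemma open_any_sum:
  assumes q: "valid q"
  shows "open_any n q = (\<Sum>j\<in>{1<..<n}. open_at j n q)"
proof -
  interpret C: configuration "{1..}" "pos 1 q" "velocities q" "spins q" by (rule configuration_pos[OF q])
  show ?thesis unfolding open_any_def open_at_def
    by (rule sum_if_unique[symmetric]) (auto intro: C.opens_way_unique)
qed

lemma cross_shift:
  assumes "\<And>i. i \<in> {a..b} \<Longrightarrow> lengths q' i = lengths q (i + k)"
    "\<And>i. i \<in> {a..b} \<Longrightarrow> velocities q' i = velocities q (i + k)"
    "\<And>i. i \<in> {a..b} \<Longrightarrow> spins q' i = spins q (i + k)"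
  shows "cross a b q' = cross (a + k) (b + k) q"
proof -
  have P: "pos a q' i = pos (a + k) q (i + k)" if "i \<le> b" for i
  proof -
    have "pos (a + k) q (i + k) = (\<Sum>j=a..i. lengths q (j + k))"
      unfolding pos_def by (rule sum.shift_bounds_cl_nat_ivl)
    also have "\<dots> = pos a q' i" unfolding pos_def by (rule sum.cong) (use assms(1) that in auto)
    finally show ?thesis ..
  qed
  have "clears_left (pos a q') (velocities q') (spins q') a b
    \<longleftrightarrow> clears_left (pos (a + k) q) (velocities q) (spins q) (a + k) (b + k)"
    by (rule clears_left_shift[where c = 0]) (use P assms in auto)
  then show ?thesis using P[of b] by (simp add: cross_def)
qed

text \<open>The first \<open>j\<close> particles are reversed. The first length stays in place, being the distance of the block from the
  origin, and the remaining \<open>j - 1\<close> lengths are reversed among themselves.\<close>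

lemma open_at_reversed:
  assumes q: "valid q" and j: "1 < j" "j < n"
  shows "open_at j n q = mirror_open j n (transform (\<lambda>i. if 2 \<le> i \<and> i \<le> j then j + 2 - i else i)
    (\<lambda>i. if i \<le> j then j + 1 - i else i) (\<lambda>i. if i \<le> j then -1 else 1) q)" (is "_ = mirror_open j n ?q")
proof -
  have L: "lengths ?q i = (if 2 \<le> i \<and> i \<le> j then lengths q (j + 2 - i) else lengths q i)"
    and Vel: "velocities ?q i = (if i \<le> j then - velocities q (j + 1 - i) else velocities q i)"
    and Sp: "spins ?q i = (if i \<le> j then - spins q (j + 1 - i) else spins q i)" for i
    by (auto simp: transform_simps)
  have P1: "pos 1 ?q i = lengths q 1 + pos 1 q j - pos 1 q (j + 1 - i)" if "1 \<le> i" "i \<le> j" for i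
    using that
  proof (induction i rule: dec_induct)
    case base
    then show ?case using j by (simp add: pos_same L)
  next
    case (step i)
    have "pos 1 q (j + 1 - i) = pos 1 q (j - i) + lengths q (j + 1 - i)"
      using pos_Suc[of 1 "j - i" q] step by (simp add: Suc_diff_le)
    then show ?case using step pos_Suc[of 1 i ?q] by (simp add: L)
  qed
  have P2: "pos 1 ?q i = pos 1 q i" if "j \<le> i" for i
    using that
  proof (induction i rule: dec_induct)
    case base
    then show ?case using P1[of j] j by (simp add: pos_same)
  next
    case (step i)
    then show ?case using pos_Suc[of 1 i] j by (simp add: L)
  qed
  have R: "LEFTQ 2 j ?q \<longleftrightarrow> clears_right (pos 1 q) (velocities q) (spins q) (Suc j - j) (Suc j - 2)"
    by (rule clears_left_mirror[where c = "lengths q 1 + pos 1 q j"])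
      (use j P1 in \<open>auto simp: Vel Sp\<close>)
  have L2: "LEFTQ (Suc j) n ?q \<longleftrightarrow> LEFTQ (Suc j) n q"
    by (rule clears_left_cong[where c = 0]) (use j P2 in \<open>auto simp: Vel Sp\<close>)
  have p2: "pos 2 ?q j = pos 2 q j"
    using pos_first[of j ?q] pos_first[of j q] P2[of j] j L[of 1] by simp
  have pj: "pos (Suc j) ?q n = pos (Suc j) q n"
    using pos_split[of 1 j n ?q] pos_split[of 1 j n q] P2[of j] P2[of n] j by simp
  have x: "pos 1 q j - pos 1 q 1 = pos 2 q j" "pos 1 q n - pos 1 q j = pos (Suc j) q n"
    using pos_split[of 1 j n q] pos_split[of 1 1 j q] j by (simp_all add: numeral_2_eq_2)
  have v1: "velocities ?q 1 = - velocities q j" and s1: "spins ?q 1 = - spins q j"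
    using j by (simp_all add: Vel Sp)
  have ow: "OPENSQ j n q \<longleftrightarrow> velocities ?q 1 = 0 \<and> LEFTQ 2 j ?q \<and> LEFTQ (Suc j) n ?q \<and>
    (pos 2 ?q j < pos (Suc j) ?q n \<or> pos 2 ?q j = pos (Suc j) ?q n \<and> spins ?q 1 = 1)"
    unfolding opens_way_def x R L2 p2 pj v1 s1 using j by (auto simp: numeral_2_eq_2)
  have "\<phi> (pos 1 q n) = \<phi> (lengths q 1) * \<phi> (pos 2 q j) * \<phi> (pos (Suc j) q n)"
    using \<phi>_pos[OF q, of 1 j n] \<phi>_pos[OF q, of 1 1 j] j by (simp add: pos_same numeral_2_eq_2)
  then show ?thesis unfolding open_at_def ow mirror_open_def start_def
    using j by (auto simp: cross_eq p2 pj L)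
qed

text \<open>The blocks \<open>2, \<dots>, j\<close> and \<open>j + 1, \<dots>, n\<close> change places, after which the second one begins at \<open>k + 1\<close>.
  Reversing the spin of the static particle turns the condition on the race into its complement.\<close>

lemma mirror_open_symmetric:
  assumes q: "valid q" and j: "1 < j" "j < n"
  defines "k \<equiv> n + 1 - j"
  shows "mirror_open j n q + mirror_open k n (transform (\<lambda>i. if 2 \<le> i \<and> i \<le> k then i + (j - 1) else if k < i then i - (k - 1) else i)
    (\<lambda>i. if 2 \<le> i \<and> i \<le> k then i + (j - 1) else if k < i then i - (k - 1) else i)
    (\<lambda>i. if i = 1 then -1 else 1) q) = start 0 q * cross 2 j q * cross (Suc j) n q" (is "_ + mirror_open k n ?q = _")
proof -
  have k: "1 < k" "k < n" "j + k = n + 1" using j by (auto simp: k_def)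
  have 1: "cross 2 k ?q = cross (2 + (j - 1)) (k + (j - 1)) q"
    by (rule cross_shift) (auto simp: transform_simps)
  have 2: "cross 2 j q = cross (2 + (k - 1)) (j + (k - 1)) ?q"
    by (rule cross_shift) (use k in \<open>auto simp: transform_simps\<close>)
  have e: "2 + (j - 1) = Suc j" "k + (j - 1) = n" "2 + (k - 1) = Suc k" "j + (k - 1) = n"
    using j k by auto
  have p1: "pos 2 ?q k = pos (Suc j) q n"
  proof -
    have "pos (2 + (j - 1)) q (k + (j - 1)) = (\<Sum>i=2..k. lengths q (i + (j - 1)))"
      unfolding pos_def by (rule sum.shift_bounds_cl_nat_ivl)
    also have "\<dots> = pos 2 ?q k" unfolding pos_def by (rule sum.cong) (auto simp: transform_simps)
    finally show ?thesis unfolding e by simp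
  qed
  have p2: "pos (Suc k) ?q n = pos 2 q j"
  proof -
    have "pos (2 + (k - 1)) ?q (j + (k - 1)) = (\<Sum>i=2..j. lengths ?q (i + (k - 1)))"
      unfolding pos_def by (rule sum.shift_bounds_cl_nat_ivl)
    also have "\<dots> = pos 2 q j" unfolding pos_def by (rule sum.cong) (use k in \<open>auto simp: transform_simps\<close>)
    finally show ?thesis unfolding e by simp
  qed
  have V0: "start 0 ?q = start 0 q" using k by (simp add: start_def transform_simps)
  have s1: "spins ?q 1 = - spins q 1" by (simp add: transform_simps)
  have "spins q 1 = 1 \<or> spins q 1 = -1" using validD(3)[OF q, of 1] by auto
  then show ?thesis unfolding mirror_open_def p1 p2 V0 s1 using 1 2 e by (auto simp: mult.commute mult.left_commute)
qed

end

section \<open>Recursions for the weights\<close>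

context ballistic_annihilation
begin

lemma coordinate_measurable: "k \<in> K \<Longrightarrow> (\<lambda>q. q k) \<in> borel_measurable (PiM K N)"
  by (rule measurable_compose[OF measurable_component_singleton[of k K N] laws_borel[of k]])

lemma lengths_measurable: "i \<in> A \<Longrightarrow> (\<lambda>q. lengths q i) \<in> borel_measurable (PiM (indices A) N)"
  and velocities_measurable: "i \<in> A \<Longrightarrow> (\<lambda>q. velocities q i) \<in> borel_measurable (PiM (indices A) N)"
  and spins_measurable: "i \<in> A \<Longrightarrow> (\<lambda>q. spins q i) \<in> borel_measurable (PiM (indices A) N)"
  unfolding lengths_def velocities_def spins_def by (rule coordinate_measurable; simp)+

lemma pos_measurable: "{a..i} \<subseteq> A \<Longrightarrow> (\<lambda>q. pos a q i) \<in> borel_measurable (PiM (indices A) N)"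
  unfolding pos_def by (intro borel_measurable_sum lengths_measurable) auto

lemma random_configuration_pos:
  "random_configuration (PiM (indices {a..b}) N) {a..b} (\<lambda>i q. pos a q i) (\<lambda>i q. velocities q i)
    (\<lambda>i q. spins q i)"
proof -
  have "configuration {a..b} (pos a q) (velocities q) (spins q)"
    if q: "q \<in> space (PiM (indices {a..b}) N)" for q
  proof
    have sp: "q k \<in> space (N k)" if "k \<in> indices {a..b}" for k
      using q that by (auto simp: space_PiM)
    have len: "0 < lengths q i" if "i \<in> {a..b}" for i
      using sp[of "Inl i"] that by (simp add: lengths_def space_m)
    show "velocities q i = -1 \<or> velocities q i = 0 \<or> velocities q i = 1" if "i \<in> {a..b}" for i
      using sp[of "Inr (Inl i)"] that by (simp add: velocities_def)
    show "spins q i = -1 \<or> spins q i = 1" if "i \<in> {a..b}" for i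
      using sp[of "Inr (Inr i)"] that by (simp add: spins_def)
    fix i j assume ij: "i \<in> {a..b}" "j \<in> {a..b}" "i < j"
    have "pos a q j = pos a q i + pos (Suc i) q j" using pos_split[of a i j q] ij by simp
    moreover have "0 < pos (Suc i) q j"
      unfolding pos_def by (rule sum_pos) (use ij len in auto)
    ultimately show "pos a q i < pos a q j" by simp
  qed
  then show ?thesis
    using pos_measurable velocities_measurable spins_measurable
    by (auto simp: random_configuration_def)
qed

end

context weighted_annihilation
begin

lemma agree_simps:
  assumes "\<And>k. k \<in> indices A \<Longrightarrow> q k = q' k" "i \<in> A"
  shows "lengths q i = lengths q' i" "velocities q i = velocities q' i" "spins q i = spins q' i"
  using assms by (auto simp: lengths_def velocities_def spins_def)

lemma agree_pos:
  assumes "\<And>k. k \<in> indices A \<Longrightarrow> q k = q' k" "{a..i} \<subseteq> A"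
  shows "pos a q i = pos a q' i"
  unfolding pos_def by (rule sum.cong) (use assms agree_simps(1)[OF assms(1)] in auto)

lemma observable_pos: "{a..b} \<subseteq> A \<Longrightarrow> observable (indices A) (\<lambda>q. \<phi> (pos a q b))"
  unfolding observable_def
  using measurable_compose[OF pos_measurable \<phi>_measurable] \<phi>_bounded agree_pos[of A] by metis

lemma observable_cross: "observable (indices {a..b}) (cross a b)"
  unfolding cross_def
proof (rule observable_if)
  show "Measurable.pred (PiM (indices {a..b}) N) (\<lambda>q. clears_left (pos a q) (velocities q) (spins q) a b)"
    using pred_clears_left[OF random_configuration_pos] by simp
  fix q q' :: "index \<Rightarrow> real" assume "\<And>i. i \<in> indices {a..b} \<Longrightarrow> q i = q' i"
  note A = agree_simps[OF this] agree_pos[OF this]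
  show "clears_left (pos a q) (velocities q) (spins q) a b = clears_left (pos a q') (velocities q') (spins q') a b"
    by (rule clears_left_cong[where c = 0]) (use A in auto)
qed (rule observable_pos, simp)

lemma observable_duel: "observable (indices {1..b}) (duel b)"
  unfolding duel_def
proof (rule observable_if)
  show "Measurable.pred (PiM (indices {1..b}) N) (COLLIDEQ b)"
    using pred_collide[OF random_configuration_pos] by simp
  fix q q' :: "index \<Rightarrow> real" assume "\<And>i. i \<in> indices {1..b} \<Longrightarrow> q i = q' i"
  note A = agree_simps[OF this] agree_pos[OF this]
  show "COLLIDEQ b q = COLLIDEQ b q'"
    by (rule collide_cong) (use A in auto)
qed (rule observable_pos, simp)

lemma observable_open_at: "observable (indices {1..b}) (open_at j b)"
  unfolding open_at_def
proof (rule observable_if)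
  show "Measurable.pred (PiM (indices {1..b}) N) (OPENSQ j b)"
    using pred_opens_way[OF random_configuration_pos] by simp
  fix q q' :: "index \<Rightarrow> real" assume "\<And>i. i \<in> indices {1..b} \<Longrightarrow> q i = q' i"
  note A = agree_simps[OF this] agree_pos[OF this]
  show "OPENSQ j b q = OPENSQ j b q'"
    by (rule opens_way_cong) (use A in auto)
qed (rule observable_pos, simp)

lemma observable_open_any: "observable (indices {1..b}) (open_any b)"
  unfolding open_any_def
proof (rule observable_if)
  show "Measurable.pred (PiM (indices {1..b}) N) (\<lambda>q. \<exists>j\<in>{1<..<b}. OPENSQ j b q)"
    using pred_opens_way[OF random_configuration_pos]
    by (intro pred_intros_countable_bounded(4)) simp
  fix q q' :: "index \<Rightarrow> real" assume "\<And>i. i \<in> indices {1..b} \<Longrightarrow> q i = q' i"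
  note A = agree_simps[OF this] agree_pos[OF this]
  have "OPENSQ j b q = OPENSQ j b q'" for j
    by (rule opens_way_cong) (use A in auto)
  then show "(\<exists>j\<in>{1<..<b}. OPENSQ j b q) = (\<exists>j\<in>{1<..<b}. OPENSQ j b q')" by simp
qed (rule observable_pos, simp)

lemma observable_start: "observable (indices {1}) (start u)"
  unfolding start_def
proof (rule observable_if)
  show "Measurable.pred (PiM (indices {1}) N) (\<lambda>q. velocities q 1 = u)"
    using velocities_measurable[of 1 "{1}"] by simp
  show "observable (indices {1}) (\<lambda>q. \<phi> (lengths q 1))"
    using observable_pos[of 1 1 "{1}"] unfolding pos_same by simp
  fix q q' :: "index \<Rightarrow> real" assume e: "\<And>i. i \<in> indices {1} \<Longrightarrow> q i = q' i"
  have "velocities q 1 = velocities q' 1"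
    by (rule agree_simps(2)[of "{1}"]) (use e in auto)
  then show "(velocities q 1 = u) = (velocities q' 1 = u)" by simp
qed

lemma observable_mirror_open:
  assumes j: "1 < j" "j < n"
  shows "observable (indices {1..n}) (mirror_open j n)"
  unfolding mirror_open_def
proof (rule observable_if)
  have m: "(\<lambda>q. pos 2 q j) \<in> borel_measurable (PiM (indices {1..n}) N)"
    "(\<lambda>q. pos (Suc j) q n) \<in> borel_measurable (PiM (indices {1..n}) N)"
    "(\<lambda>q. spins q 1) \<in> borel_measurable (PiM (indices {1..n}) N)"
    using j by (auto intro!: pos_measurable spins_measurable)
  show "Measurable.pred (PiM (indices {1..n}) N)
    (\<lambda>q. pos 2 q j < pos (Suc j) q n \<or> pos 2 q j = pos (Suc j) q n \<and> spins q 1 = 1)"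
    using borel_measurable_eq[OF m(1,2)] borel_measurable_eq[OF m(3) borel_measurable_const]
    by (intro pred_intros_logic(3,5) borel_measurable_pred_less m(1,2)) (simp_all add: pred_def)
  fix q q' :: "index \<Rightarrow> real" assume e: "\<And>i. i \<in> indices {1..n} \<Longrightarrow> q i = q' i"
  have "pos 2 q j = pos 2 q' j"
    by (rule agree_pos[of "{1..n}"]) (use e j in auto)
  moreover have "pos (Suc j) q n = pos (Suc j) q' n"
    by (rule agree_pos[of "{1..n}"]) (use e j in auto)
  moreover have "spins q 1 = spins q' 1"
    by (rule agree_simps(3)[of "{1..n}"]) (use e j in auto)
  ultimately show "(pos 2 q j < pos (Suc j) q n \<or> pos 2 q j = pos (Suc j) q n \<and> spins q 1 = 1) =
    (pos 2 q' j < pos (Suc j) q' n \<or> pos 2 q' j = pos (Suc j) q' n \<and> spins q' 1 = 1)" by simp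
next
  show "observable (indices {1..n}) (\<lambda>q. start 0 q * cross 2 j q * cross (Suc j) n q)"
    by (intro observable_mult observable_mono[OF observable_start] observable_mono[OF observable_cross] indices_mono)
      (use j in auto)
qed

definition c where "c = expct (\<lambda>q. \<phi> (lengths q 1))"
definition \<alpha> where "\<alpha> n = expct (cross 1 n)"
definition \<beta> where "\<beta> n = expct (duel n)"
definition \<eta> where "\<eta> n = expct (open_any n)"

lemma \<alpha>_0: "\<alpha> 0 = 0" and \<beta>_0: "\<beta> 0 = 0" "\<beta> (Suc 0) = 0" and \<eta>_0: "\<eta> 0 = 0" "\<eta> (Suc 0) = 0"
  by (simp_all add: \<alpha>_def \<beta>_def \<eta>_def expct_def cross_def duel_def open_any_def clears_left_def collide_def)

text \<open>Blocks of the same length have the same weight.\<close>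

lemma expct_cross_shift: "expct (cross (Suc k) (n + k)) = \<alpha> n"
proof (cases "n = 0")
  case True
  then show ?thesis by (simp add: \<alpha>_0 expct_def cross_def clears_left_def)
next
  case False
  have "\<alpha> n = expct (\<lambda>q. cross 1 n (transform (\<lambda>i. i + k) (\<lambda>i. i + k) (\<lambda>_. 1) q))"
    unfolding \<alpha>_def by (rule expct_transform[OF observable_cross]) (use False in auto)
  also have "\<dots> = expct (cross (1 + k) (n + k))"
    by (rule arg_cong[where f = expct], rule ext, rule cross_shift) (simp_all add: transform_simps)
  finally show ?thesis by simp
qed

text \<open>The renewal property: after \<open>k\<close> the system starts afresh.\<close>

lemma expct_mult_cross:
  assumes "observable (indices {1..k}) \<Phi>" "k \<le> n"
  shows "expct (\<lambda>q. \<Phi> q * cross (Suc k) n q) = expct \<Phi> * \<alpha> (n - k)"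
proof -
  have "expct (\<lambda>q. \<Phi> q * cross (Suc k) n q) = expct \<Phi> * expct (cross (Suc k) n)"
    by (rule expct_mult[OF assms(1) _ observable_cross])
      (intro indices_mono indices_disjoint; auto)+
  then show ?thesis using expct_cross_shift[of k "n - k"] assms(2) by simp
qed

lemma expct_start:
  shows "expct (start 0) = of_real p * c" "u = 1 \<or> u = -1 \<Longrightarrow> expct (start u) = of_real ((1 - p) / 2) * c"
proof -
  have start: "expct (start u) = of_real (measure (velocity_law p) {u}) * c" if u: "u \<in> {-1, 0, 1}" for u
  proof -
    have o1: "observable {Inr (Inl 1)} (\<lambda>q. if velocities q 1 = u then 1 else 0)"
    proof (rule observable_if)
      show "Measurable.pred (PiM {Inr (Inl 1)} N) (\<lambda>q. velocities q 1 = u)"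
        using coordinate_measurable[of "Inr (Inl 1)" "{Inr (Inl 1)}"] by (simp add: velocities_def)
    qed (auto simp: observable_def velocities_def)
    have o2: "observable {Inl 1} (\<lambda>q. \<phi> (lengths q 1))"
      unfolding observable_def lengths_def
      using measurable_compose[OF coordinate_measurable[of "Inl 1" "{Inl 1}"] \<phi>_measurable] \<phi>_bounded by simp
    have "expct (start u) = expct (\<lambda>q. (if velocities q 1 = u then 1 else 0) * \<phi> (lengths q 1))"
      by (rule expct_cong) (simp add: start_def)
    also have "\<dots> = expct (\<lambda>q. if velocities q 1 = u then 1 else 0) * c"
      unfolding c_def by (rule expct_mult[OF o1 _ o2]) auto
    also have "expct (\<lambda>q. if velocities q 1 = u then 1 else 0) = of_real (measure (velocity_law p) {u})"
    proof -
      have "expct (\<lambda>q. if velocities q 1 = u then 1 else 0)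
        = (\<integral>\<omega>. complex_of_real (indicator (v 1 -` {u} \<inter> space M) \<omega>) \<partial>M)"
        unfolding expct_def Y_simps
        by (rule Bochner_Integration.integral_cong) (auto simp: indicator_def)
      also have "\<dots> = of_real (measure M (v 1 -` {u} \<inter> space M))" by simp
      also have "measure M (v 1 -` {u} \<inter> space M) = measure (distr M (velocity_law p) (v 1)) {u}"
        by (rule measure_distr[symmetric]) (use law_v(1) u in auto)
      finally show ?thesis using law_v(2)[of 1] by simp
    qed
    finally show ?thesis .
  qed
  have "measure (velocity_law p) {u} = (if u = 0 then p else (1 - p) / 2)" if "u \<in> {-1, 0, 1}" for u
    using that p unfolding measure_def by (subst emeasure_velocity_law) auto
  then show "expct (start 0) = of_real p * c" "u = 1 \<or> u = -1 \<Longrightarrow> expct (start u) = of_real ((1 - p) / 2) * c"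
    using start[of 0] start[of u] by auto
qed

lemma expct_start_cross_cross:
  assumes "1 < j" "j < n"
  shows "expct (\<lambda>q. start 0 q * cross 2 j q * cross (Suc j) n q) = of_real p * c * \<alpha> (j - 1) * \<alpha> (n - j)"
proof -
  have "observable (indices {1..j}) (\<lambda>q. start 0 q * cross 2 j q)"
    by (intro observable_mult observable_mono[OF observable_start] observable_mono[OF observable_cross] indices_mono)
      (use assms in auto)
  then have "expct (\<lambda>q. start 0 q * cross 2 j q * cross (Suc j) n q) = expct (\<lambda>q. start 0 q * cross 2 j q) * \<alpha> (n - j)"
    by (rule expct_mult_cross) (use assms in simp)
  moreover have "expct (\<lambda>q. start 0 q * cross (Suc 1) j q) = expct (start 0) * \<alpha> (j - 1)"
    by (rule expct_mult_cross) (use observable_start assms in auto)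
  ultimately show ?thesis using expct_start(1) by (simp add: numeral_2_eq_2)
qed

lemma \<alpha>_recursion:
  assumes "1 \<le> n"
  shows "\<alpha> n = (if n = 1 then of_real ((1 - p) / 2) * c else 0)
    + (\<Sum>j\<in>{1<..<n}. of_real p * c * \<alpha> (j - 1) * \<alpha> (n - j)) + \<eta> n + (\<Sum>k\<in>{1<..<n}. \<beta> k * \<alpha> (n - k))"
proof -
  let ?K = "indices {1..n}"
  have K: "?K \<subseteq> indices {1..}" by (rule indices_mono) auto
  have o1: "observable ?K (\<lambda>q. start 0 q * cross 2 j q * cross (Suc j) n q)" if "j \<in> {1<..<n}" for j
    by (intro observable_mult observable_mono[OF observable_start] observable_mono[OF observable_cross] indices_mono)
      (use that in auto)
  have o2: "observable ?K (\<lambda>q. duel k q * cross (Suc k) n q)" if "k \<in> {1<..<n}" for k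
    by (intro observable_mult observable_mono[OF observable_duel] observable_mono[OF observable_cross] indices_mono)
      (use that in auto)
  have o3: "observable ?K (start u)" for u
    by (intro observable_mono[OF observable_start] indices_mono) (use assms in auto)
  note int = observable_integrable[OF o1 K] observable_integrable[OF o2 K] observable_integrable[OF o3 K]
    observable_integrable[OF observable_open_any K]
  have "\<alpha> n = expct (\<lambda>q. (if n = 1 then start (-1) q else 0) + (\<Sum>j\<in>{1<..<n}. start 0 q * cross 2 j q * cross (Suc j) n q)
    + open_any n q + (\<Sum>k\<in>{1<..<n}. duel k q * cross (Suc k) n q))"
    unfolding \<alpha>_def by (rule expct_cong) (rule cross_recursion[OF _ assms])
  also have "\<dots> = expct (\<lambda>q. if n = 1 then start (-1) q else 0)
    + expct (\<lambda>q. \<Sum>j\<in>{1<..<n}. start 0 q * cross 2 j q * cross (Suc j) n q) + expct (open_any n)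
    + expct (\<lambda>q. \<Sum>k\<in>{1<..<n}. duel k q * cross (Suc k) n q)"
  proof -
    have i1: "integrable M (\<lambda>\<omega>. if n = 1 then start (-1) (Y \<omega>) else 0)" using int(3) by (cases "n = 1") auto
    have i2: "integrable M (\<lambda>\<omega>. \<Sum>j\<in>{1<..<n}. start 0 (Y \<omega>) * cross 2 j (Y \<omega>) * cross (Suc j) n (Y \<omega>))"
      by (rule Bochner_Integration.integrable_sum) (rule int(1))
    have i3: "integrable M (\<lambda>\<omega>. \<Sum>k\<in>{1<..<n}. duel k (Y \<omega>) * cross (Suc k) n (Y \<omega>))"
      by (rule Bochner_Integration.integrable_sum) (rule int(2))
    note i12 = Bochner_Integration.integrable_add[OF i1 i2]
    note i123 = Bochner_Integration.integrable_add[OF i12 int(4)]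
    show ?thesis unfolding expct_def
      using Bochner_Integration.integral_add[OF i123 i3] Bochner_Integration.integral_add[OF i12 int(4)]
        Bochner_Integration.integral_add[OF i1 i2] by (simp only:)
  qed
  also have "expct (\<lambda>q. if n = 1 then start (-1) q else 0) = (if n = 1 then of_real ((1 - p) / 2) * c else 0)"
    using expct_start(2)[of "-1"] by (simp add: expct_def)
  also have "expct (\<lambda>q. \<Sum>j\<in>{1<..<n}. start 0 q * cross 2 j q * cross (Suc j) n q)
    = (\<Sum>j\<in>{1<..<n}. of_real p * c * \<alpha> (j - 1) * \<alpha> (n - j))"
    by (subst expct_sum[OF _ o1 K]) (auto simp: expct_start_cross_cross)
  also have "expct (\<lambda>q. \<Sum>k\<in>{1<..<n}. duel k q * cross (Suc k) n q) = (\<Sum>k\<in>{1<..<n}. \<beta> k * \<alpha> (n - k))"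
    by (subst expct_sum[OF _ o2 K]) (auto simp: \<beta>_def expct_mult_cross[OF observable_duel])
  finally show ?thesis by (simp add: \<eta>_def)
qed

lemma \<beta>_recursion:
  assumes "1 \<le> n"
  shows "of_real ((1 - p) / 2) * c * \<alpha> (n - 1) = \<beta> n + (\<Sum>k\<in>{1..<n}. \<eta> k * \<alpha> (n - k))"
proof -
  let ?K = "indices {1..n}"
  have K: "?K \<subseteq> indices {1..}" by (rule indices_mono) auto
  have o2: "observable ?K (\<lambda>q. open_any k q * cross (Suc k) n q)" if "k \<in> {1..<n}" for k
    by (intro observable_mult observable_mono[OF observable_open_any] observable_mono[OF observable_cross] indices_mono)
      (use that in auto)
  note int = observable_integrable[OF o2 K] observable_integrable[OF observable_duel K]
  have "expct (\<lambda>q. start 1 q * cross (Suc 1) n q) = expct (start 1) * \<alpha> (n - 1)"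
    by (rule expct_mult_cross) (use observable_start assms in auto)
  then have "of_real ((1 - p) / 2) * c * \<alpha> (n - 1) = expct (\<lambda>q. start 1 q * cross 2 n q)"
    using expct_start(2)[of 1] by (simp add: numeral_2_eq_2)
  also have "\<dots> = expct (\<lambda>q. duel n q + (\<Sum>k\<in>{1..<n}. open_any k q * cross (Suc k) n q))"
    by (rule expct_cong) (rule cross_beyond_recursion[OF _ assms])
  also have "\<dots> = expct (duel n) + expct (\<lambda>q. \<Sum>k\<in>{1..<n}. open_any k q * cross (Suc k) n q)"
  proof -
    have i3: "integrable M (\<lambda>\<omega>. \<Sum>k\<in>{1..<n}. open_any k (Y \<omega>) * cross (Suc k) n (Y \<omega>))"
      by (rule Bochner_Integration.integrable_sum) (rule int(1))
    show ?thesis unfolding expct_def by (rule Bochner_Integration.integral_add[OF int(2) i3])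
  qed
  also have "expct (\<lambda>q. \<Sum>k\<in>{1..<n}. open_any k q * cross (Suc k) n q) = (\<Sum>k\<in>{1..<n}. \<eta> k * \<alpha> (n - k))"
    by (subst expct_sum[OF _ o2 K]) (auto simp: \<eta>_def expct_mult_cross[OF observable_open_any])
  finally show ?thesis by (simp add: \<beta>_def)
qed

text \<open>Summed over \<open>j\<close>, the weights of \<open>mirror_open\<close> at \<open>j\<close> and at \<open>n + 1 - j\<close> are equal and add up to the
  weight of two consecutive crossings, without any race.\<close>

lemma \<eta>_recursion:
  "2 * \<eta> n = (\<Sum>j\<in>{1<..<n}. of_real p * c * \<alpha> (j - 1) * \<alpha> (n - j))"
proof -
  let ?K = "indices {1..n}"
  have K: "?K \<subseteq> indices {1..}" by (rule indices_mono) auto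
  have EO: "expct (open_at j n) = expct (mirror_open j n)" if j: "1 < j" "j < n" for j
  proof -
    have "expct (mirror_open j n) = expct (\<lambda>q. mirror_open j n (transform (\<lambda>i. if 2 \<le> i \<and> i \<le> j then j + 2 - i else i)
      (\<lambda>i. if i \<le> j then j + 1 - i else i) (\<lambda>i. if i \<le> j then -1 else 1) q))"
      by (rule expct_transform[OF observable_mirror_open[OF j]]) (use j in \<open>auto simp: inj_on_def\<close>)
    also have "\<dots> = expct (open_at j n)" by (rule expct_cong) (simp add: open_at_reversed[OF _ j])
    finally show ?thesis ..
  qed
  have EG: "expct (mirror_open j n) + expct (mirror_open (n + 1 - j) n) = of_real p * c * \<alpha> (j - 1) * \<alpha> (n - j)"
    if j: "1 < j" "j < n" for j
  proof -
    define k where "k = n + 1 - j"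
    define \<sigma> where "\<sigma> = (\<lambda>i. if 2 \<le> i \<and> i \<le> k then i + (j - 1) else if k < i then i - (k - 1) else i)"
    have k: "1 < k" "k < n" "j + k = n + 1" using j by (auto simp: k_def)
    have \<sigma>: "inj_on \<sigma> {1..n}" "\<sigma> ` {1..n} \<subseteq> {1..}"
      using k j by (auto simp: \<sigma>_def inj_on_def)
    have e: "expct (mirror_open k n) = expct (\<lambda>q. mirror_open k n (transform \<sigma> \<sigma> (\<lambda>i. if i = 1 then -1 else 1) q))"
      by (rule expct_transform[OF observable_mirror_open[OF k(1,2)]]) (use \<sigma> k in auto)
    have o: "observable ?K (\<lambda>q. start 0 q * cross 2 j q * cross (Suc j) n q)"
      by (intro observable_mult observable_mono[OF observable_start] observable_mono[OF observable_cross] indices_mono)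
        (use j in auto)
    have "expct (\<lambda>q. mirror_open k n (transform \<sigma> \<sigma> (\<lambda>i. if i = 1 then -1 else 1) q))
      = expct (\<lambda>q. start 0 q * cross 2 j q * cross (Suc j) n q - mirror_open j n q)"
    proof (rule expct_cong)
      fix q assume "valid q"
      from mirror_open_symmetric[OF this j]
      show "mirror_open k n (transform \<sigma> \<sigma> (\<lambda>i. if i = 1 then -1 else 1) q)
        = start 0 q * cross 2 j q * cross (Suc j) n q - mirror_open j n q"
        unfolding \<sigma>_def k_def by (simp add: algebra_simps)
    qed
    also have "\<dots> = expct (\<lambda>q. start 0 q * cross 2 j q * cross (Suc j) n q) - expct (mirror_open j n)"
      unfolding expct_def
      by (rule Bochner_Integration.integral_diff) (rule observable_integrable[OF _ K], rule o observable_mirror_open[OF j])+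
    finally show ?thesis using e expct_start_cross_cross[OF j] by (simp add: k_def)
  qed
  have "\<eta> n = expct (\<lambda>q. \<Sum>j\<in>{1<..<n}. open_at j n q)" unfolding \<eta>_def by (rule expct_cong) (rule open_any_sum)
  also have "\<dots> = (\<Sum>j\<in>{1<..<n}. expct (open_at j n))" by (rule expct_sum[OF _ observable_open_at K]) simp
  also have "\<dots> = (\<Sum>j\<in>{1<..<n}. expct (mirror_open j n))" by (rule sum.cong) (use EO in auto)
  finally have 1: "\<eta> n = (\<Sum>j\<in>{1<..<n}. expct (mirror_open j n))" .
  also have "\<dots> = (\<Sum>j\<in>{1<..<n}. expct (mirror_open (n + 1 - j) n))"
    by (rule sum.reindex_bij_witness[of _ "\<lambda>j. n + 1 - j" "\<lambda>j. n + 1 - j"]) auto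
  finally have 2: "\<eta> n = (\<Sum>j\<in>{1<..<n}. expct (mirror_open (n + 1 - j) n))" .
  have "2 * \<eta> n = (\<Sum>j\<in>{1<..<n}. expct (mirror_open j n) + expct (mirror_open (n + 1 - j) n))"
    using 1 2 by (simp add: sum.distrib)
  also have "\<dots> = (\<Sum>j\<in>{1<..<n}. of_real p * c * \<alpha> (j - 1) * \<alpha> (n - j))"
    by (rule sum.cong) (use EG in auto)
  finally show ?thesis .
qed

end

section \<open>The power series\<close>

lemma fps_mult_sums:
  fixes f g :: "complex fps"
  assumes f: "summable (\<lambda>n. norm (fps_nth f n))" and g: "summable (\<lambda>n. norm (fps_nth g n))"
  shows "summable (\<lambda>n. norm (fps_nth (f * g) n))"
    and "(\<Sum>n. fps_nth (f * g) n) = (\<Sum>n. fps_nth f n) * (\<Sum>n. fps_nth g n)"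
proof -
  have nth: "fps_nth (f * g) n = (\<Sum>i\<le>n. fps_nth f i * fps_nth g (n - i))" for n
    by (simp add: fps_mult_nth atLeast0AtMost)
  have S: "summable (\<lambda>n. \<Sum>i\<le>n. norm (fps_nth f i) * norm (fps_nth g (n - i)))"
    by (rule summable_Cauchy_product) (use f g in simp_all)
  have le: "norm (fps_nth (f * g) n) \<le> (\<Sum>i\<le>n. norm (fps_nth f i) * norm (fps_nth g (n - i)))" for n
    unfolding nth by (rule order_trans[OF norm_sum]) (simp add: norm_mult)
  show "summable (\<lambda>n. norm (fps_nth (f * g) n))"
    by (rule summable_comparison_test'[OF S, of 0]) (simp only: real_norm_def abs_norm_cancel le)
  show "(\<Sum>n. fps_nth (f * g) n) = (\<Sum>n. fps_nth f n) * (\<Sum>n. fps_nth g n)"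
    unfolding nth using Cauchy_product[OF f g] by simp
qed

definition quartic :: "complex \<Rightarrow> complex fps \<Rightarrow> complex fps" where
  "quartic p A = fps_const (1 - p) + fps_const (1 + 2 * p) * A ^ 2 - fps_const p * A ^ 4"

lemma fps_nth_scale:
  fixes A A' B B' :: "complex fps"
  assumes "\<And>i. i \<le> n \<Longrightarrow> fps_nth A i = c ^ i * fps_nth A' i" "\<And>i. i \<le> n \<Longrightarrow> fps_nth B i = c ^ i * fps_nth B' i"
    and "k \<le> n"
  shows "fps_nth (A * B) k = c ^ k * fps_nth (A' * B') k"
proof -
  have "fps_nth (A * B) k = (\<Sum>i=0..k. c ^ k * (fps_nth A' i * fps_nth B' (k - i)))"
    unfolding fps_mult_nth
  proof (rule sum.cong[OF refl])
    fix i assume "i \<in> {0..k}"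
    then have "c ^ k = c ^ i * c ^ (k - i)" by (simp flip: power_add)
    then show "fps_nth A i * fps_nth B (k - i) = c ^ k * (fps_nth A' i * fps_nth B' (k - i))"
      using assms \<open>i \<in> {0..k}\<close> by simp
  qed
  then show ?thesis by (simp add: fps_mult_nth sum_distrib_left)
qed

text \<open>The coefficient at \<open>n + 1\<close> is \<open>c\<close> times an expression that is homogeneous in the earlier coefficients,
  which gives one further factor \<open>c\<close> per step.\<close>

lemma quartic_solution_scales:
  assumes A: "2 * A = fps_const c * fps_X * quartic p A" and A': "2 * A' = fps_X * quartic p A'"
  shows "fps_nth A n = c ^ n * fps_nth A' n"
proof (induction n rule: less_induct)
  case (less n)
  have two: "2 * fps_nth B i = fps_nth (2 * B) i" for B :: "complex fps" and i
    by (simp add: fps_numeral_fps_const)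
  show ?case
  proof (cases n)
    case 0
    have "2 * fps_nth A 0 = 0" "2 * fps_nth A' 0 = 0"
      using arg_cong[OF A, of "\<lambda>f. fps_nth f 0"] arg_cong[OF A', of "\<lambda>f. fps_nth f 0"]
      by (simp_all add: fps_numeral_fps_const)
    then show ?thesis using 0 by simp
  next
    case (Suc k)
    have IH: "fps_nth A i = c ^ i * fps_nth A' i" if "i \<le> k" for i using less.IH that Suc by simp
    have sq: "fps_nth (A * A) i = c ^ i * fps_nth (A' * A') i" if "i \<le> k" for i
      by (rule fps_nth_scale[OF IH IH that])
    have qu: "fps_nth (A * A * (A * A)) k = c ^ k * fps_nth (A' * A' * (A' * A')) k"
      by (rule fps_nth_scale[OF sq sq order_refl])
    have nq: "fps_nth (quartic p B) k = (if k = 0 then 1 - p else 0) + (1 + 2 * p) * fps_nth (B * B) k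
      - p * fps_nth (B * B * (B * B)) k" for B
      by (simp add: quartic_def power2_eq_square power4_eq_xxxx mult.assoc)
    have q: "fps_nth (quartic p A) k = c ^ k * fps_nth (quartic p A') k"
      unfolding nq sq[OF order_refl] qu by (simp add: algebra_simps)
    have "2 * fps_nth A n = c * fps_nth (quartic p A) k"
      unfolding two A Suc by (simp add: mult.assoc)
    moreover have "2 * fps_nth A' n = fps_nth (quartic p A') k"
      unfolding two A' Suc by simp
    ultimately have "2 * fps_nth A n = 2 * (c ^ n * fps_nth A' n)" using q Suc by simp
    then show ?thesis by simp
  qed
qed

lemma quartic_solution_sum:
  assumes A: "2 * A = fps_const c * fps_X * quartic p A" and s: "summable (\<lambda>n. norm (fps_nth A n))"
  defines "F \<equiv> \<Sum>n. fps_nth A n"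
  shows "2 * F = c * ((1 - p) + (1 + 2 * p) * F ^ 2 - p * F ^ 4)"
proof -
  have s2: "summable (\<lambda>n. norm (fps_nth (A ^ 2) n))" "(\<Sum>n. fps_nth (A ^ 2) n) = F ^ 2"
    using fps_mult_sums[OF s s] by (simp_all add: power2_eq_square F_def)
  have "A ^ 4 = A ^ 2 * A ^ 2" by (simp flip: power_add)
  then have s4: "summable (\<lambda>n. norm (fps_nth (A ^ 4) n))" "(\<Sum>n. fps_nth (A ^ 4) n) = F ^ 4"
    using fps_mult_sums[OF s2(1) s2(1)] s2(2) by (simp_all flip: power_add)
  have "(\<lambda>n. fps_nth A n) sums F" unfolding F_def by (rule summable_sums[OF summable_norm_cancel[OF s]])
  moreover have "fps_nth A 0 = 0"
    using arg_cong[OF A, of "\<lambda>f. fps_nth f 0"] by (simp add: fps_numeral_fps_const)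
  ultimately have "(\<lambda>n. fps_nth A (Suc n)) sums F" by (simp add: sums_Suc_iff)
  then have 1: "(\<lambda>n. 2 * fps_nth A (Suc n)) sums (2 * F)" by (rule sums_mult)
  have "(\<lambda>n. fps_nth (fps_const (1 - p)) n) sums (1 - p)"
    using sums_single[of 0 "\<lambda>_. 1 - p"] by (simp add: fps_const_def cong: if_cong)
  moreover have "(\<lambda>n. (1 + 2 * p) * fps_nth (A ^ 2) n) sums ((1 + 2 * p) * F ^ 2)"
    using summable_sums[OF summable_norm_cancel[OF s2(1)]] unfolding s2(2) by (rule sums_mult)
  moreover have "(\<lambda>n. p * fps_nth (A ^ 4) n) sums (p * F ^ 4)"
    using summable_sums[OF summable_norm_cancel[OF s4(1)]] unfolding s4(2) by (rule sums_mult)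
  ultimately have "(\<lambda>n. fps_nth (fps_const (1 - p)) n + (1 + 2 * p) * fps_nth (A ^ 2) n - p * fps_nth (A ^ 4) n)
    sums ((1 - p) + (1 + 2 * p) * F ^ 2 - p * F ^ 4)"
    by (intro sums_add sums_diff)
  then have "(\<lambda>n. fps_nth (quartic p A) n) sums ((1 - p) + (1 + 2 * p) * F ^ 2 - p * F ^ 4)"
    unfolding quartic_def by (simp only: fps_add_nth fps_sub_nth fps_mult_left_const_nth)
  then have 2: "(\<lambda>n. c * fps_nth (quartic p A) n) sums (c * ((1 - p) + (1 + 2 * p) * F ^ 2 - p * F ^ 4))"
    by (rule sums_mult)
  have "2 * fps_nth A (Suc n) = c * fps_nth (quartic p A) n" for n
  proof -
    have "2 * fps_nth A (Suc n) = fps_nth (2 * A) (Suc n)" by (simp add: fps_numeral_fps_const)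
    then show ?thesis unfolding A by (simp add: mult.assoc)
  qed
  then show ?thesis using sums_unique2[OF 1] 2 by simp
qed

context weighted_annihilation
begin

definition \<alpha>_series where "\<alpha>_series = Abs_fps \<alpha>"
definition \<beta>_series where "\<beta>_series = Abs_fps \<beta>"
definition \<eta>_series where "\<eta>_series = Abs_fps \<eta>"

lemma series_0 [simp]: "fps_nth \<alpha>_series 0 = 0" "fps_nth \<beta>_series 0 = 0" "fps_nth \<eta>_series 0 = 0"
  by (simp_all add: \<alpha>_series_def \<beta>_series_def \<eta>_series_def \<alpha>_0 \<beta>_0 \<eta>_0)

lemma sum_conv_square:
  "(\<Sum>j\<in>{1<..<Suc n}. \<alpha> (j - 1) * \<alpha> (Suc n - j)) = fps_nth (\<alpha>_series * \<alpha>_series) n"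
proof -
  have "(\<Sum>j\<in>{1<..<Suc n}. \<alpha> (j - 1) * \<alpha> (Suc n - j)) = (\<Sum>i\<in>{0<..<n}. \<alpha> i * \<alpha> (n - i))"
    by (rule sum.reindex_bij_witness[of _ Suc "\<lambda>j. j - 1"]) auto
  also have "\<dots> = (\<Sum>i=0..n. \<alpha> i * \<alpha> (n - i))"
    by (rule sum.mono_neutral_left) (auto simp: \<alpha>_0 not_less le_less)
  finally show ?thesis by (simp add: fps_mult_nth \<alpha>_series_def)
qed

lemma series_equations:
  defines "p' \<equiv> complex_of_real p"
  shows "\<eta>_series * 2 = fps_const (p' * c) * fps_X * \<alpha>_series ^ 2"
    and "fps_const ((1 - p') / 2 * c) * fps_X * \<alpha>_series = \<beta>_series + \<eta>_series * \<alpha>_series"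
    and "\<alpha>_series = fps_const ((1 - p') / 2 * c) * fps_X + fps_const (p' * c) * fps_X * \<alpha>_series ^ 2
      + \<eta>_series + \<beta>_series * \<alpha>_series"
proof -
  have sq: "(\<Sum>j\<in>{1<..<Suc n}. of_real p * c * \<alpha> (j - 1) * \<alpha> (Suc n - j))
    = p' * c * fps_nth (\<alpha>_series ^ 2) n" for n
    unfolding power2_eq_square sum_conv_square[symmetric]
    by (simp add: p'_def sum_distrib_left mult.assoc)
  show "\<eta>_series * 2 = fps_const (p' * c) * fps_X * \<alpha>_series ^ 2"
  proof (rule fps_ext)
    fix n show "fps_nth (\<eta>_series * 2) n = fps_nth (fps_const (p' * c) * fps_X * \<alpha>_series ^ 2) n"
    proof (cases n)
      case (Suc k)
      have "fps_nth (\<eta>_series * 2) (Suc k) = 2 * \<eta> (Suc k)"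
        by (simp add: fps_numeral_fps_const \<eta>_series_def)
      then show ?thesis using \<eta>_recursion[of "Suc k"] unfolding sq Suc by (simp add: mult.assoc)
    qed (simp add: fps_numeral_fps_const)
  qed
  show "fps_const ((1 - p') / 2 * c) * fps_X * \<alpha>_series = \<beta>_series + \<eta>_series * \<alpha>_series"
  proof (rule fps_ext)
    fix n show "fps_nth (fps_const ((1 - p') / 2 * c) * fps_X * \<alpha>_series) n = fps_nth (\<beta>_series + \<eta>_series * \<alpha>_series) n"
    proof (cases n)
      case (Suc k)
      have "(\<Sum>i\<in>{1..<Suc k}. \<eta> i * \<alpha> (Suc k - i)) = (\<Sum>i=0..Suc k. \<eta> i * \<alpha> (Suc k - i))"
        by (rule sum.mono_neutral_left) (auto simp: \<alpha>_0 \<eta>_0 not_less_eq_eq le_Suc_eq)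
      also have "\<dots> = fps_nth (\<eta>_series * \<alpha>_series) (Suc k)"
        by (simp only: fps_mult_nth \<eta>_series_def \<alpha>_series_def fps_nth_Abs_fps)
      finally have "of_real ((1 - p) / 2) * c * \<alpha> k = \<beta> (Suc k) + fps_nth (\<eta>_series * \<alpha>_series) (Suc k)"
        using \<beta>_recursion[of "Suc k"] by simp
      moreover have "fps_nth (fps_const ((1 - p') / 2 * c) * fps_X * \<alpha>_series) (Suc k)
        = of_real ((1 - p) / 2) * c * \<alpha> k"
        by (simp add: mult.assoc \<alpha>_series_def p'_def)
      moreover have "fps_nth \<beta>_series (Suc k) = \<beta> (Suc k)" by (simp add: \<beta>_series_def)
      ultimately show ?thesis unfolding Suc fps_add_nth by (simp only:)
    qed simp
  qed
  show "\<alpha>_series = fps_const ((1 - p') / 2 * c) * fps_X + fps_const (p' * c) * fps_X * \<alpha>_series ^ 2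
      + \<eta>_series + \<beta>_series * \<alpha>_series" (is "_ = ?R")
  proof (rule fps_ext)
    fix n show "fps_nth \<alpha>_series n = fps_nth ?R n"
    proof (cases n)
      case (Suc k)
      have "(\<Sum>i\<in>{1<..<Suc k}. \<beta> i * \<alpha> (Suc k - i)) = (\<Sum>i=0..Suc k. \<beta> i * \<alpha> (Suc k - i))"
      proof (rule sum.mono_neutral_left)
        show "\<forall>i\<in>{0..Suc k} - {1<..<Suc k}. \<beta> i * \<alpha> (Suc k - i) = 0"
        proof
          fix i assume "i \<in> {0..Suc k} - {1<..<Suc k}"
          then have "i = 0 \<or> i = Suc 0 \<or> i = Suc k" by auto
          then show "\<beta> i * \<alpha> (Suc k - i) = 0" by (auto simp: \<alpha>_0 \<beta>_0)
        qed
      qed auto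
      also have "\<dots> = fps_nth (\<beta>_series * \<alpha>_series) (Suc k)"
        by (simp only: fps_mult_nth \<beta>_series_def \<alpha>_series_def fps_nth_Abs_fps)
      finally have b: "(\<Sum>i\<in>{1<..<Suc k}. \<beta> i * \<alpha> (Suc k - i)) = fps_nth (\<beta>_series * \<alpha>_series) (Suc k)" .
      have "fps_nth \<alpha>_series (Suc k) = (if Suc k = 1 then of_real ((1 - p) / 2) * c else 0)
        + p' * c * fps_nth (\<alpha>_series ^ 2) k + \<eta> (Suc k) + fps_nth (\<beta>_series * \<alpha>_series) (Suc k)"
        using \<alpha>_recursion[of "Suc k"] unfolding sq b by (simp add: \<alpha>_series_def)
      moreover have "fps_nth (fps_const ((1 - p') / 2 * c) * fps_X) (Suc k)
        = (if Suc k = 1 then of_real ((1 - p) / 2) * c else 0)"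
        by (simp add: p'_def fps_X_nth)
      moreover have "fps_nth (fps_const (p' * c) * fps_X * \<alpha>_series ^ 2) (Suc k)
        = p' * c * fps_nth (\<alpha>_series ^ 2) k"
        by (simp add: mult.assoc)
      moreover have "fps_nth \<eta>_series (Suc k) = \<eta> (Suc k)" by (simp add: \<eta>_series_def)
      ultimately show ?thesis unfolding Suc fps_add_nth by (simp only:)
    qed (simp add: power2_eq_square)
  qed
qed

lemma \<alpha>_series_quartic: "2 * \<alpha>_series = fps_const c * fps_X * quartic (of_real p) \<alpha>_series"
proof -
  define p' where "p' = complex_of_real p"
  note E = series_equations[folded p'_def]
  let ?A = "\<alpha>_series"
  define P C h where "P = fps_const p'" and "C = fps_const c" and "h = fps_const (1 / 2 :: complex)"
  have h: "2 * h = 1" by (simp add: h_def fps_numeral_fps_const flip: fps_const_mult)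
  have k1: "fps_const ((1 - p') / 2 * c) = (1 - P) * h * C" "fps_const (p' * c) = P * C"
    by (simp_all add: P_def C_def h_def flip: fps_const_1_eq_1)
  have k2: "fps_const (1 - p') = 1 - P" "fps_const (1 + 2 * p') = 1 + 2 * P"
    by (simp_all add: P_def fps_numeral_fps_const flip: fps_const_1_eq_1)
  note E' = E[unfolded k1]
  have "2 * ?A = C * fps_X * ((1 - P) + (1 + 2 * P) * ?A ^ 2 - P * ?A ^ 4)"
    using E' h by algebra
  then show ?thesis by (simp add: quartic_def k2 flip: p'_def C_def P_def)
qed

end

section \<open>Independence and the Laplace transform\<close>

context ballistic_annihilation
begin

definition first :: "'a \<Rightarrow> enat" where
  "first \<omega> = first_crossing (\<lambda>n. position l n \<omega>) (\<lambda>n. v n \<omega>) (\<lambda>n. s n \<omega>)"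

definition arrival :: "nat \<Rightarrow> 'a set" where
  "arrival n = {\<omega> \<in> space M. first \<omega> = enat n}"

lemma position_eq: "position l n \<omega> = pos 1 (Y \<omega>) n"
  by (simp add: position_def pos_def Y_simps)

lemma first_iff:
  assumes "\<omega> \<in> space M"
  shows "first \<omega> = enat n \<longleftrightarrow> 1 \<le> n \<and> clears_left (pos 1 (Y \<omega>)) (velocities (Y \<omega>)) (spins (Y \<omega>)) 1 n"
proof -
  note V = Y_valid[OF assms]
  interpret C: configuration "{1..}" "pos 1 (Y \<omega>)" "velocities (Y \<omega>)" "spins (Y \<omega>)"
    by (rule configuration_pos[OF V])
  have "0 < pos 1 (Y \<omega>) i" if "1 \<le> i" for i
    unfolding pos_def by (rule sum_pos) (use that validD(1)[OF V] in auto)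
  then show ?thesis
    using C.first_crossing_iff[OF order_refl] by (simp add: first_def position_eq Y_simps)
qed

lemma position_rv [measurable]: "position l n \<in> borel_measurable M"
proof -
  have "(\<lambda>\<omega>. l k \<omega>) \<in> borel_measurable M" if "1 \<le> k" for k
    using measurable_compose[OF law_l(1)[OF that], of "\<lambda>x. x" borel] laws_borel[of "Inl k"] by simp
  then have "(\<lambda>\<omega>. \<Sum>k=1..n. l k \<omega>) \<in> borel_measurable M" by (intro borel_measurable_sum) simp
  then show ?thesis by (simp add: position_def[abs_def])
qed

lemma weighted_annihilationI: "weighted_annihilation M p m l v s \<phi>"
  if "\<phi> \<in> borel_measurable borel" "\<And>y. norm (\<phi> y) \<le> 1" "\<And>y z. 0 \<le> y \<Longrightarrow> 0 \<le> z \<Longrightarrow> \<phi> (y + z) = \<phi> y * \<phi> z"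
  using that ballistic_annihilation_axioms
  by (simp add: weighted_annihilation_def weighted_annihilation_axioms_def)

lemma arrival_events [measurable]: "arrival n \<in> events"
proof (cases "1 \<le> n")
  case True
  interpret one: weighted_annihilation M p m l v s "\<lambda>_. 1" by (rule weighted_annihilationI) auto
  have "indices {1..n} \<subseteq> indices {1..}" by (rule indices_mono) auto
  from observable_rv[OF one.observable_cross this]
  have "(\<lambda>\<omega>. one.cross 1 n (Y \<omega>)) -` {1} \<inter> space M \<in> events"
    by (rule measurable_sets) simp
  moreover have "(\<lambda>\<omega>. one.cross 1 n (Y \<omega>)) -` {1} \<inter> space M = arrival n"
    using True by (auto simp: arrival_def first_iff one.cross_def split: if_splits)
  ultimately show ?thesis by simp
next
  case False
  then have "arrival n = {}" by (auto simp: arrival_def first_iff)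
  then show ?thesis by simp
qed

lemma arrival_disjoint: "disjoint_family arrival"
  by (auto simp: disjoint_family_on_def arrival_def)

lemma arrival_0: "arrival 0 = {}"
  by (auto simp: arrival_def first_iff)

lemma first_measurable: "first \<in> measurable M (count_space UNIV)"
proof (rule measurableI)
  fix A :: "enat set"
  have f: "first -` {enat n} \<inter> space M \<in> events" for n
    using arrival_events[of n] by (simp add: arrival_def Int_def conj_commute)
  have "first -` {\<infinity>} \<inter> space M = space M - (\<Union>n. first -` {enat n} \<inter> space M)" by auto
  also have "\<dots> \<in> events" using f by blast
  finally have "first -` {\<infinity>} \<inter> space M \<in> events" .
  then have "first -` {a} \<inter> space M \<in> events" for a using f by (cases a) auto
  then have "(\<Union>a\<in>A. first -` {a} \<inter> space M) \<in> events"
    by (intro sets.countable_UN') auto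
  moreover have "(\<Union>a\<in>A. first -` {a} \<inter> space M) = first -` A \<inter> space M" by auto
  ultimately show "first -` A \<inter> space M \<in> events" by simp
qed simp

end

context weighted_annihilation
begin

lemma \<alpha>_eq_arrival: "\<alpha> n = (\<integral>\<omega>. indicator (arrival n) \<omega> *\<^sub>R \<phi> (position l n \<omega>) \<partial>M)"
proof (cases "1 \<le> n")
  case True
  show ?thesis unfolding \<alpha>_def expct_def
    by (rule Bochner_Integration.integral_cong)
      (use True in \<open>auto simp: cross_def arrival_def first_iff position_eq indicator_def\<close>)
next
  case False
  then have "n = 0" by simp
  then show ?thesis by (simp add: arrival_0 \<alpha>_0)
qed

lemma expct_\<phi>_pos: "1 \<le> n \<Longrightarrow> expct (\<lambda>q. \<phi> (pos 1 q n)) = c ^ n"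
proof (induction n rule: dec_induct)
  case base
  then show ?case unfolding pos_same c_def by simp
next
  case (step n)
  have o: "observable (indices {k}) (\<lambda>q. \<phi> (lengths q k))" for k
    using observable_pos[of k k "{k}"] unfolding pos_same by simp
  have "expct (\<lambda>q. \<phi> (pos 1 q (Suc n))) = expct (\<lambda>q. \<phi> (pos 1 q n) * \<phi> (lengths q (Suc n)))"
  proof (rule expct_cong)
    fix q assume "valid q"
    from \<phi>_pos[OF this, of 1 n "Suc n"] step(1)
    show "\<phi> (pos 1 q (Suc n)) = \<phi> (pos 1 q n) * \<phi> (lengths q (Suc n))" by (simp add: pos_same)
  qed
  also have "\<dots> = expct (\<lambda>q. \<phi> (pos 1 q n)) * expct (\<lambda>q. \<phi> (lengths q (Suc n)))"
    by (rule expct_mult[OF observable_pos[OF order_refl] _ o]) (intro indices_mono indices_disjoint; auto)+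
  also have "expct (\<lambda>q. \<phi> (lengths q (Suc n))) = c"
  proof -
    have "c = expct (\<lambda>q. \<phi> (lengths (transform (\<lambda>i. i + n) (\<lambda>i. i) (\<lambda>_. 1) q) 1))"
      unfolding c_def by (rule expct_transform[OF o]) auto
    then show ?thesis by (simp add: transform_simps)
  qed
  finally show ?case using step.IH by simp
qed

text \<open>For \<open>\<phi> = 1\<close> the weight is the probability of \<open>A = n\<close> and \<open>c = 1\<close>.\<close>

lemma \<alpha>_scaling: "\<alpha> n = c ^ n * of_real (prob (arrival n))"
proof -
  interpret one: weighted_annihilation M p m l v s "\<lambda>_. 1" by (rule weighted_annihilationI) auto
  have "one.c = 1" by (simp add: one.c_def expct_def prob_space)
  then have "2 * one.\<alpha>_series = fps_X * quartic (of_real p) one.\<alpha>_series"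
    using one.\<alpha>_series_quartic by simp
  from quartic_solution_scales[OF \<alpha>_series_quartic this, of n]
  have "\<alpha> n = c ^ n * one.\<alpha> n" by (simp add: \<alpha>_series_def one.\<alpha>_series_def)
  also have "one.\<alpha> n = of_real (prob (arrival n))"
  proof -
    have "one.\<alpha> n = (\<integral>\<omega>. complex_of_real (indicator (arrival n) \<omega>) \<partial>M)"
      unfolding one.\<alpha>_eq_arrival by (rule Bochner_Integration.integral_cong) (auto simp: scaleR_conv_of_real)
    then show ?thesis by simp
  qed
  finally show ?thesis .
qed

lemma integral_arrival:
  assumes "1 \<le> n"
  shows "(\<integral>\<omega>. indicator (arrival n) \<omega> *\<^sub>R \<phi> (position l n \<omega>) \<partial>M)
    = of_real (prob (arrival n)) * (\<integral>\<omega>. \<phi> (position l n \<omega>) \<partial>M)"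
  using \<alpha>_scaling[of n] expct_\<phi>_pos[OF assms]
  by (simp add: \<alpha>_eq_arrival expct_def position_eq)

lemma \<alpha>_summable: "summable (\<lambda>n. norm (\<alpha> n))"
proof (rule summable_comparison_test')
  have "(\<lambda>n. prob (arrival n)) sums prob (\<Union>n. arrival n)"
    by (rule finite_measure_UNION) (use arrival_disjoint in auto)
  then show "summable (\<lambda>n. prob (arrival n))" by (rule sums_summable)
  have "norm (integral\<^sup>L M (\<lambda>\<omega>. \<phi> (lengths (Y \<omega>) 1))) \<le> (\<integral>\<omega>. norm (\<phi> (lengths (Y \<omega>) 1)) \<partial>M)"
    by (rule integral_norm_bound)
  also have "\<dots> \<le> (\<integral>\<omega>. 1 \<partial>M)"
    by (rule integral_mono')
      (auto simp: \<phi>_bounded)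
  finally have "norm c \<le> 1" by (simp add: c_def expct_def prob_space)
  then show "norm (norm (\<alpha> n)) \<le> prob (arrival n)" if "0 \<le> n" for n
    unfolding \<alpha>_scaling by (simp add: norm_mult norm_power power_le_one mult_left_le_one_le)
qed

end

context ballistic_annihilation
begin

text \<open>The characters \<open>\<phi>(y) = exp(i t y)\<close> show that conditioning on \<open>A = n\<close> does not change the characteristic
  function of \<open>x\<^sub>n\<close>.\<close>

lemma arrival_independent_of_position:
  assumes n: "1 \<le> n" and S: "S \<in> sets borel"
  shows "prob (arrival n \<inter> (position l n -` S \<inter> space M)) = prob (arrival n) * prob (position l n -` S \<inter> space M)"
proof (cases "prob (arrival n) = 0")
  case True
  have "prob (arrival n \<inter> (position l n -` S \<inter> space M)) \<le> prob (arrival n)"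
    by (rule finite_measure_mono) auto
  then show ?thesis using True measure_nonneg[of M "arrival n \<inter> (position l n -` S \<inter> space M)"] by simp
next
  case False
  let ?X = "position l n" and ?E = "arrival n"
  let ?U = "uniform_measure M ?E"
  have pE: "0 < prob ?E" using False by (simp add: zero_less_measure_iff)
  have X: "?X \<in> borel_measurable M" by (rule position_rv)
  have XU: "?X \<in> borel_measurable ?U" using X by simp
  interpret U: prob_space ?U
    by (rule prob_space_uniform_measure) (use pE in \<open>auto simp: emeasure_eq_measure\<close>)
  have "char (distr ?U borel ?X) = char (distr M borel ?X)"
  proof
    fix t :: real
    have it: "weighted_annihilation M p m l v s (\<lambda>y. iexp (t * y))"
      by (rule weighted_annihilationI) (auto simp: distrib_left exp_add[symmetric] algebra_simps)
    have U: "?U = density M (\<lambda>\<omega>. ennreal (indicator ?E \<omega> / prob ?E))"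
      unfolding uniform_measure_def
      by (rule density_cong)
        (use pE in \<open>auto simp: emeasure_eq_measure indicator_def divide_ennreal simp flip: ennreal_1\<close>)
    have "char (distr ?U borel ?X) t = (\<integral>\<omega>. iexp (t * ?X \<omega>) \<partial>?U)"
      unfolding char_def by (rule integral_distr[OF XU]) simp
    also have "\<dots> = (\<integral>\<omega>. (indicator ?E \<omega> / prob ?E) *\<^sub>R iexp (t * ?X \<omega>) \<partial>M)"
      unfolding U by (rule integral_density) (use X in auto)
    also have "\<dots> = (\<integral>\<omega>. (indicator ?E \<omega> *\<^sub>R iexp (t * ?X \<omega>)) / of_real (prob ?E) \<partial>M)"
      by (rule Bochner_Integration.integral_cong) (auto simp: scaleR_conv_of_real)
    also have "\<dots> = (\<integral>\<omega>. indicator ?E \<omega> *\<^sub>R iexp (t * ?X \<omega>) \<partial>M) / of_real (prob ?E)"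
      by simp
    also have "\<dots> = (\<integral>\<omega>. iexp (t * ?X \<omega>) \<partial>M)"
      using weighted_annihilation.integral_arrival[OF it n] pE by simp
    also have "\<dots> = char (distr M borel ?X) t"
      unfolding char_def by (rule integral_distr[OF X, symmetric]) simp
    finally show "char (distr ?U borel ?X) t = char (distr M borel ?X) t" .
  qed
  then have "distr ?U borel ?X = distr M borel ?X"
    by (intro Levy_uniqueness) (auto simp: real_distribution_def real_distribution_axioms_def
        intro!: prob_space_distr U.prob_space_distr X XU)
  then have "measure (distr ?U borel ?X) S = measure (distr M borel ?X) S" by simp
  then have "prob (?E \<inter> (?X -` S \<inter> space M)) / prob ?E = prob (?X -` S \<inter> space M)"
    using measurable_sets[OF X S] pE
    by (simp add: measure_distr[OF XU S] measure_distr[OF X S] measure_uniform_measure emeasure_eq_measure)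
  then show ?thesis using pE by (simp add: field_simps)
qed

lemma law_of_copy:
  assumes x': "independent_copy M (position l) first x'" and n: "1 \<le> n"
  shows "x' n \<in> borel_measurable M"
    and "\<And>S. S \<in> sets borel \<Longrightarrow> prob (arrival n \<inter> (x' n -` S \<inter> space M)) = prob (arrival n) * prob (position l n -` S \<inter> space M)"
proof -
  define P where "P = Pi\<^sub>M {1::nat..} (\<lambda>_. borel :: real measure)"
  define X X' where "X = (\<lambda>\<omega>. \<lambda>n\<in>{1..}. position l n \<omega>)" and "X' = (\<lambda>\<omega>. \<lambda>n\<in>{1..}. x' n \<omega>)"
  have X': "X' \<in> measurable M P" and law: "distr M P X' = distr M P X"
    and ind: "indep_set (sets (vimage_algebra (space M) first (count_space UNIV)))
      (sets (vimage_algebra (space M) X' P))"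
    using x' by (auto simp: independent_copy_def Let_def X_def X'_def P_def)
  have X: "X \<in> measurable M P" unfolding X_def P_def by (intro measurable_restrict position_rv)
  have coord: "(\<lambda>f. f n) \<in> borel_measurable P" unfolding P_def by (rule measurable_component_singleton) (use n in simp)
  have e: "x' n = (\<lambda>\<omega>. X' \<omega> n)" "position l n = (\<lambda>\<omega>. X \<omega> n)" using n by (auto simp: X_def X'_def fun_eq_iff)
  show m: "x' n \<in> borel_measurable M" unfolding e(1) by (rule measurable_compose[OF X' coord])
  fix S :: "real set" assume S: "S \<in> sets borel"
  define C where "C = (\<lambda>f. f n) -` S \<inter> space P"
  have C: "C \<in> sets P" unfolding C_def by (rule measurable_sets[OF coord S])
  have c': "x' n -` S \<inter> space M = X' -` C \<inter> space M"
    using measurable_space[OF X'] by (auto simp: C_def e(1))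
  have c: "position l n -` S \<inter> space M = X -` C \<inter> space M"
    using measurable_space[OF X] by (auto simp: C_def e(2))
  have "prob (arrival n \<inter> (X' -` C \<inter> space M)) = prob (arrival n) * prob (X' -` C \<inter> space M)"
  proof (rule indep_setD[OF ind])
    have "first -` {enat n} \<inter> space M \<in> sets (vimage_algebra (space M) first (count_space UNIV))"
      by (rule in_vimage_algebra) simp
    moreover have "first -` {enat n} \<inter> space M = arrival n" by (auto simp: arrival_def)
    ultimately show "arrival n \<in> sets (vimage_algebra (space M) first (count_space UNIV))" by simp
    show "X' -` C \<inter> space M \<in> sets (vimage_algebra (space M) X' P)"
      by (rule in_vimage_algebra[OF C])
  qed
  also have "prob (X' -` C \<inter> space M) = prob (X -` C \<inter> space M)"
    using arg_cong[OF law, of "\<lambda>N. measure N C"] by (simp add: measure_distr[OF X' C] measure_distr[OF X C])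
  finally show "prob (arrival n \<inter> (x' n -` S \<inter> space M)) = prob (arrival n) * prob (position l n -` S \<inter> space M)"
    unfolding c c' .
qed

text \<open>The law at the first crossing involves \<open>y\<close> only through the laws of \<open>y n\<close> given \<open>A = n\<close>, so it is the same
  for the positions and for an independent copy.\<close>

lemma distribution_at_first:
  fixes y :: "nat \<Rightarrow> 'a \<Rightarrow> real"
  defines "F \<equiv> {\<omega> \<in> space M. first \<omega> < \<infinity>}" and "S \<equiv> count_space UNIV \<Otimes>\<^sub>M borel"
  assumes y: "\<And>n. 1 \<le> n \<Longrightarrow> y n \<in> borel_measurable M"
    and ind: "\<And>n S. 1 \<le> n \<Longrightarrow> S \<in> sets borel \<Longrightarrow>
      prob (arrival n \<inter> (y n -` S \<inter> space M)) = prob (arrival n) * prob (position l n -` S \<inter> space M)"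
    and B: "B \<in> sets S"
  shows "emeasure (distr (uniform_measure M F) S (\<lambda>\<omega>. (first \<omega>, value_at (\<lambda>n. y n \<omega>) (first \<omega>)))) B
    = (\<Sum>n. ennreal (prob (arrival n) * prob (position l n -` {z. (enat n, ereal z) \<in> B} \<inter> space M))) / emeasure M F"
proof -
  let ?f = "\<lambda>\<omega>. (first \<omega>, value_at (\<lambda>n. y n \<omega>) (first \<omega>))"
  have F: "F = (\<Union>n. arrival n)" by (auto simp: F_def arrival_def)
  have Fs: "F \<in> events" unfolding F by auto
  define y' where "y' n = (if 1 \<le> n then y n else (\<lambda>_. 0))" for n
  have y': "y' n \<in> borel_measurable M" for n using y by (simp add: y'_def)
  note [measurable] = first_measurable y'
  have "(\<lambda>\<omega>. value_at (\<lambda>n. y n \<omega>) (first \<omega>)) \<in> borel_measurable M"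
  proof -
    have "(\<lambda>\<omega>. case a of enat n \<Rightarrow> ereal (y' n \<omega>) | \<infinity> \<Rightarrow> \<infinity>) \<in> borel_measurable M" for a
      by (cases a) auto
    then have "(\<lambda>\<omega>. (\<lambda>a \<omega>. case a of enat n \<Rightarrow> ereal (y' n \<omega>) | \<infinity> \<Rightarrow> \<infinity>) (first \<omega>) \<omega>) \<in> borel_measurable M"
      by (rule measurable_compose_countable[OF _ first_measurable])
    moreover have "value_at (\<lambda>n. y n \<omega>) (first \<omega>)
      = (case first \<omega> of enat n \<Rightarrow> ereal (y' n \<omega>) | \<infinity> \<Rightarrow> \<infinity>)" if "\<omega> \<in> space M" for \<omega>
    proof (cases "first \<omega>")
      case (enat n)
      then have "1 \<le> n" using first_iff[OF that, of n] by simp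
      then show ?thesis using enat by (simp add: value_at_def y'_def)
    qed (simp add: value_at_def)
    ultimately show ?thesis by (simp cong: measurable_cong)
  qed
  then have f: "?f \<in> measurable M S" unfolding S_def by (intro measurable_Pair first_measurable)
  have fU: "?f \<in> measurable (uniform_measure M F) S" using f by simp
  have Bn: "{z. (enat n, ereal z) \<in> B} \<in> sets borel" for n
  proof -
    have "(\<lambda>z. (enat n, ereal z)) \<in> measurable borel S" unfolding S_def by measurable
    from measurable_sets[OF this B] show ?thesis by (simp add: vimage_def)
  qed
  define E where "E n = arrival n \<inter> (y' n -` {z. (enat n, ereal z) \<in> B} \<inter> space M)" for n
  have E: "E n \<in> events" for n
    unfolding E_def using measurable_sets[OF y' Bn] by auto
  have PE: "emeasure M (E n) = ennreal (prob (arrival n) * prob (position l n -` {z. (enat n, ereal z) \<in> B} \<inter> space M))" for n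
  proof (cases "1 \<le> n")
    case True
    then show ?thesis unfolding emeasure_eq_measure E_def using ind[OF True Bn] by (simp add: y'_def)
  next
    case False
    then have "n = 0" by simp
    then show ?thesis by (simp add: E_def arrival_0)
  qed
  have "F \<inter> (?f -` B \<inter> space M) = (\<Union>n. E n)"
    unfolding F E_def arrival_def using first_iff by (fastforce simp: value_at_def y'_def)
  moreover have "(\<Sum>n. emeasure M (E n)) = emeasure M (\<Union>n. E n)"
    by (rule suminf_emeasure) (use E arrival_disjoint in \<open>auto simp: disjoint_family_on_def E_def\<close>)
  ultimately have e: "emeasure M (F \<inter> (?f -` B \<inter> space M)) = (\<Sum>n. emeasure M (E n))" by simp
  have "emeasure (distr (uniform_measure M F) S ?f) B = emeasure (uniform_measure M F) (?f -` B \<inter> space M)"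
    by (subst emeasure_distr[OF fU B]) simp
  also have "\<dots> = emeasure M (F \<inter> (?f -` B \<inter> space M)) / emeasure M F"
    by (rule emeasure_uniform_measure[OF Fs measurable_sets[OF f B]])
  finally show ?thesis unfolding e PE .
qed

text \<open>The exponential weight is taken at \<open>\<bar>y\<bar>\<close> to be bounded on the whole line; the positions are nonnegative.\<close>

lemma laplace_equation:
  fixes u :: real
  assumes u: "0 \<le> u"
  defines "Ll \<equiv> \<integral>\<omega>. exp (- u * position l 1 \<omega>) \<partial>M"
    and "D \<equiv> \<lambda>\<omega>. value_at (\<lambda>n. position l n \<omega>) (first \<omega>)"
  defines "LD \<equiv> \<integral>\<omega>. exp (- u * real_of_ereal (D \<omega>)) * indicator {\<omega>. D \<omega> < \<infinity>} \<omega> \<partial>M"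
  shows "p * Ll * LD ^ 4 - (1 + 2 * p) * Ll * LD ^ 2 + 2 * LD - (1 - p) * Ll = 0"
proof -
  let ?\<phi> = "\<lambda>y. complex_of_real (exp (- u * \<bar>y\<bar>))"
  interpret w: weighted_annihilation M p m l v s ?\<phi>
    by (rule weighted_annihilationI) (use u in \<open>auto simp: distrib_left exp_add[symmetric] simp flip: of_real_mult\<close>)
  have c: "w.c = of_real Ll"
  proof -
    have "w.c = (\<integral>\<omega>. complex_of_real (exp (- u * position l 1 \<omega>)) \<partial>M)"
      unfolding w.c_def expct_def
    proof (rule Bochner_Integration.integral_cong[OF refl])
      fix \<omega> assume "\<omega> \<in> space M"
      then have "0 < lengths (Y \<omega>) 1" using validD(1)[OF Y_valid, of \<omega> 1] by simp
      then show "?\<phi> (lengths (Y \<omega>) 1) = complex_of_real (exp (- u * position l 1 \<omega>))"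
        unfolding position_eq pos_same by simp
    qed
    then show ?thesis by (simp add: Ll_def)
  qed
  have D: "exp (- u * real_of_ereal (D \<omega>)) * indicator {\<omega>. D \<omega> < \<infinity>} \<omega>
    = (\<Sum>n. indicator (arrival n) \<omega> *\<^sub>R exp (- u * position l n \<omega>))" if \<omega>: "\<omega> \<in> space M" for \<omega>
  proof (cases "first \<omega>")
    case (enat n)
    have "(\<Sum>k. indicator (arrival k) \<omega> *\<^sub>R exp (- u * position l k \<omega>))
      = (\<Sum>k\<in>{n}. indicator (arrival k) \<omega> *\<^sub>R exp (- u * position l k \<omega>))"
      by (rule suminf_finite) (auto simp: arrival_def enat)
    then show ?thesis using \<omega> by (simp add: D_def value_at_def enat arrival_def)
  next
    case infinity
    then show ?thesis by (simp add: D_def value_at_def arrival_def)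
  qed
  let ?f = "\<lambda>n \<omega>. indicator (arrival n) \<omega> *\<^sub>R exp (- u * position l n \<omega>)"
  have nonneg: "0 \<le> position l n \<omega>" if "\<omega> \<in> space M" for n \<omega>
    unfolding position_eq by (rule pos_nonneg[OF Y_valid[OF that]]) simp
  have int: "integrable M (?f n)" for n
  proof (rule integrable_const_bound[where B = 1])
    show "AE \<omega> in M. norm (?f n \<omega>) \<le> 1"
      by (rule AE_I2) (use nonneg u in \<open>auto simp: indicator_def\<close>)
  qed measurable
  have f_nonneg: "0 \<le> (\<integral>\<omega>. ?f n \<omega> \<partial>M)" for n
    by (rule Bochner_Integration.integral_nonneg) auto
  have val: "w.\<alpha> n = of_real (\<integral>\<omega>. ?f n \<omega> \<partial>M)" for n
  proof -
    have "w.\<alpha> n = (\<integral>\<omega>. complex_of_real (?f n \<omega>) \<partial>M)"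
      unfolding w.\<alpha>_eq_arrival
      by (rule Bochner_Integration.integral_cong) (use nonneg in \<open>auto simp: scaleR_conv_of_real\<close>)
    then show ?thesis by (simp only: integral_complex_of_real)
  qed
  have "norm (w.\<alpha> n) = (\<integral>\<omega>. ?f n \<omega> \<partial>M)" for n
    unfolding val using f_nonneg[of n] by (simp only: norm_of_real abs_of_nonneg)
  then have sm: "summable (\<lambda>n. \<integral>\<omega>. ?f n \<omega> \<partial>M)" using w.\<alpha>_summable by simp
  have "LD = (\<integral>\<omega>. (\<Sum>n. ?f n \<omega>) \<partial>M)"
    unfolding LD_def by (rule Bochner_Integration.integral_cong[OF refl D])
  also have "\<dots> = (\<Sum>n. \<integral>\<omega>. ?f n \<omega> \<partial>M)"
  proof (rule integral_suminf[OF int])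
    have "summable (\<lambda>n. norm (?f n \<omega>))" for \<omega>
    proof (cases "first \<omega>")
      case (enat k)
      show ?thesis by (rule summable_finite[of "{k}"]) (auto simp: arrival_def enat)
    next
      case infinity
      show ?thesis by (rule summable_finite[of "{}"]) (auto simp: arrival_def infinity)
    qed
    then show "AE \<omega> in M. summable (\<lambda>n. norm (?f n \<omega>))" by simp
    have "(\<integral>\<omega>. norm (?f n \<omega>) \<partial>M) = (\<integral>\<omega>. ?f n \<omega> \<partial>M)" for n
      by (rule Bochner_Integration.integral_cong) auto
    then show "summable (\<lambda>n. \<integral>\<omega>. norm (?f n \<omega>) \<partial>M)" using sm by simp
  qed
  finally have "complex_of_real LD = (\<Sum>n. of_real (\<integral>\<omega>. ?f n \<omega> \<partial>M))"
    using suminf_of_real[OF sm] by simp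
  then have F: "of_real LD = (\<Sum>n. fps_nth w.\<alpha>_series n)"
    by (simp only: w.\<alpha>_series_def fps_nth_Abs_fps val)
  have "2 * of_real LD = w.c * ((1 - of_real p) + (1 + 2 * of_real p) * of_real LD ^ 2 - of_real p * of_real LD ^ 4)"
    unfolding F by (rule quartic_solution_sum[OF w.\<alpha>_series_quartic]) (simp only: w.\<alpha>_series_def fps_nth_Abs_fps w.\<alpha>_summable)
  then have "complex_of_real (2 * LD) = of_real (Ll * ((1 - p) + (1 + 2 * p) * LD ^ 2 - p * LD ^ 4))"
    unfolding c by simp
  then have "2 * LD = Ll * ((1 - p) + (1 + 2 * p) * LD ^ 2 - p * LD ^ 4)" by (simp only: of_real_eq_iff)
  then show ?thesis by (simp add: algebra_simps)
qed

end

theorem corollary3: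
  fixes M :: "'a measure" and p :: real and m :: "real measure"
    and l v s x :: "nat \<Rightarrow> 'a \<Rightarrow> real" and A :: "'a \<Rightarrow> enat" and D :: "'a \<Rightarrow> ereal"
    and L\<^sub>l L\<^sub>D :: "real \<Rightarrow> real"
  assumes model: "ballistic_annihilation M p m l v s"
    and x: "x = position l"
    and A: "A = (\<lambda>\<omega>. first_crossing (\<lambda>n. x n \<omega>) (\<lambda>n. v n \<omega>) (\<lambda>n. s n \<omega>))"
    and D: "D = (\<lambda>\<omega>. value_at (\<lambda>n. x n \<omega>) (A \<omega>))"
    and L\<^sub>l: "L\<^sub>l = (\<lambda>u. \<integral>\<omega>. exp (- u * x 1 \<omega>) \<partial>M)"
    and L\<^sub>D: "L\<^sub>D = (\<lambda>u. \<integral>\<omega>. exp (- u * real_of_ereal (D \<omega>)) * indicator {\<omega>. D \<omega> < \<infinity>} \<omega> \<partial>M)"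
  shows "A \<in> measurable M (count_space UNIV) \<and>
    (let F = {\<omega> \<in> space M. A \<omega> < \<infinity>}; S = count_space UNIV \<Otimes>\<^sub>M borel in
      measure M F > 0 \<longrightarrow>
        (\<forall>x'. independent_copy M x A x' \<longrightarrow>
          distr (uniform_measure M F) S (\<lambda>\<omega>. (A \<omega>, value_at (\<lambda>n. x n \<omega>) (A \<omega>)))
          = distr (uniform_measure M F) S (\<lambda>\<omega>. (A \<omega>, value_at (\<lambda>n. x' n \<omega>) (A \<omega>))))) \<and>
    (\<forall>u\<ge>0. p * L\<^sub>l u * L\<^sub>D u ^ 4 - (1 + 2 * p) * L\<^sub>l u * L\<^sub>D u ^ 2 + 2 * L\<^sub>D u
      - (1 - p) * L\<^sub>l u = 0)"
proof -
  interpret ballistic_annihilation M p m l v s by (rule model)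
  have A': "A = first" by (simp add: A x first_def fun_eq_iff)
  have "distr (uniform_measure M {\<omega> \<in> space M. first \<omega> < \<infinity>}) (count_space UNIV \<Otimes>\<^sub>M borel)
      (\<lambda>\<omega>. (first \<omega>, value_at (\<lambda>n. position l n \<omega>) (first \<omega>)))
    = distr (uniform_measure M {\<omega> \<in> space M. first \<omega> < \<infinity>}) (count_space UNIV \<Otimes>\<^sub>M borel)
      (\<lambda>\<omega>. (first \<omega>, value_at (\<lambda>n. x' n \<omega>) (first \<omega>)))"
    if "independent_copy M (position l) first x'" for x'
  proof (rule measure_eqI)
    fix B assume "B \<in> sets (distr (uniform_measure M {\<omega> \<in> space M. first \<omega> < \<infinity>})
      (count_space UNIV \<Otimes>\<^sub>M borel) (\<lambda>\<omega>. (first \<omega>, value_at (\<lambda>n. position l n \<omega>) (first \<omega>))))"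
    then have B: "B \<in> sets (count_space UNIV \<Otimes>\<^sub>M borel)" by simp
    show "emeasure (distr (uniform_measure M {\<omega> \<in> space M. first \<omega> < \<infinity>}) (count_space UNIV \<Otimes>\<^sub>M borel)
        (\<lambda>\<omega>. (first \<omega>, value_at (\<lambda>n. position l n \<omega>) (first \<omega>)))) B
      = emeasure (distr (uniform_measure M {\<omega> \<in> space M. first \<omega> < \<infinity>}) (count_space UNIV \<Otimes>\<^sub>M borel)
        (\<lambda>\<omega>. (first \<omega>, value_at (\<lambda>n. x' n \<omega>) (first \<omega>)))) B"
      by (rule trans[OF distribution_at_first[of "position l"] distribution_at_first[of x', symmetric]])
        (use B law_of_copy[OF that] position_rv arrival_independent_of_position in auto)
  qed simp
  moreover have "first \<in> measurable M (count_space UNIV)" by (rule first_measurable)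
  ultimately show ?thesis
    unfolding L\<^sub>l L\<^sub>D D A' x Let_def using laplace_equation by auto
qed

end
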